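(* Let $\mathcal{A}$ and $\mathcal{B}$ be operator algebras with $c_0$-isomorphic diagonals. If $\mathcal{A}\otimes\mathcal{K}$ and $\mathcal{B}\otimes\mathcal{K}$ are isometrically isomorphic, then $\mathcal{A}$ and $\mathcal{B}$ are isometrically isomorphic.
   Context: An operator algebra is a norm-closed (not necessarily selfadjoint) subalgebra of $B(\mathcal{H}_0)$ for some Hilbert space $\mathcal{H}_0$, acting non-degenerately. The diagonal of an operator algebra $\mathcal{A}$ is the $\mathrm{C}^*$-algebra $\operatorname{diag}\mathcal{A}:=\mathcal{A}\cap\mathcal{A}^*$ (it does not depend on the isometric representation). Standing assumption: every operator algebra has a contractive approximate unit contained in its diagonal. An operator algebra $\mathcal{A}$ has a $c_0$-isomorphic diagonal if there is a (possibly finite) set $\Gamma$ such that $\operatorname{diag}\mathcal{A}$ is $*$-isomorphic to $c_0(\Gamma)$. $\mathcal{K}$ denotes the compact operators on a fixed infinite-dimensional separable Hilbert space $\mathcal{H}$. For operator algebras $\mathcal{A}_i\subseteq B(\mathcal{H}_i)$, $i=1,2$, $\mathcal{A}_1\otimes\mathcal{A}_2$ is the spatial tensor product: the norm-closed subalgebra of $B(\mathcal{H}_1\otimes\mathcal{H}_2)$ generated by the elementary tensors $a_1\otimes a_2$, $a_i\in\mathcal{A}_i$. Isometrically isomorphic means that there is a surjective algebra isomorphism that is isometric. *)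

theory Defs
  imports "HOL-Analysis.Analysis"
begin

class complex_vector = real_vector +
  fixes scaleC :: "complex \<Rightarrow> 'a \<Rightarrow> 'a" (infixr "*\<^sub>C" 75)
  assumes scaleC_add_right: "c *\<^sub>C (x + y) = c *\<^sub>C x + c *\<^sub>C y"
    and scaleC_add_left: "(c + d) *\<^sub>C x = c *\<^sub>C x + d *\<^sub>C x"
    and scaleC_scaleC [simp]: "c *\<^sub>C d *\<^sub>C x = (c * d) *\<^sub>C x"
    and scaleC_one [simp]: "1 *\<^sub>C x = x"
    and scaleR_scaleC: "r *\<^sub>R x = complex_of_real r *\<^sub>C x"

global_interpretation complex_vector: vector_space "scaleC :: complex \<Rightarrow> 'a \<Rightarrow> 'a::complex_vector"
  defines csubspace = complex_vector.subspace
    and cspan = complex_vector.span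
  by unfold_locales (simp_all add: scaleC_add_right scaleC_add_left)

class complex_normed_vector = complex_vector + real_normed_vector +
  assumes norm_scaleC [simp]: "norm (c *\<^sub>C x) = cmod c * norm x"

lemma scaleC_scaleR: "c *\<^sub>C (r *\<^sub>R x) = r *\<^sub>R (c *\<^sub>C x)"
  by (simp add: scaleR_scaleC mult.commute)

text \<open>Inner products are conjugate-linear in the first argument. Positive definiteness
  follows from the equation for the norm.\<close>

class chilbert_space = complex_normed_vector + complete_space +
  fixes cinner :: "'a \<Rightarrow> 'a \<Rightarrow> complex"
  assumes cinner_commute: "cinner x y = cnj (cinner y x)"
    and cinner_add_right: "cinner x (y + z) = cinner x y + cinner x z"
    and cinner_scaleC_right [simp]: "cinner x (c *\<^sub>C y) = c * cinner x y"
    and norm_sq_cinner: "(norm x)\<^sup>2 = Re (cinner x x)"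

lemma cinner_add_left: "cinner (x + y) z = cinner x z + cinner y z"
  by (metis cinner_add_right cinner_commute complex_cnj_add)

lemma cinner_scaleC_left [simp]: "cinner (c *\<^sub>C x) y = cnj c * cinner x y"
  by (metis cinner_commute cinner_scaleC_right complex_cnj_mult)

lemma cinner_zero [simp]: "cinner x 0 = 0" "cinner 0 x = 0"
  using cinner_add_right[of x 0 0] cinner_add_left[of 0 0 x] by auto

lemma cinner_minus_right [simp]: "cinner x (- y) = - cinner x y"
  using cinner_add_right[of x y "-y"] by (simp add: eq_neg_iff_add_eq_0 add.commute)

lemma cinner_minus_left [simp]: "cinner (- x) y = - cinner x y"
  using cinner_add_left[of x "-x" y] by (simp add: eq_neg_iff_add_eq_0 add.commute)

lemma cinner_diff_right: "cinner x (y - z) = cinner x y - cinner x z"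
  using cinner_add_right[of x y "-z"] by simp

lemma cinner_diff_left: "cinner (x - y) z = cinner x z - cinner y z"
  using cinner_add_left[of x "-y" z] by simp

lemma cinner_sum_right: "cinner x (\<Sum>i\<in>I. f i) = (\<Sum>i\<in>I. cinner x (f i))"
  by (induction I rule: infinite_finite_induct) (auto simp: cinner_add_right)

lemma cinner_self: "cinner x x = complex_of_real ((norm x)\<^sup>2)"
proof -
  have "Im (cinner x x) = 0"
    using arg_cong[OF cinner_commute[of x x], of Im] by simp
  then show ?thesis by (simp add: complex_eq_iff norm_sq_cinner)
qed

instantiation blinfun :: (complex_normed_vector, complex_normed_vector) complex_normed_vector
begin

lift_definition scaleC_blinfun :: "complex \<Rightarrow> ('a \<Rightarrow>\<^sub>L 'b) \<Rightarrow> ('a \<Rightarrow>\<^sub>L 'b)"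
  is "\<lambda>c f x. c *\<^sub>C f x"
proof -
  fix c :: complex and f :: "'a \<Rightarrow> 'b"
  assume "bounded_linear f"
  then interpret bounded_linear f .
  obtain K where K: "\<And>x. norm (f x) \<le> norm x * K" using bounded by blast
  show "bounded_linear (\<lambda>x. c *\<^sub>C f x)"
  proof (rule bounded_linear_intro[where K = "cmod c * K"])
    fix x
    have "cmod c * norm (f x) \<le> cmod c * (norm x * K)"
      by (intro mult_left_mono K) auto
    then show "norm (c *\<^sub>C f x) \<le> norm x * (cmod c * K)" by (simp add: mult_ac)
  qed (simp_all add: add scale scaleC_add_right scaleC_scaleR)
qed

instance
proof
  fix c d :: complex and r :: real and S T :: "'a \<Rightarrow>\<^sub>L 'b"
  show "c *\<^sub>C (S + T) = c *\<^sub>C S + c *\<^sub>C T"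
    by transfer (simp add: scaleC_add_right)
  show "(c + d) *\<^sub>C S = c *\<^sub>C S + d *\<^sub>C S"
    by transfer (simp add: scaleC_add_left)
  show "c *\<^sub>C d *\<^sub>C S = (c * d) *\<^sub>C S"
    by transfer simp
  show "1 *\<^sub>C S = S"
    by transfer simp
  show "r *\<^sub>R S = complex_of_real r *\<^sub>C S"
    by transfer (simp add: scaleR_scaleC)
  have le: "norm (c *\<^sub>C T) \<le> cmod c * norm T" for c and T :: "'a \<Rightarrow>\<^sub>L 'b"
  proof (rule norm_blinfun_bound)
    fix x
    have "norm (blinfun_apply (c *\<^sub>C T) x) = cmod c * norm (blinfun_apply T x)"
      by (simp add: scaleC_blinfun.rep_eq)
    also have "\<dots> \<le> cmod c * (norm T * norm x)"
      by (intro mult_left_mono norm_blinfun) auto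
    finally show "norm (blinfun_apply (c *\<^sub>C T) x) \<le> cmod c * norm T * norm x" by simp
  qed auto
  show "norm (c *\<^sub>C T) = cmod c * norm T"
  proof (cases "c = 0")
    case True
    have "0 *\<^sub>C T = 0" by transfer simp
    then show ?thesis using True by simp
  next
    case False
    have "inverse c *\<^sub>C c *\<^sub>C T = T"
      using False by transfer simp
    then have "norm T \<le> inverse (cmod c) * norm (c *\<^sub>C T)"
      using le[of "inverse c" "c *\<^sub>C T"] by (simp add: norm_inverse)
    then have "cmod c * norm T \<le> norm (c *\<^sub>C T)"
      using False by (simp add: field_simps)
    then show ?thesis using le[of c T] by simp
  qed
qed

end

definition clinear :: "('a::complex_vector \<Rightarrow> 'b::complex_vector) \<Rightarrow> bool" where
  "clinear f \<longleftrightarrow> (\<forall>x y. f (x + y) = f x + f y) \<and> (\<forall>c x. f (c *\<^sub>C x) = c *\<^sub>C f x)"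


text \<open>
  The Hilbert space tensor product is the completion of the algebraic tensor product. A list
  \<open>[(x\<^sub>1, y\<^sub>1), \<dots>, (x\<^sub>n, y\<^sub>n)]\<close> stands for the formal sum of the \<open>x\<^sub>i \<otimes> y\<^sub>i\<close>, and
  \<open>ft_inner\<close> is the form determined by
  \<open>\<langle>x \<otimes> y, x' \<otimes> y'\<rangle> = \<langle>x, x'\<rangle> \<langle>y, y'\<rangle>\<close>. The type \<open>htensor\<close> below consists of the Cauchy sequences
  of such formal sums, modulo sequences tending to zero in the induced seminorm; this
  quotient performs the identification of formal sums with algebraic tensors as well.
\<close>

definition ft_inner :: "('a::chilbert_space \<times> 'b::chilbert_space) list \<Rightarrow> ('a \<times> 'b) list \<Rightarrow> complex"
  where "ft_inner L M =
    (\<Sum>p\<leftarrow>L. \<Sum>q\<leftarrow>M. cinner (fst p) (fst q) * cinner (snd p) (snd q))"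

definition ft_scale :: "complex \<Rightarrow> ('a::chilbert_space \<times> 'b::chilbert_space) list \<Rightarrow> ('a \<times> 'b) list"
  where "ft_scale c L = map (apfst (scaleC c)) L"

definition ft_diff :: "('a::chilbert_space \<times> 'b::chilbert_space) list \<Rightarrow> ('a \<times> 'b) list \<Rightarrow> ('a \<times> 'b) list"
  where "ft_diff L M = L @ ft_scale (- 1) M"

definition ft_norm :: "('a::chilbert_space \<times> 'b::chilbert_space) list \<Rightarrow> real"
  where "ft_norm L = sqrt (Re (ft_inner L L))"

lemma sum_list_cnj: "cnj (\<Sum>x\<leftarrow>L. f x) = (\<Sum>x\<leftarrow>L. cnj (f x))"
  by (induction L) auto

lemma sum_list_add: "(\<Sum>x\<leftarrow>L. f x + g x) = (\<Sum>x\<leftarrow>L. f x) + (\<Sum>x\<leftarrow>L. g x :: 'c::comm_monoid_add)"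
  by (induction L) (auto simp: algebra_simps)

lemma sum_list_swap: "(\<Sum>x\<leftarrow>L. \<Sum>y\<leftarrow>M. f x y) = (\<Sum>y\<leftarrow>M. \<Sum>x\<leftarrow>L. f x y :: 'c::comm_monoid_add)"
  by (induction L) (auto simp: sum_list_add)

lemma ft_inner_append [simp]:
  "ft_inner (L @ L') M = ft_inner L M + ft_inner L' M"
  "ft_inner M (L @ L') = ft_inner M L + ft_inner M L'"
  by (auto simp: ft_inner_def sum_list_add)

lemma ft_inner_Nil [simp]: "ft_inner [] M = 0" "ft_inner M [] = 0"
  by (auto simp: ft_inner_def)

lemma ft_inner_scale [simp]:
  "ft_inner (ft_scale c L) M = cnj c * ft_inner L M"
  "ft_inner M (ft_scale c L) = c * ft_inner M L"
  by (auto simp: ft_inner_def ft_scale_def sum_list_const_mult[symmetric] o_def mult_ac)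

lemma ft_inner_diff [simp]:
  "ft_inner (ft_diff L L') M = ft_inner L M - ft_inner L' M"
  "ft_inner M (ft_diff L L') = ft_inner M L - ft_inner M L'"
  by (auto simp: ft_diff_def)

lemma ft_inner_commute: "ft_inner L M = cnj (ft_inner M L)"
  unfolding ft_inner_def
  by (subst sum_list_swap) (simp add: sum_list_cnj cinner_commute[symmetric])

definition cbilin :: "('a::complex_vector \<Rightarrow> 'b::complex_vector \<Rightarrow> complex) \<Rightarrow> bool" where
  "cbilin \<beta> \<longleftrightarrow> (\<forall>x x' y. \<beta> (x + x') y = \<beta> x y + \<beta> x' y) \<and> (\<forall>c x y. \<beta> (c *\<^sub>C x) y = c * \<beta> x y)
    \<and> (\<forall>x y y'. \<beta> x (y + y') = \<beta> x y + \<beta> x y') \<and> (\<forall>c x y. \<beta> x (c *\<^sub>C y) = c * \<beta> x y)"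

lemma cbilin_sum:
  assumes "cbilin \<beta>"
  shows "\<beta> x (\<Sum>i\<in>I. f i) = (\<Sum>i\<in>I. \<beta> x (f i))"
proof -
  have "\<beta> x 0 = 0" using assms unfolding cbilin_def
    by (metis complex_vector.scale_zero_left mult_zero_left)
  then show ?thesis using assms
    by (induction I rule: infinite_finite_induct) (auto simp: cbilin_def)
qed

lemma ft_orthonormal_form:
  fixes L :: "('a::chilbert_space \<times> 'b::chilbert_space) list"
  shows "\<exists>E z. finite E \<and> (\<forall>f\<in>E. \<forall>g\<in>E. cinner f g = (if f = g then 1 else 0)) \<and>
    (\<forall>\<beta>. cbilin \<beta> \<longrightarrow> (\<Sum>p\<leftarrow>L. \<beta> (fst p) (snd p)) = (\<Sum>f\<in>E. \<beta> (z f :: 'a) (f :: 'b)))"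
proof (induction L)
  case Nil
  show ?case by (rule exI[of _ "{}"]) auto
next
  case (Cons p L)
  obtain x y where p: "p = (x, y)" by force
  from Cons obtain E z where E: "finite E"
    "\<And>f g. f \<in> E \<Longrightarrow> g \<in> E \<Longrightarrow> cinner f g = (if f = g then 1 else 0)"
    "\<And>\<beta>. cbilin \<beta> \<Longrightarrow> (\<Sum>p\<leftarrow>L. \<beta> (fst p) (snd p)) = (\<Sum>f\<in>E. \<beta> (z f :: 'a) (f :: 'b))"
    by blast
  define r where "r = y - (\<Sum>f\<in>E. cinner f y *\<^sub>C f)"
  have y: "y = (\<Sum>f\<in>E. cinner f y *\<^sub>C f) + r" by (simp add: r_def)
  have orth: "cinner g r = 0" if "g \<in> E" for g
  proof -
    have "cinner g r = cinner g y - (\<Sum>f\<in>E. cinner f y * cinner g f)"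
      by (simp add: r_def cinner_diff_right cinner_sum_right)
    also have "(\<Sum>f\<in>E. cinner f y * cinner g f) = (\<Sum>f\<in>E. if g = f then cinner f y else 0)"
      using that by (intro sum.cong) (auto simp: E)
    finally show ?thesis using that E(1) by simp
  qed
  have \<beta>xy: "\<beta> x y = (\<Sum>f\<in>E. cinner f y * \<beta> x f) + \<beta> x r" if "cbilin \<beta>" for \<beta>
  proof -
    have "\<beta> x y = \<beta> x (\<Sum>f\<in>E. cinner f y *\<^sub>C f) + \<beta> x r"
      using that by (subst y) (auto simp: cbilin_def)
    also have "\<beta> x (\<Sum>f\<in>E. cinner f y *\<^sub>C f) = (\<Sum>f\<in>E. cinner f y * \<beta> x f)"
      unfolding cbilin_sum[OF that] using that by (simp add: cbilin_def)
    finally show ?thesis .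
  qed
  define z1 where "z1 = (\<lambda>f. z f + cinner f y *\<^sub>C x)"
  have z1: "(\<Sum>f\<in>E. \<beta> (z1 f) f) = (\<Sum>f\<in>E. \<beta> (z f) f) + (\<Sum>f\<in>E. cinner f y * \<beta> x f)"
    if "cbilin \<beta>" for \<beta>
    using that by (simp add: cbilin_def z1_def sum.distrib)
  show ?case
  proof (cases "r = 0")
    case True
    have "\<beta> x r = 0" if "cbilin \<beta>" for \<beta>
      using cbilin_sum[OF that, of x "\<lambda>_. 0" "{}"] True by simp
    then have "(\<Sum>p\<leftarrow>p # L. \<beta> (fst p) (snd p)) = (\<Sum>f\<in>E. \<beta> (z1 f) f)" if "cbilin \<beta>" for \<beta>
      using that by (simp add: p z1 \<beta>xy E(3))
    then show ?thesis using E(1,2) by blast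
  next
    case False
    define n where "n = complex_of_real (norm r)"
    have n: "n \<noteq> 0" using False by (simp add: n_def)
    define g where "g = inverse n *\<^sub>C r"
    have gg: "cinner g g = 1"
      using n by (simp add: g_def cinner_self n_def norm_inverse power2_eq_square flip: of_real_mult of_real_inverse)
    have fg: "cinner f g = 0" "cinner g f = 0" if "f \<in> E" for f
      using orth[OF that] cinner_commute[of g f] by (simp_all add: g_def)
    have gE: "g \<notin> E" using fg gg by force
    have r: "r = n *\<^sub>C g" using n by (simp add: g_def)
    define z2 where "z2 = z1(g := n *\<^sub>C x)"
    have "(\<Sum>p\<leftarrow>p # L. \<beta> (fst p) (snd p)) = (\<Sum>f\<in>insert g E. \<beta> (z2 f) f)" if b: "cbilin \<beta>" for \<beta>
    proof -
      have "(\<Sum>f\<in>insert g E. \<beta> (z2 f) f) = \<beta> (n *\<^sub>C x) g + (\<Sum>f\<in>E. \<beta> (z2 f) f)"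
        using gE E(1) by (simp add: z2_def)
      also have "(\<Sum>f\<in>E. \<beta> (z2 f) f) = (\<Sum>f\<in>E. \<beta> (z1 f) f)"
        using gE by (intro sum.cong) (auto simp: z2_def)
      also have "\<beta> (n *\<^sub>C x) g = \<beta> x r"
        using b unfolding r by (simp add: cbilin_def)
      finally show ?thesis using b by (simp add: p z1 \<beta>xy E(3))
    qed
    moreover have "\<forall>f\<in>insert g E. \<forall>h\<in>insert g E. cinner f h = (if f = h then 1 else 0)"
      using E(2) fg gg gE by auto
    ultimately show ?thesis using E(1) by (intro exI[of _ "insert g E"] exI[of _ z2]) auto
  qed
qed

lemma ft_inner_map_self:
  fixes L :: "('a::chilbert_space \<times> 'b::chilbert_space) list"
  shows "\<exists>E z. finite E \<and> (\<forall>T :: 'a \<Rightarrow> 'c::chilbert_space. clinear T \<longrightarrow>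
    ft_inner (map (apfst T) L) (map (apfst T) L) = complex_of_real (\<Sum>f\<in>E. (norm (T (z f :: 'a)))\<^sup>2))
    \<and> ft_inner L L = complex_of_real (\<Sum>f\<in>E. (norm (z (f :: 'b)))\<^sup>2)"
proof -
  obtain E and z where E: "finite E"
    "\<And>f g. f \<in> E \<Longrightarrow> g \<in> E \<Longrightarrow> cinner f g = (if f = g then 1 else 0)"
    "\<And>\<beta>. cbilin \<beta> \<Longrightarrow> (\<Sum>p\<leftarrow>L. \<beta> (fst p) (snd p)) = (\<Sum>f\<in>E. \<beta> (z f :: 'a) (f :: 'b))"
    using ft_orthonormal_form[of L] by blast
  have *: "ft_inner (map (apfst T) L) (map (apfst T) L) = complex_of_real (\<Sum>f\<in>E. (norm (T (z f)))\<^sup>2)"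
    if T: "clinear T" for T :: "'a \<Rightarrow> 'd::chilbert_space"
  proof -
    have b1: "cbilin (\<lambda>x' y'. cinner (T x) (T x') * cinner y y')" for x and y :: 'b
      using T by (auto simp: cbilin_def clinear_def cinner_add_right algebra_simps)
    have b2: "cbilin (\<lambda>x' y'. \<Sum>f\<in>E. cinner (T (z f)) (T x') * cinner f y')"
      using T by (auto simp: cbilin_def clinear_def cinner_add_right algebra_simps sum.distrib sum_distrib_left)
    have "ft_inner (map (apfst T) L) (map (apfst T) L)
      = (\<Sum>p\<leftarrow>L. \<Sum>q\<leftarrow>L. cinner (T (fst p)) (T (fst q)) * cinner (snd p) (snd q))"
      by (simp add: ft_inner_def o_def)
    also have "\<dots> = (\<Sum>p\<leftarrow>L. \<Sum>f\<in>E. cinner (T (fst p)) (T (z f)) * cinner (snd p) f)"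
      by (simp add: E(3)[OF b1])
    also have "\<dots> = cnj (\<Sum>p\<leftarrow>L. \<Sum>f\<in>E. cinner (T (z f)) (T (fst p)) * cinner f (snd p))"
      by (simp add: sum_list_cnj cinner_commute[symmetric])
    also have "\<dots> = cnj (\<Sum>g\<in>E. \<Sum>f\<in>E. cinner (T (z f)) (T (z g)) * cinner f g)"
      by (simp add: E(3)[OF b2])
    also have "(\<Sum>g\<in>E. \<Sum>f\<in>E. cinner (T (z f)) (T (z g)) * cinner f g)
        = (\<Sum>g\<in>E. \<Sum>f\<in>E. if g = f then cinner (T (z g)) (T (z g)) else 0)"
      by (intro sum.cong) (auto simp: E(2))
    also have "\<dots> = complex_of_real (\<Sum>f\<in>E. (norm (T (z f)))\<^sup>2)"
      using E(1) by (simp add: cinner_self)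
    finally show ?thesis by simp
  qed
  have "map (apfst (\<lambda>x. x)) L = L" by (simp add: apfst_def map_prod_def)
  then have "ft_inner L L = complex_of_real (\<Sum>f\<in>E. (norm (z f))\<^sup>2)"
    using *[of "\<lambda>x. x"] by (simp add: clinear_def)
  then show ?thesis using E(1) * by blast
qed

lemma
  fixes L :: "('a::chilbert_space \<times> 'b::chilbert_space) list"
  shows ft_inner_self: "ft_inner L L = complex_of_real ((ft_norm L)\<^sup>2)"
    and ft_norm_ge_0 [simp]: "ft_norm L \<ge> 0"
proof -
  obtain E and z :: "'b \<Rightarrow> 'a" where Ez: "ft_inner L L = complex_of_real (\<Sum>f\<in>E. (norm (z f))\<^sup>2)"
    using ft_inner_map_self[of L, where ?'c = 'a] by blast
  have "Re (ft_inner L L) \<ge> 0" unfolding Ez by (simp add: sum_nonneg)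
  then show "ft_norm L \<ge> 0" "ft_inner L L = complex_of_real ((ft_norm L)\<^sup>2)"
    by (auto simp: ft_norm_def Ez)
qed

lemma ft_norm_sq: "(ft_norm L)\<^sup>2 = Re (ft_inner L L)"
  by (simp only: ft_inner_self Re_complex_of_real)

lemma ft_norm_map_fst:
  fixes L :: "('a::chilbert_space \<times> 'b::chilbert_space) list" and T :: "'a \<Rightarrow> 'c::chilbert_space"
  assumes T: "clinear T" and K: "\<And>x. norm (T x) \<le> K * norm x" and "K \<ge> 0"
  shows "ft_norm (map (apfst T) L) \<le> K * ft_norm L"
proof -
  obtain E and z :: "'b \<Rightarrow> 'a" where E: "finite E"
    "ft_inner (map (apfst T) L) (map (apfst T) L) = complex_of_real (\<Sum>f\<in>E. (norm (T (z f)))\<^sup>2)"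
    "ft_inner L L = complex_of_real (\<Sum>f\<in>E. (norm (z f))\<^sup>2)"
    using ft_inner_map_self[of L, where ?'c = 'c] T by blast
  have "(\<Sum>f\<in>E. (norm (T (z f)))\<^sup>2) \<le> (\<Sum>f\<in>E. (K * norm (z f))\<^sup>2)"
    by (intro sum_mono power_mono K) auto
  also have "\<dots> = K\<^sup>2 * (\<Sum>f\<in>E. (norm (z f))\<^sup>2)"
    by (simp add: power_mult_distrib sum_distrib_left)
  finally have "sqrt (\<Sum>f\<in>E. (norm (T (z f)))\<^sup>2) \<le> sqrt (K\<^sup>2 * (\<Sum>f\<in>E. (norm (z f))\<^sup>2))" by simp
  then show ?thesis using \<open>K \<ge> 0\<close> by (simp add: ft_norm_def E real_sqrt_mult)
qed

lemma ft_norm_map_snd: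
  assumes T: "clinear T" and K: "\<And>x. norm (T x) \<le> K * norm x" and "K \<ge> 0"
  shows "ft_norm (map (apsnd T) L) \<le> K * ft_norm L"
proof -
  have sw: "ft_norm (map prod.swap M) = ft_norm M" for M :: "('x::chilbert_space \<times> 'y::chilbert_space) list"
    by (simp add: ft_norm_def ft_inner_def o_def mult.commute)
  have "ft_norm (map (apsnd T) L) = ft_norm (map prod.swap (map (apsnd T) L))"
    by (simp only: sw)
  also have "map prod.swap (map (apsnd T) L) = map (apfst T) (map prod.swap L)"
    by (auto simp: o_def)
  also have "ft_norm \<dots> \<le> K * ft_norm (map prod.swap L)"
    by (rule ft_norm_map_fst[OF assms])
  finally show ?thesis by (simp add: sw)
qed

lemma ft_Cauchy_Schwarz: "cmod (ft_inner L M) \<le> ft_norm L * ft_norm M"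
proof -
  define t where "t = ft_inner M L"
  define A where "A = (ft_norm L)\<^sup>2"
  define B where "B = (ft_norm M)\<^sup>2"
  define C where "C = (cmod t)\<^sup>2"
  have q: "0 \<le> s\<^sup>2 * A - 2 * s * r * C + r\<^sup>2 * C * B" for s r :: real
  proof -
    define D where "D = ft_diff (ft_scale (complex_of_real s) L) (ft_scale (complex_of_real r * t) M)"
    have LM: "ft_inner L M = cnj t" "ft_inner M L = t"
      by (simp_all add: t_def ft_inner_commute[symmetric])
    have tt: "cnj t * t = complex_of_real C" unfolding C_def
      by (subst complex_norm_square) (rule mult.commute)
    have "complex_of_real ((ft_norm D)\<^sup>2) = ft_inner D D"
      by (rule ft_inner_self[symmetric])
    also have "\<dots> = s * s * ft_inner L L - 2 * s * r * (cnj t * t) + r * r * (cnj t * t) * ft_inner M M"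
      unfolding D_def ft_inner_diff ft_inner_scale LM by (simp add: algebra_simps)
    also have "\<dots> = complex_of_real (s\<^sup>2 * A - 2 * s * r * C + r\<^sup>2 * C * B)"
      unfolding tt ft_inner_self A_def B_def by (simp add: power2_eq_square)
    finally have "(ft_norm D)\<^sup>2 = s\<^sup>2 * A - 2 * s * r * C + r\<^sup>2 * C * B"
      unfolding of_real_eq_iff .
    then show ?thesis by (metis zero_le_power2)
  qed
  have AB: "A \<ge> 0" "B \<ge> 0" "C \<ge> 0" by (simp_all add: A_def B_def C_def)
  have "C \<le> A * B"
  proof (cases "B = 0")
    case False
    have "0 \<le> B * (A * B - C)"
      using q[of B 1] by (simp add: algebra_simps power2_eq_square)
    then show ?thesis using False AB by (simp add: zero_le_mult_iff)
  next
    case True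
    show ?thesis
    proof (cases "C = 0")
      case False
      have "0 \<le> A - 2 * ((A + 1) / (2 * C)) * C"
        using q[of 1 "(A + 1) / (2 * C)"] True by simp
      also have "\<dots> = - 1" using False by (simp add: field_simps)
      finally show ?thesis by simp
    qed (simp add: True)
  qed
  then have "(cmod t)\<^sup>2 \<le> (ft_norm L * ft_norm M)\<^sup>2"
    by (simp add: power_mult_distrib A_def B_def C_def)
  then have "cmod t \<le> ft_norm L * ft_norm M" by (rule power2_le_imp_le) simp
  then show ?thesis by (simp add: t_def ft_inner_commute[of L M])
qed

lemma ft_norm_triangle: "ft_norm (L @ M) \<le> ft_norm L + ft_norm M"
proof (rule power2_le_imp_le)
  have "(ft_norm (L @ M))\<^sup>2 = (ft_norm L)\<^sup>2 + 2 * Re (ft_inner L M) + (ft_norm M)\<^sup>2"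
    by (simp add: ft_norm_sq ft_inner_commute[of M L])
  also have "Re (ft_inner L M) \<le> ft_norm L * ft_norm M"
    using complex_Re_le_cmod[of "ft_inner L M"] ft_Cauchy_Schwarz[of L M] by linarith
  finally show "(ft_norm (L @ M))\<^sup>2 \<le> (ft_norm L + ft_norm M)\<^sup>2"
    by (simp add: power2_sum)
qed simp

lemma ft_norm_cong:
  assumes "\<And>N. ft_inner N L = ft_inner N M"
  shows "ft_norm L = ft_norm M"
  by (metis assms ft_inner_commute ft_norm_def)

lemma ft_norm_scale [simp]: "ft_norm (ft_scale c L) = cmod c * ft_norm L"
proof -
  have "complex_of_real ((ft_norm (ft_scale c L))\<^sup>2) = (c * cnj c) * complex_of_real ((ft_norm L)\<^sup>2)"
    unfolding ft_inner_self[symmetric] by simp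
  also have "\<dots> = complex_of_real ((cmod c * ft_norm L)\<^sup>2)"
    by (simp add: complex_norm_square[symmetric] power_mult_distrib)
  finally have "(ft_norm (ft_scale c L))\<^sup>2 = (cmod c * ft_norm L)\<^sup>2" unfolding of_real_eq_iff .
  then show ?thesis by (simp add: power2_eq_iff_nonneg)
qed

lemma ft_diff_triangle: "ft_norm (ft_diff L N) \<le> ft_norm (ft_diff L M) + ft_norm (ft_diff M N)"
proof -
  have "ft_norm (ft_diff L N) = ft_norm (ft_diff L M @ ft_diff M N)"
    by (rule ft_norm_cong) simp
  then show ?thesis using ft_norm_triangle by metis
qed

lemma ft_diff_commute: "ft_norm (ft_diff L M) = ft_norm (ft_diff M L)"
proof -
  have "ft_norm (ft_diff L M) = ft_norm (ft_scale (- 1) (ft_diff M L))"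
    by (rule ft_norm_cong) simp
  then show ?thesis by simp
qed

lemma ft_norm_diff_zero:
  assumes "\<And>N. ft_inner N L = ft_inner N M"
  shows "ft_norm (ft_diff L M) = 0"
  by (simp add: ft_norm_def assms)

lemma ft_norm_Nil [simp]: "ft_norm [] = 0"
  by (simp add: ft_norm_def)

lemma ft_norm_diff_ge: "\<bar>ft_norm L - ft_norm M\<bar> \<le> ft_norm (ft_diff L M)"
proof -
  have D: "ft_norm (ft_diff L []) = ft_norm L" for L :: "('a \<times> 'b) list"
    by (rule ft_norm_cong) simp
  show ?thesis
    using ft_diff_triangle[of L "[]" M] ft_diff_triangle[of M "[]" L] ft_diff_commute[of L M]
    by (simp add: D)
qed

lemma ft_norm_diff_append: "ft_norm (ft_diff (L @ L') (M @ M')) \<le> ft_norm (ft_diff L M) + ft_norm (ft_diff L' M')"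
proof -
  have "ft_norm (ft_diff (L @ L') (M @ M')) = ft_norm (ft_diff L M @ ft_diff L' M')"
    by (rule ft_norm_cong) simp
  then show ?thesis using ft_norm_triangle by metis
qed

lemma ft_norm_diff_scale: "ft_norm (ft_diff (ft_scale c L) (ft_scale c M)) = cmod c * ft_norm (ft_diff L M)"
proof -
  have "ft_norm (ft_diff (ft_scale c L) (ft_scale c M)) = ft_norm (ft_scale c (ft_diff L M))"
    by (rule ft_norm_cong) (simp add: algebra_simps)
  then show ?thesis by simp
qed

definition ft_cauchy :: "(nat \<Rightarrow> ('a::chilbert_space \<times> 'b::chilbert_space) list) \<Rightarrow> bool"
  where "ft_cauchy s \<longleftrightarrow> (\<forall>e>0. \<exists>N. \<forall>m\<ge>N. \<forall>n\<ge>N. ft_norm (ft_diff (s m) (s n)) < e)"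

definition ft_rel :: "(nat \<Rightarrow> ('a::chilbert_space \<times> 'b::chilbert_space) list) \<Rightarrow> (nat \<Rightarrow> ('a \<times> 'b) list) \<Rightarrow> bool"
  where "ft_rel s t \<longleftrightarrow> ft_cauchy s \<and> ft_cauchy t \<and> (\<lambda>n. ft_norm (ft_diff (s n) (t n))) \<longlonglongrightarrow> 0"

lemma ft_cauchy_const [simp]: "ft_cauchy (\<lambda>_. L)"
  by (simp add: ft_cauchy_def ft_norm_diff_zero)

lemma ft_rel_refl [simp]: "ft_rel s s \<longleftrightarrow> ft_cauchy s"
  by (simp add: ft_rel_def ft_norm_diff_zero)

lemma ft_rel_eqI:
  assumes "ft_cauchy s" "ft_cauchy t" "\<And>n N. ft_inner N (s n) = ft_inner N (t n)"
  shows "ft_rel s t"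
  using assms by (simp add: ft_rel_def ft_norm_diff_zero)

lemma ft_rel_sym: "ft_rel s t \<Longrightarrow> ft_rel t s"
  by (simp add: ft_rel_def ft_diff_commute)

lemma LIMSEQ_null_bound:
  fixes f :: "nat \<Rightarrow> 'c::real_normed_vector"
  assumes "g \<longlonglongrightarrow> 0" "\<And>n. norm (f n) \<le> g n"
  shows "f \<longlonglongrightarrow> 0"
  by (rule Lim_null_comparison[OF always_eventually]) (use assms in auto)

lemma ft_rel_trans: assumes "ft_rel s t" "ft_rel t u" shows "ft_rel s u"
proof -
  have "(\<lambda>n. ft_norm (ft_diff (s n) (t n)) + ft_norm (ft_diff (t n) (u n))) \<longlonglongrightarrow> 0 + 0"
    using assms unfolding ft_rel_def by (intro tendsto_add) auto
  then have "(\<lambda>n. ft_norm (ft_diff (s n) (u n))) \<longlonglongrightarrow> 0"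
    unfolding add_0_right by (rule LIMSEQ_null_bound) (simp add: ft_diff_triangle)
  then show ?thesis using assms by (simp add: ft_rel_def)
qed

lemma ft_cauchyI_bound:
  assumes s: "ft_cauchy s" and t: "ft_cauchy t" and K: "K \<ge> 0"
    and b: "\<And>m n. ft_norm (ft_diff (u m) (u n)) \<le> K * (ft_norm (ft_diff (s m) (s n)) + ft_norm (ft_diff (t m) (t n)))"
  shows "ft_cauchy u"
  unfolding ft_cauchy_def
proof (intro allI impI)
  fix e :: real assume "e > 0"
  define d where "d = e / (2 * (K + 1))"
  have "d > 0" using \<open>e > 0\<close> K by (simp add: d_def)
  obtain N1 where N1: "\<And>m n. m \<ge> N1 \<Longrightarrow> n \<ge> N1 \<Longrightarrow> ft_norm (ft_diff (s m) (s n)) < d"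
    using s \<open>d > 0\<close> unfolding ft_cauchy_def by meson
  obtain N2 where N2: "\<And>m n. m \<ge> N2 \<Longrightarrow> n \<ge> N2 \<Longrightarrow> ft_norm (ft_diff (t m) (t n)) < d"
    using t \<open>d > 0\<close> unfolding ft_cauchy_def by meson
  have "ft_norm (ft_diff (u m) (u n)) < e" if "m \<ge> max N1 N2" "n \<ge> max N1 N2" for m n
  proof -
    have "ft_norm (ft_diff (u m) (u n)) \<le> K * (ft_norm (ft_diff (s m) (s n)) + ft_norm (ft_diff (t m) (t n)))"
      by (rule b)
    also have "\<dots> \<le> K * (d + d)"
      using N1[of m n] N2[of m n] that K by (intro mult_left_mono) auto
    also have "\<dots> < (K + 1) * (d + d)" using \<open>d > 0\<close> by simp
    also have "\<dots> = e"
    proof -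
      have "2 * (K + 1) \<noteq> 0" using K by simp
      then have "d * (2 * (K + 1)) = e" unfolding d_def by simp
      then show ?thesis by (simp add: algebra_simps)
    qed
    finally show ?thesis .
  qed
  then show "\<exists>N. \<forall>m\<ge>N. \<forall>n\<ge>N. ft_norm (ft_diff (u m) (u n)) < e" by blast
qed

lemma ft_relI_bound:
  assumes s: "ft_rel s s'" and t: "ft_rel t t'" and K: "K \<ge> 0"
    and b: "\<And>m n. ft_norm (ft_diff (u m) (u n)) \<le> K * (ft_norm (ft_diff (s m) (s n)) + ft_norm (ft_diff (t m) (t n)))"
    and b': "\<And>m n. ft_norm (ft_diff (u' m) (u' n)) \<le> K * (ft_norm (ft_diff (s' m) (s' n)) + ft_norm (ft_diff (t' m) (t' n)))"
    and c: "\<And>n. ft_norm (ft_diff (u n) (u' n)) \<le> K * (ft_norm (ft_diff (s n) (s' n)) + ft_norm (ft_diff (t n) (t' n)))"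
  shows "ft_rel u u'"
proof -
  have "(\<lambda>n. K * (ft_norm (ft_diff (s n) (s' n)) + ft_norm (ft_diff (t n) (t' n)))) \<longlonglongrightarrow> K * (0 + 0)"
    using s t unfolding ft_rel_def by (intro tendsto_intros) auto
  then have "(\<lambda>n. ft_norm (ft_diff (u n) (u' n))) \<longlonglongrightarrow> 0"
    unfolding add_0_right mult_zero_right by (rule LIMSEQ_null_bound) (simp add: c)
  moreover have "ft_cauchy u" using s t b K unfolding ft_rel_def by (blast intro: ft_cauchyI_bound)
  moreover have "ft_cauchy u'" using s t b' K unfolding ft_rel_def by (blast intro: ft_cauchyI_bound)
  ultimately show ?thesis by (simp add: ft_rel_def)
qed

lemma ft_cauchy_norm_convergent: "ft_cauchy s \<Longrightarrow> convergent (\<lambda>n. ft_norm (s n))"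
  unfolding Cauchy_convergent_iff[symmetric] Cauchy_def ft_cauchy_def dist_real_def
  by (meson ft_norm_diff_ge le_less_trans)

lemma ft_cauchy_bounded: assumes "ft_cauchy s" shows "\<exists>K\<ge>0. \<forall>n. ft_norm (s n) \<le> K"
proof -
  have "Bseq (\<lambda>n. ft_norm (s n))"
    using ft_cauchy_norm_convergent[OF assms] by (rule convergent_imp_Bseq)
  then show ?thesis unfolding Bseq_def by (auto intro: less_imp_le)
qed

lemma ft_inner_diff_bound:
  "cmod (ft_inner L M - ft_inner L' M') \<le> ft_norm (ft_diff L L') * ft_norm M + ft_norm L' * ft_norm (ft_diff M M')"
proof -
  have "ft_inner L M - ft_inner L' M' = ft_inner (ft_diff L L') M + ft_inner L' (ft_diff M M')"
    by simp
  also have "cmod \<dots> \<le> cmod (ft_inner (ft_diff L L') M) + cmod (ft_inner L' (ft_diff M M'))"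
    by (rule norm_triangle_ineq)
  also have "\<dots> \<le> ft_norm (ft_diff L L') * ft_norm M + ft_norm L' * ft_norm (ft_diff M M')"
    by (intro add_mono ft_Cauchy_Schwarz)
  finally show ?thesis .
qed

lemma ft_cauchy_inner_convergent:
  assumes s: "ft_cauchy s" and t: "ft_cauchy t"
  shows "convergent (\<lambda>n. ft_inner (s n) (t n))"
  unfolding Cauchy_convergent_iff[symmetric]
proof (rule metric_CauchyI)
  fix e :: real assume "e > 0"
  obtain K1 where K1: "K1 \<ge> 0" "\<And>n. ft_norm (s n) \<le> K1" using ft_cauchy_bounded[OF s] by auto
  obtain K2 where K2: "K2 \<ge> 0" "\<And>n. ft_norm (t n) \<le> K2" using ft_cauchy_bounded[OF t] by auto
  define d where "d = e / (K1 + K2 + 1)"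
  have "d > 0" using \<open>e > 0\<close> K1(1) K2(1) by (simp add: d_def)
  obtain N1 where N1: "\<And>m n. m \<ge> N1 \<Longrightarrow> n \<ge> N1 \<Longrightarrow> ft_norm (ft_diff (s m) (s n)) < d"
    using s \<open>d > 0\<close> unfolding ft_cauchy_def by meson
  obtain N2 where N2: "\<And>m n. m \<ge> N2 \<Longrightarrow> n \<ge> N2 \<Longrightarrow> ft_norm (ft_diff (t m) (t n)) < d"
    using t \<open>d > 0\<close> unfolding ft_cauchy_def by meson
  have "dist (ft_inner (s m) (t m)) (ft_inner (s n) (t n)) < e" if "m \<ge> max N1 N2" "n \<ge> max N1 N2" for m n
  proof -
    have "dist (ft_inner (s m) (t m)) (ft_inner (s n) (t n))
      \<le> ft_norm (ft_diff (s m) (s n)) * ft_norm (t m) + ft_norm (s n) * ft_norm (ft_diff (t m) (t n))"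
      unfolding dist_norm by (rule ft_inner_diff_bound)
    also have "\<dots> \<le> d * K2 + K1 * d"
      using N1[of m n] N2[of m n] that K1 K2 \<open>d > 0\<close> by (intro add_mono mult_mono) auto
    also have "\<dots> < d * (K1 + K2 + 1)" using \<open>d > 0\<close> by (simp add: algebra_simps)
    also have "\<dots> = e" using K1(1) K2(1) by (simp add: d_def)
    finally show ?thesis .
  qed
  then show "\<exists>M. \<forall>m\<ge>M. \<forall>n\<ge>M. dist (ft_inner (s m) (t m)) (ft_inner (s n) (t n)) < e" by blast
qed

lemma ft_rel_inner_lim:
  assumes s: "ft_rel s s'" and t: "ft_rel t t'"
  shows "lim (\<lambda>n. ft_inner (s n) (t n)) = lim (\<lambda>n. ft_inner (s' n) (t' n))"
proof -
  obtain K1 where K1: "K1 \<ge> 0" "\<And>n. ft_norm (s' n) \<le> K1" using ft_cauchy_bounded s unfolding ft_rel_def by meson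
  obtain K2 where K2: "K2 \<ge> 0" "\<And>n. ft_norm (t n) \<le> K2" using ft_cauchy_bounded t unfolding ft_rel_def by meson
  have "(\<lambda>n. ft_norm (ft_diff (s n) (s' n)) * K2 + K1 * ft_norm (ft_diff (t n) (t' n))) \<longlonglongrightarrow> 0 * K2 + K1 * 0"
    using s t unfolding ft_rel_def by (intro tendsto_intros) auto
  moreover have "norm (ft_inner (s n) (t n) - ft_inner (s' n) (t' n)) \<le> ft_norm (ft_diff (s n) (s' n)) * K2 + K1 * ft_norm (ft_diff (t n) (t' n))" for n
    by (rule order_trans[OF ft_inner_diff_bound]) (intro add_mono mult_mono K1 K2; simp)
  ultimately have "(\<lambda>n. ft_inner (s n) (t n) - ft_inner (s' n) (t' n)) \<longlonglongrightarrow> 0"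
    unfolding mult_zero_left mult_zero_right add_0_right by (rule LIMSEQ_null_bound)
  moreover have "(\<lambda>n. ft_inner (s n) (t n) - ft_inner (s' n) (t' n)) \<longlonglongrightarrow>
      lim (\<lambda>n. ft_inner (s n) (t n)) - lim (\<lambda>n. ft_inner (s' n) (t' n))"
    using s t unfolding ft_rel_def
    by (intro tendsto_diff; metis ft_cauchy_inner_convergent convergent_LIMSEQ_iff)
  ultimately show ?thesis using LIMSEQ_unique by fastforce
qed

lemma ft_rel_norm_lim:
  assumes s: "ft_rel s s'"
  shows "lim (\<lambda>n. ft_norm (s n)) = lim (\<lambda>n. ft_norm (s' n))"
proof -
  have "(\<lambda>n. ft_norm (s n) - ft_norm (s' n)) \<longlonglongrightarrow> 0"
    by (rule LIMSEQ_null_bound[of "\<lambda>n. ft_norm (ft_diff (s n) (s' n))"])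
       (use s in \<open>auto simp: ft_rel_def ft_norm_diff_ge\<close>)
  moreover have "(\<lambda>n. ft_norm (s n) - ft_norm (s' n)) \<longlonglongrightarrow>
      lim (\<lambda>n. ft_norm (s n)) - lim (\<lambda>n. ft_norm (s' n))"
    using s unfolding ft_rel_def
    by (intro tendsto_diff; metis ft_cauchy_norm_convergent convergent_LIMSEQ_iff)
  ultimately show ?thesis using LIMSEQ_unique by fastforce
qed

quotient_type (overloaded) ('a, 'b) htensor =
  "nat \<Rightarrow> ('a::chilbert_space \<times> 'b::chilbert_space) list" / partial: ft_rel
proof (rule part_equivpI)
  show "\<exists>s. ft_rel s (s :: nat \<Rightarrow> ('a \<times> 'b) list)"
    by (rule exI[of _ "\<lambda>_. []"]) simp
qed (auto intro!: sympI transpI intro: ft_rel_sym ft_rel_trans)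

lemma ft_cauchy_append: "ft_cauchy s \<Longrightarrow> ft_cauchy t \<Longrightarrow> ft_cauchy (\<lambda>n. s n @ t n)"
  by (erule (1) ft_cauchyI_bound[where K = 1]) (use ft_norm_diff_append in auto)

lemma ft_cauchy_scale: "ft_cauchy s \<Longrightarrow> ft_cauchy (\<lambda>n. ft_scale c (s n))"
  by (erule ft_cauchyI_bound[where K = "cmod c" and t = "\<lambda>_. []"])
     (auto simp: ft_norm_diff_scale mult_left_mono)

lemma ft_cauchy_diff: "ft_cauchy s \<Longrightarrow> ft_cauchy t \<Longrightarrow> ft_cauchy (\<lambda>n. ft_diff (s n) (t n))"
  unfolding ft_diff_def by (intro ft_cauchy_append ft_cauchy_scale)

lemma ft_rel_append: "ft_rel s s' \<Longrightarrow> ft_rel t t' \<Longrightarrow> ft_rel (\<lambda>n. s n @ t n) (\<lambda>n. s' n @ t' n)"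
  by (erule (1) ft_relI_bound[where K = 1]) (use ft_norm_diff_append in auto)

lemma ft_rel_scale: "ft_rel s s' \<Longrightarrow> ft_rel (\<lambda>n. ft_scale c (s n)) (\<lambda>n. ft_scale c (s' n))"
  by (erule ft_relI_bound[where K = "cmod c" and t = "\<lambda>_. []" and t' = "\<lambda>_. []"])
     (auto simp: ft_norm_diff_scale mult_left_mono)

instantiation htensor :: (chilbert_space, chilbert_space) complex_normed_vector
begin

lift_definition zero_htensor :: "('a, 'b) htensor" is "\<lambda>_. []" by simp

lift_definition plus_htensor :: "('a, 'b) htensor \<Rightarrow> ('a, 'b) htensor \<Rightarrow> ('a, 'b) htensor"
  is "\<lambda>s t n. s n @ t n" by (rule ft_rel_append)

lift_definition uminus_htensor :: "('a, 'b) htensor \<Rightarrow> ('a, 'b) htensor"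
  is "\<lambda>s n. ft_scale (- 1) (s n)" by (rule ft_rel_scale)

lift_definition minus_htensor :: "('a, 'b) htensor \<Rightarrow> ('a, 'b) htensor \<Rightarrow> ('a, 'b) htensor"
  is "\<lambda>s t n. ft_diff (s n) (t n)" unfolding ft_diff_def by (intro ft_rel_append ft_rel_scale)

lift_definition scaleR_htensor :: "real \<Rightarrow> ('a, 'b) htensor \<Rightarrow> ('a, 'b) htensor"
  is "\<lambda>r s n. ft_scale (complex_of_real r) (s n)" by (rule ft_rel_scale)

lift_definition scaleC_htensor :: "complex \<Rightarrow> ('a, 'b) htensor \<Rightarrow> ('a, 'b) htensor"
  is "\<lambda>c s n. ft_scale c (s n)" by (rule ft_rel_scale)

lift_definition norm_htensor :: "('a, 'b) htensor \<Rightarrow> real"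
  is "\<lambda>s. lim (\<lambda>n. ft_norm (s n))" by (rule ft_rel_norm_lim)

definition dist_htensor :: "('a, 'b) htensor \<Rightarrow> ('a, 'b) htensor \<Rightarrow> real"
  where "dist_htensor x y = norm (x - y)"

definition sgn_htensor :: "('a, 'b) htensor \<Rightarrow> ('a, 'b) htensor"
  where "sgn_htensor x = inverse (norm x) *\<^sub>R x"

definition uniformity_htensor :: "(('a, 'b) htensor \<times> ('a, 'b) htensor) filter"
  where "uniformity_htensor = (INF e\<in>{0 <..}. principal {(x, y). dist x y < e})"

definition open_htensor :: "('a, 'b) htensor set \<Rightarrow> bool"
  where "open_htensor S = (\<forall>x\<in>S. \<forall>\<^sub>F (x', y) in uniformity. x' = x \<longrightarrow> y \<in> S)"

lemma htensor_norm_lim: "ft_cauchy s \<Longrightarrow> (\<lambda>n. ft_norm (s n)) \<longlonglongrightarrow> norm (abs_htensor s)"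
  by (simp add: norm_htensor.abs_eq convergent_LIMSEQ_iff[symmetric] ft_cauchy_norm_convergent)

lemma htensor_cases:
  obtains s where "ft_cauchy s" "x = abs_htensor s"
  by (metis Quotient3_htensor Quotient3_abs_rep Quotient3_rep_reflp ft_rel_refl)

lemma htensor_diff_abs: "ft_cauchy s \<Longrightarrow> ft_cauchy t \<Longrightarrow> abs_htensor s - abs_htensor t = abs_htensor (\<lambda>n. ft_diff (s n) (t n))"
  by (simp add: minus_htensor.abs_eq)

lemma htensor_norm_const: "norm (abs_htensor (\<lambda>_. L)) = ft_norm L"
  by (simp add: norm_htensor.abs_eq)

instance
proof
  fix x y z :: "('a, 'b) htensor" and r r' :: real and c d :: complex
  show "dist x y = norm (x - y)" by (rule dist_htensor_def)
  show "sgn x = inverse (norm x) *\<^sub>R x" by (rule sgn_htensor_def)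
  show "(uniformity :: (('a, 'b) htensor \<times> ('a, 'b) htensor) filter) = (INF e\<in>{0 <..}. principal {(x, y). dist x y < e})"
    by (rule uniformity_htensor_def)
  show "open U \<longleftrightarrow> (\<forall>x\<in>U. \<forall>\<^sub>F (x', y) in uniformity. x' = x \<longrightarrow> y \<in> U)" for U :: "('a, 'b) htensor set"
    by (rule open_htensor_def)
  note ft_c = ft_cauchy_append ft_cauchy_scale ft_cauchy_diff
  show "x + y + z = x + (y + z)"
    by transfer (rule ft_rel_eqI; simp add: ft_c)
  show "x + y = y + x"
    by transfer (rule ft_rel_eqI; simp add: ft_c)
  show "0 + x = x"
    by transfer simp
  show "- x + x = 0"
    by transfer (rule ft_rel_eqI; simp add: ft_c)
  show "x - y = x + - y"
    by transfer (rule ft_rel_eqI; simp add: ft_c)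
  show "r *\<^sub>R (x + y) = r *\<^sub>R x + r *\<^sub>R y"
    by transfer (rule ft_rel_eqI; simp add: ft_c algebra_simps)
  show "(r + r') *\<^sub>R x = r *\<^sub>R x + r' *\<^sub>R x"
    by transfer (rule ft_rel_eqI; simp add: ft_c algebra_simps)
  show "r *\<^sub>R r' *\<^sub>R x = (r * r') *\<^sub>R x"
    by transfer (rule ft_rel_eqI; simp add: ft_c algebra_simps)
  show "1 *\<^sub>R x = x"
    by transfer (rule ft_rel_eqI; simp add: ft_c algebra_simps)
  show "c *\<^sub>C (x + y) = c *\<^sub>C x + c *\<^sub>C y"
    by transfer (rule ft_rel_eqI; simp add: ft_c algebra_simps)
  show "(c + d) *\<^sub>C x = c *\<^sub>C x + d *\<^sub>C x"
    by transfer (rule ft_rel_eqI; simp add: ft_c algebra_simps)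
  show "c *\<^sub>C d *\<^sub>C x = (c * d) *\<^sub>C x"
    by transfer (rule ft_rel_eqI; simp add: ft_c algebra_simps)
  show "1 *\<^sub>C x = x"
    by transfer (rule ft_rel_eqI; simp add: ft_c algebra_simps)
  show "r *\<^sub>R x = complex_of_real r *\<^sub>C x"
    by transfer (rule ft_rel_eqI; simp add: ft_c algebra_simps)
  obtain s where s: "ft_cauchy s" "x = abs_htensor s" by (rule htensor_cases)
  obtain t where t: "ft_cauchy t" "y = abs_htensor t" by (rule htensor_cases)
  obtain u where u: "ft_cauchy u" "z = abs_htensor u" by (rule htensor_cases)
  have pl: "y + z = abs_htensor (\<lambda>n. t n @ u n)" "x + y = abs_htensor (\<lambda>n. s n @ t n)"
    by (simp_all add: plus_htensor.abs_eq s t u)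
  have sc: "c *\<^sub>C x = abs_htensor (\<lambda>n. ft_scale c (s n))" "c *\<^sub>C y = abs_htensor (\<lambda>n. ft_scale c (t n))"
     "r *\<^sub>R x = abs_htensor (\<lambda>n. ft_scale (complex_of_real r) (s n))"
    by (simp_all add: scaleC_htensor.abs_eq scaleR_htensor.abs_eq s t)
  show "norm x = 0 \<longleftrightarrow> x = 0"
  proof
    assume "norm x = 0"
    then have "(\<lambda>n. ft_norm (ft_diff (s n) [])) \<longlonglongrightarrow> 0"
      using htensor_norm_lim[OF s(1)] s(2) ft_norm_cong[of "ft_diff (s n) []" "s n" for n] by simp
    then have "ft_rel s (\<lambda>_. [])" using s(1) by (simp add: ft_rel_def)
    then show "x = 0" using s(2) Quotient3_rel_abs[OF Quotient3_htensor] by (simp add: zero_htensor_def)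
  next
    assume "x = 0"
    then show "norm x = 0" by (simp add: zero_htensor_def htensor_norm_const)
  qed
  show "norm (x + y) \<le> norm x + norm y"
    unfolding pl unfolding s t
    by (rule LIMSEQ_le[OF htensor_norm_lim tendsto_add[OF htensor_norm_lim htensor_norm_lim]])
       (auto intro: ft_c s t ft_norm_triangle)
  have "(\<lambda>n. ft_norm (ft_scale c (s n))) \<longlonglongrightarrow> cmod c * norm x" for c
    unfolding ft_norm_scale s(2) by (intro tendsto_intros htensor_norm_lim s)
  then show "norm (c *\<^sub>C x) = cmod c * norm x" "norm (r *\<^sub>R x) = \<bar>r\<bar> * norm x"
    unfolding sc using LIMSEQ_unique[OF htensor_norm_lim[OF ft_cauchy_scale[OF s(1)]]] norm_of_real
    by metis+
qed

end

lemma htensor_const_approx_seq: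
  assumes "ft_cauchy s"
  shows "(\<lambda>n. abs_htensor (\<lambda>_. s n)) \<longlonglongrightarrow> abs_htensor s"
proof (rule LIMSEQ_I)
  fix e :: real assume "e > 0"
  then obtain N where N: "\<And>m n. m \<ge> N \<Longrightarrow> n \<ge> N \<Longrightarrow> ft_norm (ft_diff (s m) (s n)) < e / 2"
    using assms unfolding ft_cauchy_def by (meson half_gt_zero)
  have "norm (abs_htensor (\<lambda>_. s n) - abs_htensor s) < e" if "n \<ge> N" for n
  proof -
    have "(\<lambda>m. ft_norm (ft_diff (s n) (s m))) \<longlonglongrightarrow> norm (abs_htensor (\<lambda>_. s n) - abs_htensor s)"
      using assms by (simp add: htensor_diff_abs htensor_norm_lim ft_cauchy_diff)
    moreover have "eventually (\<lambda>m. ft_norm (ft_diff (s n) (s m)) \<le> e / 2) sequentially"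
      using N that unfolding eventually_sequentially by (meson less_imp_le)
    ultimately have "norm (abs_htensor (\<lambda>_. s n) - abs_htensor s) \<le> e / 2"
      by (rule tendsto_upperbound) simp
    then show ?thesis using \<open>e > 0\<close> by simp
  qed
  then show "\<exists>N. \<forall>n\<ge>N. norm (abs_htensor (\<lambda>_. s n) - abs_htensor s) < e" by blast
qed

lemma htensor_const_approx:
  assumes "e > 0"
  shows "\<exists>L. norm (x - abs_htensor (\<lambda>_. L)) < e"
proof -
  obtain s where s: "ft_cauchy s" "x = abs_htensor s" by (rule htensor_cases)
  show ?thesis
    using LIMSEQ_D[OF htensor_const_approx_seq[OF s(1)] assms] s(2) by (metis norm_minus_commute order_refl)
qed

instantiation htensor :: (chilbert_space, chilbert_space) chilbert_space
begin

lift_definition cinner_htensor :: "('a, 'b) htensor \<Rightarrow> ('a, 'b) htensor \<Rightarrow> complex"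
  is "\<lambda>s t. lim (\<lambda>n. ft_inner (s n) (t n))" by (rule ft_rel_inner_lim)

lemma htensor_inner_lim:
  "ft_cauchy s \<Longrightarrow> ft_cauchy t \<Longrightarrow> (\<lambda>n. ft_inner (s n) (t n)) \<longlonglongrightarrow> cinner (abs_htensor s) (abs_htensor t)"
  by (simp add: cinner_htensor.abs_eq convergent_LIMSEQ_iff[symmetric] ft_cauchy_inner_convergent)

instance
proof
  fix x y z :: "('a, 'b) htensor" and c :: complex
  obtain s where s: "ft_cauchy s" "x = abs_htensor s" by (rule htensor_cases)
  obtain t where t: "ft_cauchy t" "y = abs_htensor t" by (rule htensor_cases)
  obtain u where u: "ft_cauchy u" "z = abs_htensor u" by (rule htensor_cases)
  have pl: "y + z = abs_htensor (\<lambda>n. t n @ u n)"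
    by (simp add: plus_htensor.abs_eq t u)
  have sc: "c *\<^sub>C y = abs_htensor (\<lambda>n. ft_scale c (t n))"
    by (simp add: scaleC_htensor.abs_eq t)
  show "cinner x y = cnj (cinner y x)"
    using htensor_inner_lim[OF s(1) t(1)] tendsto_cnj[OF htensor_inner_lim[OF t(1) s(1)]]
    unfolding ft_inner_commute[symmetric] s(2) t(2) by (rule LIMSEQ_unique)
  show "cinner x (y + z) = cinner x y + cinner x z"
    using htensor_inner_lim[OF s(1) ft_cauchy_append[OF t(1) u(1)]]
      tendsto_add[OF htensor_inner_lim[OF s(1) t(1)] htensor_inner_lim[OF s(1) u(1)]]
    unfolding pl ft_inner_append unfolding s(2) t(2) u(2) by (rule LIMSEQ_unique)
  show "cinner x (c *\<^sub>C y) = c * cinner x y"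
    using htensor_inner_lim[OF s(1) ft_cauchy_scale[OF t(1), of c]]
      tendsto_mult[OF tendsto_const[of c] htensor_inner_lim[OF s(1) t(1)]]
    unfolding sc ft_inner_scale unfolding s(2) t(2) by (rule LIMSEQ_unique)
  show "(norm x)\<^sup>2 = Re (cinner x x)"
    using tendsto_power[OF htensor_norm_lim[OF s(1)], of 2] tendsto_Re[OF htensor_inner_lim[OF s(1) s(1)]]
    unfolding ft_norm_sq s(2) by (rule LIMSEQ_unique)
next
  fix X :: "nat \<Rightarrow> ('a, 'b) htensor"
  assume X: "Cauchy X"
  have "\<exists>L. norm (X n - abs_htensor (\<lambda>_. L)) < inverse (real (Suc n))" for n
    by (rule htensor_const_approx) simp
  then obtain L where L: "\<And>n. norm (X n - abs_htensor (\<lambda>_. L n)) < inverse (real (Suc n))"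
    by metis
  have lim: "(\<lambda>n. X n - abs_htensor (\<lambda>_. L n)) \<longlonglongrightarrow> 0"
    by (rule LIMSEQ_null_bound[OF LIMSEQ_inverse_real_of_nat]) (use L in \<open>auto intro: less_imp_le\<close>)
  have "Cauchy (\<lambda>n. abs_htensor (\<lambda>_. L n))"
  proof (rule metric_CauchyI)
    fix e :: real assume "e > 0"
    then obtain N1 where N1: "\<And>m n. m \<ge> N1 \<Longrightarrow> n \<ge> N1 \<Longrightarrow> norm (X m - X n) < e / 3"
      using CauchyD[OF X, of "e / 3"] by auto
    obtain N2 where N2: "\<And>n. n \<ge> N2 \<Longrightarrow> norm (X n - abs_htensor (\<lambda>_. L n)) < e / 3"
      using LIMSEQ_D[OF lim, of "e / 3"] \<open>e > 0\<close> by auto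
    have "dist (abs_htensor (\<lambda>_. L m)) (abs_htensor (\<lambda>_. L n)) < e"
      if "m \<ge> max N1 N2" "n \<ge> max N1 N2" for m n
      using N1[of m n] N2[of m] N2[of n] that
        dist_triangle3[of "abs_htensor (\<lambda>_. L m)" "abs_htensor (\<lambda>_. L n)" "X m"]
        dist_triangle[of "X m" "abs_htensor (\<lambda>_. L n)" "X n"]
      by (simp add: dist_norm)
    then show "\<exists>M. \<forall>m\<ge>M. \<forall>n\<ge>M. dist (abs_htensor (\<lambda>_. L m)) (abs_htensor (\<lambda>_. L n)) < e"
      by blast
  qed
  moreover have "dist (abs_htensor (\<lambda>_. L m)) (abs_htensor (\<lambda>_. L n)) = ft_norm (ft_diff (L m) (L n))" for m n
    by (simp add: dist_norm htensor_diff_abs htensor_norm_const)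
  ultimately have "ft_cauchy L" unfolding Cauchy_def ft_cauchy_def by simp
  from tendsto_add[OF lim htensor_const_approx_seq[OF this]]
  show "convergent X" by (auto simp: convergent_def)
qed

end

lift_definition tensor :: "'a::chilbert_space \<Rightarrow> 'b::chilbert_space \<Rightarrow> ('a, 'b) htensor"  (infixr "\<otimes>\<^sub>h" 70)
  is "\<lambda>x y _. [(x, y)]" by simp

lemma cinner_tensor: "cinner (x \<otimes>\<^sub>h y) (x' \<otimes>\<^sub>h y') = cinner x x' * cinner y y'"
  by (simp add: tensor.abs_eq cinner_htensor.abs_eq ft_inner_def)

lemma norm_tensor: "norm (x \<otimes>\<^sub>h y) = norm x * norm y"
proof -
  have "complex_of_real ((norm (x \<otimes>\<^sub>h y))\<^sup>2) = complex_of_real ((norm x * norm y)\<^sup>2)"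
    unfolding cinner_self[symmetric] cinner_tensor power_mult_distrib of_real_mult ..
  then have "(norm (x \<otimes>\<^sub>h y))\<^sup>2 = (norm x * norm y)\<^sup>2" unfolding of_real_eq_iff .
  then show ?thesis by (simp add: power2_eq_iff_nonneg)
qed

lemma tensor_add_left: "(x + x') \<otimes>\<^sub>h y = x \<otimes>\<^sub>h y + x' \<otimes>\<^sub>h y"
  by transfer (rule ft_rel_eqI; simp add: ft_cauchy_append ft_inner_def cinner_add_right algebra_simps sum_list_add)

lemma tensor_add_right: "x \<otimes>\<^sub>h (y + y') = x \<otimes>\<^sub>h y + x \<otimes>\<^sub>h y'"
  by transfer (rule ft_rel_eqI; simp add: ft_inner_def cinner_add_right algebra_simps sum_list_add)

lemma tensor_scaleC_left: "(c *\<^sub>C x) \<otimes>\<^sub>h y = c *\<^sub>C (x \<otimes>\<^sub>h y)"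
  by transfer (rule ft_rel_eqI; simp add: ft_scale_def)

lemma tensor_scaleC_right: "x \<otimes>\<^sub>h (c *\<^sub>C y) = c *\<^sub>C (x \<otimes>\<^sub>h y)"
  by transfer (rule ft_rel_eqI; simp add: ft_scale_def ft_inner_def mult_ac)

lemma htensor_const_sum: "abs_htensor (\<lambda>_. L) = (\<Sum>p\<leftarrow>L. fst p \<otimes>\<^sub>h snd p)"
proof (induction L)
  case Nil
  show ?case by (simp add: zero_htensor_def)
next
  case (Cons p L)
  have "abs_htensor (\<lambda>_. p # L) = fst p \<otimes>\<^sub>h snd p + abs_htensor (\<lambda>_. L)"
    by (simp add: tensor.abs_eq plus_htensor.abs_eq)
  then show ?case by (simp add: Cons)
qed

lemma tensor_span_dense:
  "closure (cspan {x \<otimes>\<^sub>h y | x y. True}) = (UNIV :: ('a::chilbert_space, 'b::chilbert_space) htensor set)"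
proof -
  let ?T = "{x \<otimes>\<^sub>h y | x y. True} :: ('a, 'b) htensor set"
  have span: "abs_htensor (\<lambda>_. L) \<in> cspan ?T" for L
    unfolding htensor_const_sum
  proof (induction L)
    case (Cons p L)
    have "fst p \<otimes>\<^sub>h snd p \<in> cspan ?T"
      by (rule complex_vector.span_base) blast
    from complex_vector.span_add[OF this Cons] show ?case by simp
  qed (simp add: complex_vector.span_zero)
  have "x \<in> closure (cspan ?T)" for x
  proof -
    obtain s where s: "ft_cauchy s" "x = abs_htensor s" by (rule htensor_cases)
    show ?thesis unfolding closure_sequential s(2)
      by (intro exI[of _ "\<lambda>n. abs_htensor (\<lambda>_. s n)"] conjI allI span htensor_const_approx_seq s(1))
  qed
  then show ?thesis by blast
qed

lemma blinfun_eq_on_tensors: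
  fixes S T :: "('a::chilbert_space, 'b::chilbert_space) htensor \<Rightarrow>\<^sub>L 'c::complex_normed_vector"
  assumes "\<And>x y. S (x \<otimes>\<^sub>h y) = T (x \<otimes>\<^sub>h y)"
  shows "S = T"
proof (rule blinfun_eqI)
  fix v
  define D where "D = S - T"
  have "closed {v. D v = 0}"
    by (intro closed_Collect_eq continuous_intros)
  moreover have "D (\<Sum>p\<leftarrow>L. fst p \<otimes>\<^sub>h snd p) = 0" for L
    by (induction L) (simp_all add: D_def blinfun.diff_left blinfun.add_right assms)
  ultimately have "D (abs_htensor s) = 0" if "ft_cauchy s" for s
    using closed_sequentially[OF _ _ htensor_const_approx_seq[OF that]]
    unfolding htensor_const_sum by blast
  then have "D v = 0" by (metis htensor_cases)
  then show "S v = T v" by (simp add: D_def blinfun.diff_left)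
qed

lemma map_tensor_exists:
  fixes S :: "'a::chilbert_space \<Rightarrow>\<^sub>L 'a" and T :: "'b::chilbert_space \<Rightarrow>\<^sub>L 'b"
  assumes S: "clinear (blinfun_apply S)" and T: "clinear (blinfun_apply T)"
  shows "\<exists>R :: ('a, 'b) htensor \<Rightarrow>\<^sub>L ('a, 'b) htensor. clinear (blinfun_apply R) \<and>
    (\<forall>x y. R (x \<otimes>\<^sub>h y) = S x \<otimes>\<^sub>h T y)"
proof -
  define h where "h = map (map_prod (blinfun_apply S) (blinfun_apply T))"
  define K where "K = norm S * norm T"
  have "K \<ge> 0" by (simp add: K_def)
  have h: "h L = map (apfst (blinfun_apply S)) (map (apsnd (blinfun_apply T)) L)" for L
    by (auto simp: h_def apfst_def apsnd_def)
  have hn: "ft_norm (h L) \<le> K * ft_norm L" for L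
  proof -
    have "ft_norm (h L) \<le> norm S * ft_norm (map (apsnd (blinfun_apply T)) L)"
      unfolding h by (rule ft_norm_map_fst[OF S norm_blinfun]) simp
    also have "\<dots> \<le> norm S * (norm T * ft_norm L)"
      by (intro mult_left_mono ft_norm_map_snd[OF T norm_blinfun]) auto
    finally show ?thesis by (simp add: K_def)
  qed
  have ha: "h (L @ M) = h L @ h M" and hs: "h (ft_scale c L) = ft_scale c (h L)" for L M c
    using S by (auto simp: h_def ft_scale_def clinear_def)
  have hd: "ft_diff (h L) (h M) = h (ft_diff L M)" for L M
    by (simp add: ft_diff_def ha hs)
  have hc: "ft_cauchy (\<lambda>n. h (s n))" if "ft_cauchy s" for s
    by (rule ft_cauchyI_bound[OF that ft_cauchy_const[of "[]"] \<open>K \<ge> 0\<close>])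
       (use hn in \<open>simp add: hd ft_norm_diff_zero\<close>)
  have hr: "ft_rel (\<lambda>n. h (s n)) (\<lambda>n. h (t n))" if "ft_rel s t" for s t
  proof -
    have "(\<lambda>n. K * ft_norm (ft_diff (s n) (t n))) \<longlonglongrightarrow> K * 0"
      using that unfolding ft_rel_def by (intro tendsto_intros) auto
    then have "(\<lambda>n. ft_norm (ft_diff (h (s n)) (h (t n)))) \<longlonglongrightarrow> 0"
      unfolding mult_zero_right by (rule LIMSEQ_null_bound) (simp add: hd hn)
    then show ?thesis using that hc by (simp add: ft_rel_def)
  qed
  define R where "R = (\<lambda>v. abs_htensor (\<lambda>n. h (rep_htensor v n)))"
  have R: "R (abs_htensor s) = abs_htensor (\<lambda>n. h (s n))" if "ft_cauchy s" for s
  proof -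
    have "ft_rel (rep_htensor (abs_htensor s)) s"
      using that by (simp add: Quotient3_rep_abs[OF Quotient3_htensor])
    from hr[OF this] show ?thesis unfolding R_def
      by (rule Quotient3_rel_abs[OF Quotient3_htensor])
  qed
  have add: "R (v + w) = R v + R w" for v w
  proof -
    obtain s where s: "ft_cauchy s" "v = abs_htensor s" by (rule htensor_cases)
    obtain t where t: "ft_cauchy t" "w = abs_htensor t" by (rule htensor_cases)
    show ?thesis using s t by (simp add: plus_htensor.abs_eq R ft_cauchy_append ha hc)
  qed
  have scale: "R (c *\<^sub>C v) = c *\<^sub>C R v" for c v
  proof -
    obtain s where s: "ft_cauchy s" "v = abs_htensor s" by (rule htensor_cases)
    show ?thesis using s by (simp add: scaleC_htensor.abs_eq R ft_cauchy_scale hs hc)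
  qed
  have "norm (R v) \<le> norm v * K" for v
  proof -
    obtain s where s: "ft_cauchy s" "v = abs_htensor s" by (rule htensor_cases)
    have "norm (R v) \<le> K * norm v"
      unfolding s(2) R[OF s(1)]
      by (rule LIMSEQ_le[OF htensor_norm_lim[OF hc[OF s(1)]]
            tendsto_mult[OF tendsto_const htensor_norm_lim[OF s(1)]]]) (auto intro: hn)
    then show ?thesis by (simp add: mult.commute)
  qed
  then have "bounded_linear R"
    by (intro bounded_linear_intro[where K = K]) (auto simp: add scale scaleR_scaleC)
  moreover have "R (x \<otimes>\<^sub>h y) = S x \<otimes>\<^sub>h T y" for x y
    by (simp add: tensor.abs_eq R h_def)
  ultimately show ?thesis using add scale
    by (intro exI[of _ "Blinfun R"]) (auto simp: bounded_linear_Blinfun_apply clinear_def)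
qed

text \<open>The elements of \<^typ>\<open>'a \<Rightarrow>\<^sub>L 'a\<close> are only real-linear; \<open>B(H)\<close> consists of the complex-linear
  ones. The operator norm is that of \<^typ>\<open>'a \<Rightarrow>\<^sub>L 'a\<close>.\<close>

definition bounded_operators :: "('a::chilbert_space \<Rightarrow>\<^sub>L 'a) set"
  where "bounded_operators = {T. clinear (blinfun_apply T)}"

definition map_tensor :: "('a::chilbert_space \<Rightarrow>\<^sub>L 'a) \<Rightarrow> ('b::chilbert_space \<Rightarrow>\<^sub>L 'b) \<Rightarrow>
    (('a, 'b) htensor \<Rightarrow>\<^sub>L ('a, 'b) htensor)"  (infixr "\<otimes>\<^sub>o" 70)
  where "S \<otimes>\<^sub>o T = (THE R. R \<in> bounded_operators \<and> (\<forall>x y. R (x \<otimes>\<^sub>h y) = S x \<otimes>\<^sub>h T y))"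

lemma map_tensor:
  assumes "S \<in> bounded_operators" "T \<in> bounded_operators"
  shows "S \<otimes>\<^sub>o T \<in> bounded_operators" "(S \<otimes>\<^sub>o T) (x \<otimes>\<^sub>h y) = S x \<otimes>\<^sub>h T y"
proof -
  let ?P = "\<lambda>R. R \<in> bounded_operators \<and> (\<forall>x y. R (x \<otimes>\<^sub>h y) = S x \<otimes>\<^sub>h T y)"
  have "\<exists>R. ?P R" using map_tensor_exists[of S T] assms by (auto simp: bounded_operators_def)
  moreover have "R = R'" if "?P R" "?P R'" for R R'
    using that by (intro blinfun_eq_on_tensors) simp
  ultimately have "\<exists>!R. ?P R" by blast
  from theI'[OF this]
  show "S \<otimes>\<^sub>o T \<in> bounded_operators" "(S \<otimes>\<^sub>o T) (x \<otimes>\<^sub>h y) = S x \<otimes>\<^sub>h T y"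
    unfolding map_tensor_def by blast+
qed

definition closed_subalgebra :: "('a::chilbert_space \<Rightarrow>\<^sub>L 'a) set \<Rightarrow> bool"
  where "closed_subalgebra A \<longleftrightarrow> A \<subseteq> bounded_operators \<and> csubspace A \<and>
    (\<forall>S\<in>A. \<forall>T\<in>A. S o\<^sub>L T \<in> A) \<and> closed A"

definition is_adjoint :: "('a::chilbert_space \<Rightarrow>\<^sub>L 'a) \<Rightarrow> ('a \<Rightarrow>\<^sub>L 'a) \<Rightarrow> bool"
  where "is_adjoint S T \<longleftrightarrow> (\<forall>x y. cinner (S x) y = cinner x (T y))"

text \<open>The set \<open>A\<^sup>*\<close> is given through the relation \<open>S = T\<^sup>*\<close>, which determines \<open>S\<close> uniquely
  from \<open>T\<close> and conversely.\<close>

definition diag :: "('a::chilbert_space \<Rightarrow>\<^sub>L 'a) set \<Rightarrow> ('a \<Rightarrow>\<^sub>L 'a) set"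
  where "diag A = A \<inter> {S. \<exists>T\<in>A. is_adjoint S T}"

definition nondegenerate :: "('a::chilbert_space \<Rightarrow>\<^sub>L 'a) set \<Rightarrow> bool"
  where "nondegenerate A \<longleftrightarrow> closure (cspan {blinfun_apply T x | T x. T \<in> A}) = (UNIV :: 'a set)"

text \<open>Nets are rendered by proper filters on the space of operators: a net yields the image filter,
  and every filter is the image filter of a net.\<close>

definition has_contractive_approximate_unit_in ::
    "('a::chilbert_space \<Rightarrow>\<^sub>L 'a) set \<Rightarrow> ('a \<Rightarrow>\<^sub>L 'a) set \<Rightarrow> bool"
  where "has_contractive_approximate_unit_in A D \<longleftrightarrow>
    (\<exists>F. F \<noteq> bot \<and> (\<forall>\<^sub>F E in F. E \<in> D \<and> norm E \<le> 1) \<and>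
      (\<forall>T\<in>A. ((\<lambda>E. E o\<^sub>L T) \<longlongrightarrow> T) F \<and> ((\<lambda>E. T o\<^sub>L E) \<longlongrightarrow> T) F))"

text \<open>The requirement of a contractive approximate unit in the diagonal is a standing assumption
  on operator algebras here.\<close>

definition operator_algebra :: "('a::chilbert_space \<Rightarrow>\<^sub>L 'a) set \<Rightarrow> bool"
  where "operator_algebra A \<longleftrightarrow> closed_subalgebra A \<and> nondegenerate A \<and>
    has_contractive_approximate_unit_in A (diag A)"

definition c0 :: "'g set \<Rightarrow> ('g \<Rightarrow> complex) set"
  where "c0 \<Gamma> = {f. (\<forall>\<gamma>. \<gamma> \<notin> \<Gamma> \<longrightarrow> f \<gamma> = 0) \<and> (\<forall>\<epsilon>>0. finite {\<gamma>\<in>\<Gamma>. \<epsilon> \<le> cmod (f \<gamma>)})}"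

definition star_isomorphic_c0 :: "('a::chilbert_space \<Rightarrow>\<^sub>L 'a) set \<Rightarrow> 'g set \<Rightarrow> bool"
  where "star_isomorphic_c0 D \<Gamma> \<longleftrightarrow> (\<exists>\<pi>. bij_betw \<pi> D (c0 \<Gamma>) \<and>
    (\<forall>S\<in>D. \<forall>T\<in>D. \<pi> (S + T) = (\<lambda>\<gamma>. \<pi> S \<gamma> + \<pi> T \<gamma>)) \<and>
    (\<forall>c. \<forall>T\<in>D. \<pi> (c *\<^sub>C T) = (\<lambda>\<gamma>. c * \<pi> T \<gamma>)) \<and>
    (\<forall>S\<in>D. \<forall>T\<in>D. \<pi> (S o\<^sub>L T) = (\<lambda>\<gamma>. \<pi> S \<gamma> * \<pi> T \<gamma>)) \<and>
    (\<forall>S\<in>D. \<forall>T\<in>D. is_adjoint S T \<longrightarrow> \<pi> S = (\<lambda>\<gamma>. cnj (\<pi> T \<gamma>))))"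

definition compact_operators :: "('a::chilbert_space \<Rightarrow>\<^sub>L 'a) set"
  where "compact_operators = {T \<in> bounded_operators. compact (closure (blinfun_apply T ` cball 0 1))}"

definition spatial_tensor :: "('a::chilbert_space \<Rightarrow>\<^sub>L 'a) set \<Rightarrow> ('b::chilbert_space \<Rightarrow>\<^sub>L 'b) set \<Rightarrow>
    (('a, 'b) htensor \<Rightarrow>\<^sub>L ('a, 'b) htensor) set"
  where "spatial_tensor A B = closed_subalgebra hull {S \<otimes>\<^sub>o T | S T. S \<in> A \<and> T \<in> B}"

definition isometrically_isomorphic ::
    "('a::chilbert_space \<Rightarrow>\<^sub>L 'a) set \<Rightarrow> ('b::chilbert_space \<Rightarrow>\<^sub>L 'b) set \<Rightarrow> bool"
  where "isometrically_isomorphic A B \<longleftrightarrow> (\<exists>\<phi>. bij_betw \<phi> A B \<and>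
    (\<forall>S\<in>A. \<forall>T\<in>A. \<phi> (S + T) = \<phi> S + \<phi> T) \<and>
    (\<forall>c. \<forall>T\<in>A. \<phi> (c *\<^sub>C T) = c *\<^sub>C \<phi> T) \<and>
    (\<forall>S\<in>A. \<forall>T\<in>A. \<phi> (S o\<^sub>L T) = \<phi> S o\<^sub>L \<phi> T) \<and>
    (\<forall>T\<in>A. norm (\<phi> T) = norm T))"

lemma closed_subalgebra_bounded_operators:
  "closed_subalgebra (bounded_operators :: ('a::chilbert_space \<Rightarrow>\<^sub>L 'a) set)"
proof -
  have "closed {T :: 'a \<Rightarrow>\<^sub>L 'a. T (c *\<^sub>C x) = c *\<^sub>C T x}" for c x
  proof -
    have "bounded_linear (\<lambda>v :: 'a. c *\<^sub>C v)"
      by (rule bounded_linear_intro[where K = "cmod c"]) (simp_all add: scaleC_add_right scaleC_scaleR)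
    note cont = bounded_linear.continuous_on[OF this]
    show ?thesis by (intro closed_Collect_eq cont continuous_intros)
  qed
  then have "closed {T :: 'a \<Rightarrow>\<^sub>L 'a. \<forall>c x. T (c *\<^sub>C x) = c *\<^sub>C T x}"
    by (intro closed_Collect_all)
  moreover have "(bounded_operators :: ('a \<Rightarrow>\<^sub>L 'a) set) = {T :: 'a \<Rightarrow>\<^sub>L 'a. \<forall>c x. T (c *\<^sub>C x) = c *\<^sub>C T x}"
    by (auto simp: bounded_operators_def clinear_def blinfun.add_right)
  moreover have "csubspace (bounded_operators :: ('a \<Rightarrow>\<^sub>L 'a) set)"
    by (auto simp: complex_vector.subspace_def bounded_operators_def clinear_def blinfun.add_right
        blinfun.add_left scaleC_blinfun.rep_eq scaleC_add_right mult.commute)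
  ultimately show ?thesis
    by (auto simp: closed_subalgebra_def bounded_operators_def clinear_def)
qed

lemma closed_subalgebra_spatial_tensor:
  assumes "A \<subseteq> bounded_operators" "B \<subseteq> bounded_operators"
  shows "closed_subalgebra (spatial_tensor A B)"
proof -
  let ?F = "{C. closed_subalgebra C \<and> {S \<otimes>\<^sub>o T | S T. S \<in> A \<and> T \<in> B} \<subseteq> C}"
  have "bounded_operators \<in> ?F"
    using assms map_tensor(1) closed_subalgebra_bounded_operators by auto
  then have "\<Inter>?F \<subseteq> bounded_operators" by blast
  moreover have "csubspace (\<Inter>?F)"
    by (intro complex_vector.subspace_Inter) (auto simp: closed_subalgebra_def)
  moreover have "closed (\<Inter>?F)"
    by (intro closed_Inter) (auto simp: closed_subalgebra_def)
  moreover have "\<forall>S\<in>\<Inter>?F. \<forall>T\<in>\<Inter>?F. S o\<^sub>L T \<in> \<Inter>?F"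
    by (auto simp: closed_subalgebra_def)
  ultimately show ?thesis
    unfolding spatial_tensor_def hull_def by (auto simp: closed_subalgebra_def)
qed

end

theory Submission
  imports Defs
begin

text \<open>
  Write \<open>p\<^sub>\<gamma>\<close> for the minimal projections of the diagonal of \<open>A\<close>, \<open>q\<^sub>\<delta>\<close> for those of \<open>B\<close>, and let
  \<open>e\<close> be a rank one projection. Each \<open>p\<^sub>\<gamma> \<otimes> e\<close> is a minimal projection of \<open>A \<otimes> K\<close>, and every minimal
  projection of \<open>A \<otimes> K\<close> is Murray-von Neumann equivalent to exactly one of them. Idempotents of norm at
  most one are selfadjoint, and partial isometries are given by pairs of contractions \<open>v\<close>, \<open>w\<close> with
  \<open>v w v = v\<close> and \<open>w v w = w\<close>, so an isometric isomorphism \<open>\<phi>\<close> preserves all this and induces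
  a bijection \<open>\<sigma>\<close> of the index sets with partial isometries \<open>v\<^sub>\<gamma>\<close> from \<open>\<phi>(p\<^sub>\<gamma> \<otimes> e)\<close> to \<open>q\<^bsub>\<sigma>(\<gamma>)\<^esub> \<otimes> e\<close>.
  For finite \<open>F\<close> let \<open>V\<^sub>F = \<Sum>\<^bsub>\<gamma>\<in>F\<^esub> v\<^sub>\<gamma>\<close> and \<open>p\<^sub>F = \<Sum>\<^bsub>\<gamma>\<in>F\<^esub> p\<^sub>\<gamma>\<close>. The maps \<open>a \<mapsto> V\<^sub>F \<phi>(a \<otimes> e) V\<^sub>F\<^sup>*\<close>
  identify \<open>p\<^sub>F A p\<^sub>F\<close> with the corresponding corner of \<open>B\<close>, compatibly in \<open>F\<close>, and the unions of
  these corners are dense because the approximate units lie in the diagonals.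
\<close>

section \<open>Adjoints and contractive pairs\<close>

instance chilbert_space \<subseteq> banach ..

text \<open>The Cauchy-Schwarz inequality for formal sums of tensors is applied to
  \<open>x \<otimes> x\<close> and \<open>y \<otimes> y\<close>, where the form is the square of
  \<open>cinner x y\<close>.\<close>

lemma norm_cinner_le: "cmod (cinner x y) \<le> norm x * norm (y :: 'a::chilbert_space)"
proof -
  have n: "ft_norm [(z, z)] = (norm z)\<^sup>2" for z :: 'a
    by (simp add: ft_norm_def ft_inner_def cinner_self power2_eq_square flip: of_real_mult)
  have "cmod (ft_inner [(x, x)] [(y, y)]) \<le> (norm x)\<^sup>2 * (norm y)\<^sup>2"
    using ft_Cauchy_Schwarz[of "[(x, x)]" "[(y, y)]"] by (simp only: n)
  then have "(cmod (cinner x y))\<^sup>2 \<le> (norm x * norm y)\<^sup>2"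
    by (simp add: ft_inner_def norm_mult power2_eq_square mult_ac)
  then show ?thesis by (rule power2_le_imp_le) simp
qed

lemma cinner_eqI:
  fixes x x' :: "'a::chilbert_space"
  assumes "\<And>y. cinner y x = cinner y x'"
  shows "x = x'"
proof -
  have "complex_of_real ((norm (x - x'))\<^sup>2) = 0"
    unfolding cinner_self[symmetric] by (simp add: cinner_diff_right assms)
  then show ?thesis by simp
qed

lemma norm_add_sq_cinner:
  "(norm (x + y))\<^sup>2 = (norm x)\<^sup>2 + 2 * Re (cinner x y) + (norm y)\<^sup>2" for x y :: "'a::chilbert_space"
  unfolding norm_sq_cinner using cinner_commute[of x y]
  by (simp add: cinner_add_left cinner_add_right)

lemma cinner_eq_0_if_norm_minimal:
  fixes x y :: "'a::chilbert_space"
  assumes "\<And>t. norm x \<le> norm (x + t *\<^sub>C y)"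
  shows "cinner x y = 0"
proof (rule ccontr)
  assume nz: "cinner x y \<noteq> 0"
  define c where "c = cinner x y"
  \<comment> \<open>The optimal step has the square of \<open>norm y\<close> in its denominator.
    Adding 1 keeps the denominator positive for every \<open>y\<close>, and the resulting bound
    \<open>s * (norm y)^2 \<le> 1\<close> still gives the contradiction.\<close>
  define s where "s = 1 / ((norm y)\<^sup>2 + 1)"
  define t where "t = - complex_of_real s * cnj c"
  have pos: "(norm y)\<^sup>2 + 1 > 0" by (simp add: add_nonneg_pos)
  have "(norm x)\<^sup>2 \<le> (norm (x + t *\<^sub>C y))\<^sup>2"
    by (rule power_mono[OF assms]) simp
  also have "\<dots> = (norm x)\<^sup>2 + 2 * Re (t * c) + (cmod t)\<^sup>2 * (norm y)\<^sup>2"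
    by (simp add: norm_add_sq_cinner c_def power_mult_distrib)
  also have "t * c = - complex_of_real (s * (cmod c)\<^sup>2)"
    by (simp add: t_def complex_norm_square mult.commute del: of_real_power)
  also have "(cmod t)\<^sup>2 = s\<^sup>2 * (cmod c)\<^sup>2"
    by (simp add: t_def norm_mult power_mult_distrib)
  finally have "2 * (s * (cmod c)\<^sup>2) \<le> s\<^sup>2 * (cmod c)\<^sup>2 * (norm y)\<^sup>2"
    by simp
  then have "2 * (s * (cmod c)\<^sup>2) \<le> (s * (cmod c)\<^sup>2) * (s * (norm y)\<^sup>2)"
    by (simp add: power2_eq_square mult_ac)
  moreover have "s * (cmod c)\<^sup>2 > 0" using nz pos by (simp add: s_def c_def)
  ultimately have "2 \<le> s * (norm y)\<^sup>2" by (metis mult.commute mult_le_cancel_right_pos)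
  moreover have "s * (norm y)\<^sup>2 \<le> 1" using pos by (simp add: s_def field_simps)
  ultimately show False by linarith
qed

section \<open>Complex-linear operators, adjoint pairs and norm bounds\<close>

lemma bounded_operatorsD:
  assumes "T \<in> bounded_operators"
  shows "T (c *\<^sub>C x) = c *\<^sub>C T x"
  using assms by (simp add: bounded_operators_def clinear_def)

lemma csubspace_bounded_operators: "csubspace (bounded_operators :: ('a::chilbert_space \<Rightarrow>\<^sub>L 'a) set)"
  using closed_subalgebra_bounded_operators[where ?'a = 'a] by (simp add: closed_subalgebra_def)

lemma bounded_operators_compose:
  "S \<in> bounded_operators \<Longrightarrow> T \<in> bounded_operators \<Longrightarrow> S o\<^sub>L T \<in> bounded_operators"
  by (simp add: bounded_operators_def clinear_def)

lemma bounded_operators_id [simp]: "id_blinfun \<in> bounded_operators"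
  by (simp add: bounded_operators_def clinear_def)

lemmas bounded_operators_closed [simp] =
  bounded_operators_compose
  complex_vector.subspace_0[OF csubspace_bounded_operators]
  complex_vector.subspace_add[OF csubspace_bounded_operators]
  complex_vector.subspace_diff[OF csubspace_bounded_operators]
  complex_vector.subspace_scale[OF csubspace_bounded_operators]

lemma is_adjoint_sym: "is_adjoint S T \<Longrightarrow> is_adjoint T S"
  unfolding is_adjoint_def by (metis cinner_commute)

lemma is_adjoint_compose:
  "is_adjoint S T \<Longrightarrow> is_adjoint S' T' \<Longrightarrow> is_adjoint (S o\<^sub>L S') (T' o\<^sub>L T)"
  by (simp add: is_adjoint_def)

lemma is_adjoint_add: "is_adjoint S T \<Longrightarrow> is_adjoint S' T' \<Longrightarrow> is_adjoint (S + S') (T + T')"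
  by (simp add: is_adjoint_def blinfun.add_left cinner_add_left cinner_add_right)

lemma is_adjoint_zero: "is_adjoint 0 0"
  by (simp add: is_adjoint_def)

lemma is_adjoint_sum: "(\<And>i. i \<in> I \<Longrightarrow> is_adjoint (f i) (g i)) \<Longrightarrow> is_adjoint (sum f I) (sum g I)"
  by (induction I rule: infinite_finite_induct) (auto intro: is_adjoint_add is_adjoint_zero)

lemma is_adjoint_scaleC: "is_adjoint S T \<Longrightarrow> is_adjoint (c *\<^sub>C S) (cnj c *\<^sub>C T)"
  by (simp add: is_adjoint_def scaleC_blinfun.rep_eq)

lemma is_adjoint_norm_sq: "is_adjoint V W \<Longrightarrow> (norm (V x))\<^sup>2 = Re (cinner x (W (V x)))"
  by (simp add: is_adjoint_def norm_sq_cinner)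

text \<open>One half of the C*-identity: the square of \<open>norm (V x)\<close> is the real part of
  \<open>cinner x (W (V x))\<close>, which Cauchy-Schwarz bounds through the norm of the
  product.\<close>

lemma norm_le_1_if_adjoint:
  assumes "is_adjoint V W" "norm (W o\<^sub>L V) \<le> 1"
  shows "norm V \<le> 1"
proof (rule norm_blinfun_bound)
  fix x
  have "(norm (V x))\<^sup>2 \<le> norm x * norm ((W o\<^sub>L V) x)"
    unfolding is_adjoint_norm_sq[OF assms(1)] using complex_Re_le_cmod norm_cinner_le order_trans
    by fastforce
  also have "norm ((W o\<^sub>L V) x) \<le> norm (W o\<^sub>L V) * norm x" by (rule norm_blinfun)
  also have "\<dots> \<le> 1 * norm x" using assms(2) by (intro mult_right_mono) auto
  finally have "(norm (V x))\<^sup>2 \<le> (1 * norm x)\<^sup>2"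
    by (simp add: mult_left_mono power2_eq_square)
  then show "norm (V x) \<le> 1 * norm x" by (rule power2_le_imp_le) simp
qed simp

lemma norm_selfadjoint_idempotent_le_1:
  assumes "is_adjoint P P" "P o\<^sub>L P = P"
  shows "norm P \<le> 1"
proof (rule norm_blinfun_bound)
  fix x
  have PP: "P (P x) = P x" by (metis assms(2) blinfun_apply_blinfun_compose)
  have "(norm (P x))\<^sup>2 \<le> norm x * norm (P x)"
    unfolding is_adjoint_norm_sq[OF assms(1)] PP using complex_Re_le_cmod norm_cinner_le order_trans
    by fastforce
  then show "norm (P x) \<le> 1 * norm x"
    by (cases "norm (P x) = 0") (auto simp: power2_eq_square)
qed simp

lemma contraction_apply: "norm T \<le> 1 \<Longrightarrow> norm (blinfun_apply T x) \<le> norm x"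
  using norm_blinfun[of T x] mult_right_mono[of "norm T" 1 "norm x"] by simp

lemma norm_compose_le_1: "norm S \<le> 1 \<Longrightarrow> norm T \<le> 1 \<Longrightarrow> norm (S o\<^sub>L T) \<le> 1"
  by (rule order_trans[OF norm_blinfun_compose]) (simp add: mult_le_one)

lemma norm_compose_le: "norm S \<le> s \<Longrightarrow> norm T \<le> t \<Longrightarrow> norm (S o\<^sub>L T) \<le> s * t"
  by (rule order_trans[OF norm_blinfun_compose]) (intro mult_mono; auto intro: order_trans[OF norm_ge_zero])

lemma norm_compression_le:
  assumes "norm S \<le> 1" "norm T \<le> 1"
  shows "norm (S o\<^sub>L (R o\<^sub>L T)) \<le> norm R"
proof -
  have "norm (R o\<^sub>L T) \<le> norm R"
    using norm_blinfun_compose[of R T] mult_left_mono[OF assms(2) norm_ge_zero[of R]] by simp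
  moreover have "norm (S o\<^sub>L (R o\<^sub>L T)) \<le> norm (R o\<^sub>L T)"
    using norm_blinfun_compose[of S "R o\<^sub>L T"] mult_right_mono[OF assms(1) norm_ge_zero[of "R o\<^sub>L T"]]
    by simp
  ultimately show ?thesis by linarith
qed

text \<open>Contractive pairs of generalized inverses express partial isometries and their adjoints
  in terms that every isometric isomorphism preserves.\<close>

definition contractive_pair :: "('a::chilbert_space \<Rightarrow>\<^sub>L 'a) \<Rightarrow> ('a \<Rightarrow>\<^sub>L 'a) \<Rightarrow> bool"
  where "contractive_pair V W \<longleftrightarrow> norm V \<le> 1 \<and> norm W \<le> 1 \<and>
    V o\<^sub>L (W o\<^sub>L V) = V \<and> W o\<^sub>L (V o\<^sub>L W) = W"

text \<open>A contraction that sends every \<open>P x + t (y - P y)\<close> to \<open>P x\<close>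
  makes \<open>P x\<close> the vector of least norm among these. Hence the range of \<open>P\<close>
  is orthogonal to its kernel.\<close>

lemma contractive_idempotent_selfadjoint:
  assumes P: "P \<in> bounded_operators" "norm P \<le> 1" "P o\<^sub>L P = P"
  shows "is_adjoint P P"
proof -
  have PP: "P (P x) = P x" for x by (metis P(3) blinfun_apply_blinfun_compose)
  have orth: "cinner (P x) (y - P y) = 0" for x y
  proof (rule cinner_eq_0_if_norm_minimal)
    fix t
    have "P (P x + t *\<^sub>C (y - P y)) = P x"
      by (simp add: blinfun.add_right bounded_operatorsD[OF P(1)] blinfun.diff_right PP)
    then show "norm (P x) \<le> norm (P x + t *\<^sub>C (y - P y))"
      using contraction_apply[OF P(2)] by metis
  qed
  have "cinner (P x) y = cinner (P x) (P y)" for x y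
    using orth[of x y] by (simp add: cinner_diff_right)
  then show ?thesis unfolding is_adjoint_def by (metis cinner_commute)
qed

text \<open>Polarization: expanding the norm at \<open>x + y\<close> gives the real parts, and
  replacing \<open>y\<close> by \<open>\<i> y\<close> gives the imaginary parts, which is where
  complex linearity enters.\<close>

lemma cinner_eq_if_norm_eq:
  assumes S: "S \<in> bounded_operators" and T: "T \<in> bounded_operators"
    and n: "\<And>x. norm (blinfun_apply S x) = norm (blinfun_apply T x)"
  shows "cinner (S x) (S y) = cinner (T x) (T y)"
proof -
  have Re: "Re (cinner (S x) (S y)) = Re (cinner (T x) (T y))" for x y
    using n[of x] n[of y] n[of "x + y"] norm_add_sq_cinner[of "S x" "S y"] norm_add_sq_cinner[of "T x" "T y"]
    by (simp add: blinfun.add_right)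
  have "Im (cinner u v) = - Re (cinner u (\<i> *\<^sub>C v))" for u v :: "'b::chilbert_space" by simp
  then have "Im (cinner (S x) (S y)) = Im (cinner (T x) (T y))"
    using Re[of x "\<i> *\<^sub>C y"] by (metis bounded_operatorsD S T)
  with Re show ?thesis by (simp add: complex_eq_iff)
qed

text \<open>\<open>V W\<close> and \<open>W V\<close> are contractive idempotents, hence
  selfadjoint. Since both factors are contractive, \<open>V\<close> and \<open>W V\<close> have
  equal norms at every vector and so equal inner products. The adjoint relation follows on inserting
  \<open>V W V = V\<close> and \<open>W V W = W\<close>.\<close>

lemma contractive_pair_adjoint:
  assumes V: "V \<in> bounded_operators" and W: "W \<in> bounded_operators" and c: "contractive_pair V W"
  shows "is_adjoint V W"
proof -
  have VWV: "V (W (V x)) = V x" and WVW: "W (V (W x)) = W x" for x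
    using c unfolding contractive_pair_def by (metis blinfun_apply_blinfun_compose)+
  have nV: "norm (V x) \<le> norm x" and nW: "norm (W x) \<le> norm x" for x
    using c by (auto simp: contractive_pair_def contraction_apply)
  have idem: "(V o\<^sub>L W) o\<^sub>L (V o\<^sub>L W) = V o\<^sub>L W" "(W o\<^sub>L V) o\<^sub>L (W o\<^sub>L V) = W o\<^sub>L V"
    by (auto intro!: blinfun_eqI simp: VWV WVW)
  have sa: "is_adjoint (V o\<^sub>L W) (V o\<^sub>L W)" "is_adjoint (W o\<^sub>L V) (W o\<^sub>L V)"
    using c V W idem
    by (auto intro!: contractive_idempotent_selfadjoint norm_compose_le_1 simp: contractive_pair_def)
  have "norm (V x) = norm ((W o\<^sub>L V) x)" for x
    using nW[of "V x"] nV[of "W (V x)"] by (simp add: VWV)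
  from cinner_eq_if_norm_eq[OF V _ this] V W
  have iso: "cinner (V x) (V y) = cinner ((W o\<^sub>L V) x) ((W o\<^sub>L V) y)" for x y by simp
  have "cinner (V x) y = cinner x (W y)" for x y
  proof -
    have "cinner (V x) y = cinner ((V o\<^sub>L W) (V x)) y" by (simp add: VWV)
    also have "\<dots> = cinner (V x) (V (W y))" using sa(1) unfolding is_adjoint_def by simp
    also have "\<dots> = cinner ((W o\<^sub>L V) x) (W y)" by (simp add: iso WVW)
    also have "\<dots> = cinner x (W y)" using sa(2) unfolding is_adjoint_def by (simp add: WVW)
    finally show ?thesis .
  qed
  then show ?thesis by (simp add: is_adjoint_def)
qed

lemma contractive_pair_sym: "contractive_pair V W \<Longrightarrow> contractive_pair W V"
  by (simp add: contractive_pair_def)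

section \<open>Rank one operators and products of compact operators\<close>

definition rank_one :: "'a::chilbert_space \<Rightarrow> 'a \<Rightarrow> ('a \<Rightarrow>\<^sub>L 'a)"
  where "rank_one x y = Blinfun (\<lambda>z. cinner y z *\<^sub>C x)"

lemma rank_one_apply [simp]: "rank_one x y z = cinner y z *\<^sub>C x"
proof -
  have "bounded_linear (\<lambda>z. cinner y z *\<^sub>C x)"
  proof (rule bounded_linear_intro[where K = "norm y * norm x"])
    fix z
    show "norm (cinner y z *\<^sub>C x) \<le> norm z * (norm y * norm x)"
      using mult_right_mono[OF norm_cinner_le[of y z], of "norm x"] by (simp add: mult_ac)
  qed (simp_all add: cinner_add_right scaleC_add_left scaleR_scaleC)
  then show ?thesis by (simp add: rank_one_def bounded_linear_Blinfun_apply)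
qed

lemma rank_one_bounded_operators [simp]: "rank_one x y \<in> bounded_operators"
  by (simp add: bounded_operators_def clinear_def cinner_add_right scaleC_add_left)

text \<open>With one unit vector in all four places, a rank one projection compresses
  \<open>T\<close> to a scalar multiple of itself. This is how the second tensor factor is removed
  later.\<close>

lemma rank_one_compose:
  "T \<in> bounded_operators \<Longrightarrow> rank_one x y o\<^sub>L (T o\<^sub>L rank_one u v) = cinner y (T u) *\<^sub>C rank_one x v"
  by (auto intro!: blinfun_eqI simp: bounded_operatorsD scaleC_blinfun.rep_eq mult.commute)

lemma rank_one_unit_compose: "norm y = 1 \<Longrightarrow> rank_one x y o\<^sub>L rank_one y z = rank_one x z"
  by (rule blinfun_eqI) (simp add: cinner_self)

lemma norm_rank_one_le: "norm (rank_one x y) \<le> norm x * norm y"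
proof (rule norm_blinfun_bound)
  fix z
  show "norm (rank_one x y z) \<le> norm x * norm y * norm z"
    using mult_right_mono[OF norm_cinner_le[of y z], of "norm x"] by (simp add: mult_ac)
qed simp

lemma continuous_scaleC_left: "continuous_on S (\<lambda>c. c *\<^sub>C (x :: 'a::complex_normed_vector))"
proof -
  have "bounded_linear (\<lambda>c. c *\<^sub>C x)"
    by (rule bounded_linear_intro[where K = "norm x"])
       (simp_all add: scaleC_add_left scaleR_scaleC scaleR_conv_of_real)
  then show ?thesis by (rule bounded_linear.continuous_on) (rule continuous_on_id)
qed

text \<open>The unit ball is mapped into the multiples of \<open>x\<close> by scalars from a closed
  disc, and these form a compact set.\<close>

lemma rank_one_compact_operators: "rank_one x y \<in> compact_operators"
proof -
  let ?K = "(\<lambda>c. c *\<^sub>C x) ` cball 0 (norm y)"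
  have K: "compact ?K"
    by (intro compact_continuous_image continuous_scaleC_left compact_cball)
  have "cmod (cinner y z) \<le> norm y" if "norm z \<le> 1" for z
    using norm_cinner_le[of y z] mult_left_mono[OF that, of "norm y"] by simp
  then have "blinfun_apply (rank_one x y) ` cball 0 1 \<subseteq> ?K"
    by auto
  then have "closure (blinfun_apply (rank_one x y) ` cball 0 1) \<subseteq> ?K"
    using K by (simp add: closure_minimal compact_imp_closed)
  then have "compact (closure (blinfun_apply (rank_one x y) ` cball 0 1))"
    using K by (metis closed_closure compact_Int_closed inf.absorb_iff2 inf.commute)
  then show ?thesis by (simp add: compact_operators_def)
qed

lemma compact_operators_compose:
  assumes "S \<in> compact_operators" "T \<in> compact_operators"
  shows "S o\<^sub>L T \<in> compact_operators"
proof -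
  let ?K = "blinfun_apply S ` closure (blinfun_apply T ` cball 0 1)"
  have K: "compact ?K"
    using assms(2) by (intro compact_continuous_image continuous_intros) (auto simp: compact_operators_def)
  have "blinfun_apply (S o\<^sub>L T) ` cball 0 1 \<subseteq> ?K"
    using closure_subset by fastforce
  then have "closure (blinfun_apply (S o\<^sub>L T) ` cball 0 1) \<subseteq> ?K"
    using K by (simp add: closure_minimal compact_imp_closed)
  then have "compact (closure (blinfun_apply (S o\<^sub>L T) ` cball 0 1))"
    using K by (metis closed_closure compact_Int_closed inf.absorb_iff2 inf.commute)
  then show ?thesis using assms by (simp add: compact_operators_def)
qed

section \<open>Tensor products of operators\<close>

lemmas compose_add_left = bounded_bilinear.add_left[OF bounded_bilinear_blinfun_compose]
  and compose_add_right = bounded_bilinear.add_right[OF bounded_bilinear_blinfun_compose]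
  and compose_diff_left = bounded_bilinear.diff_left[OF bounded_bilinear_blinfun_compose]
  and compose_diff_right = bounded_bilinear.diff_right[OF bounded_bilinear_blinfun_compose]
  and compose_sum_left = bounded_bilinear.sum_left[OF bounded_bilinear_blinfun_compose]
  and compose_sum_right = bounded_bilinear.sum_right[OF bounded_bilinear_blinfun_compose]
  and tendsto_compose_blinfun = bounded_bilinear.tendsto[OF bounded_bilinear_blinfun_compose]

lemma compose_assoc: "(R o\<^sub>L S) o\<^sub>L T = R o\<^sub>L (S o\<^sub>L T)"
  by (rule blinfun_eqI) simp

lemma compose_id [simp]: "id_blinfun o\<^sub>L T = T" "T o\<^sub>L id_blinfun = T"
  by (auto intro!: blinfun_eqI)

lemma compose_scaleC_left [simp]: "(c *\<^sub>C S) o\<^sub>L T = c *\<^sub>C (S o\<^sub>L T)"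
  for S :: "'b::complex_normed_vector \<Rightarrow>\<^sub>L 'c::complex_normed_vector"
  by (rule blinfun_eqI) (simp add: scaleC_blinfun.rep_eq)

lemma compose_scaleC_right: "S \<in> bounded_operators \<Longrightarrow> S o\<^sub>L (c *\<^sub>C T) = c *\<^sub>C (S o\<^sub>L T)"
  by (rule blinfun_eqI) (simp add: scaleC_blinfun.rep_eq bounded_operatorsD)

lemma scaleC_minus_one: "(- 1) *\<^sub>C x = - (x :: 'a::complex_vector)"
  by (metis complex_vector.scale_minus_left scaleC_one)

lemma tensor_zero_left [simp]: "(0 :: 'a::chilbert_space) \<otimes>\<^sub>h y = (0 :: ('a, 'b::chilbert_space) htensor)"
  using tensor_scaleC_left[of 0 0 y] by simp

lemma tensor_minus_left: "(- x) \<otimes>\<^sub>h y = - (x \<otimes>\<^sub>h y)"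
  using tensor_scaleC_left[of "- 1" x y] by (simp add: scaleC_minus_one)

lemma tensor_diff_left: "(x - x') \<otimes>\<^sub>h y = x \<otimes>\<^sub>h y - x' \<otimes>\<^sub>h y"
  using tensor_add_left[of x "- x'" y] by (simp add: tensor_minus_left)

text \<open>Elementary tensors span a dense subspace, so they determine an operator. The algebraic
  rules for \<open>\<otimes>\<^sub>o\<close> below are all obtained from this.\<close>

lemma map_tensor_eqI:
  fixes R :: "('a::chilbert_space, 'b::chilbert_space) htensor \<Rightarrow>\<^sub>L ('a, 'b) htensor"
  assumes "S \<in> bounded_operators" "T \<in> bounded_operators"
    and "\<And>x y. R (x \<otimes>\<^sub>h y) = S x \<otimes>\<^sub>h T y"
  shows "R = S \<otimes>\<^sub>o T"
  using assms by (intro blinfun_eq_on_tensors) (simp add: map_tensor)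

lemma map_tensor_compose:
  assumes "S \<in> bounded_operators" "S' \<in> bounded_operators"
    and "T \<in> bounded_operators" "T' \<in> bounded_operators"
  shows "(S \<otimes>\<^sub>o T) o\<^sub>L (S' \<otimes>\<^sub>o T') = (S o\<^sub>L S') \<otimes>\<^sub>o (T o\<^sub>L T')"
  using assms by (intro map_tensor_eqI) (simp_all add: map_tensor)

lemma map_tensor_add_left:
  assumes "S \<in> bounded_operators" "S' \<in> bounded_operators" "T \<in> bounded_operators"
  shows "(S + S') \<otimes>\<^sub>o T = S \<otimes>\<^sub>o T + S' \<otimes>\<^sub>o T"
  using assms
  by (intro map_tensor_eqI[symmetric]) (simp_all add: map_tensor blinfun.add_left tensor_add_left)

lemma map_tensor_diff_left:
  assumes "S \<in> bounded_operators" "S' \<in> bounded_operators" "T \<in> bounded_operators"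
  shows "(S - S') \<otimes>\<^sub>o T = S \<otimes>\<^sub>o T - S' \<otimes>\<^sub>o T"
  using assms
  by (intro map_tensor_eqI[symmetric]) (simp_all add: map_tensor blinfun.diff_left tensor_diff_left)

lemma map_tensor_scaleC_left:
  assumes "S \<in> bounded_operators" "T \<in> bounded_operators"
  shows "(c *\<^sub>C S) \<otimes>\<^sub>o T = c *\<^sub>C (S \<otimes>\<^sub>o T)"
  using assms
  by (intro map_tensor_eqI[symmetric]) (simp_all add: map_tensor scaleC_blinfun.rep_eq tensor_scaleC_left)

lemma map_tensor_scaleC_right:
  assumes "S \<in> bounded_operators" "T \<in> bounded_operators"
  shows "S \<otimes>\<^sub>o (c *\<^sub>C T) = c *\<^sub>C (S \<otimes>\<^sub>o T)"
  using assms
  by (intro map_tensor_eqI[symmetric]) (simp_all add: map_tensor scaleC_blinfun.rep_eq tensor_scaleC_right)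

lemma map_tensor_zero_left [simp]:
  assumes "T \<in> bounded_operators"
  shows "0 \<otimes>\<^sub>o T = 0"
  using assms by (intro map_tensor_eqI[symmetric]) simp_all

lemma map_tensor_sum_left:
  assumes "\<And>i. i \<in> I \<Longrightarrow> f i \<in> bounded_operators" "T \<in> bounded_operators"
  shows "sum f I \<otimes>\<^sub>o T = (\<Sum>i\<in>I. f i \<otimes>\<^sub>o T)"
  using assms(1)
proof (induction I rule: infinite_finite_induct)
  case (insert i I)
  then have "sum f I \<in> bounded_operators"
    by (intro complex_vector.subspace_sum[OF csubspace_bounded_operators]) auto
  with insert assms(2) show ?case by (simp add: map_tensor_add_left)
qed (use assms(2) in auto)

text \<open>On a formal sum the operator acts by \<open>T\<close> on the second entries and then by
  \<open>S\<close> on the first ones, and each of these maps has its own bound. Formal sums are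
  dense, so the product of the bounds passes to the limit.\<close>

lemma norm_map_tensor_le:
  fixes S :: "'a::chilbert_space \<Rightarrow>\<^sub>L 'a" and T :: "'b::chilbert_space \<Rightarrow>\<^sub>L 'b"
  assumes S: "S \<in> bounded_operators" and T: "T \<in> bounded_operators"
  shows "norm (S \<otimes>\<^sub>o T) \<le> norm S * norm T"
proof (rule norm_blinfun_bound)
  fix v :: "('a, 'b) htensor"
  let ?h = "\<lambda>L. map (apfst (blinfun_apply S)) (map (apsnd (blinfun_apply T)) L)"
  obtain s where s: "ft_cauchy s" "v = abs_htensor s" by (rule htensor_cases)
  have "(S \<otimes>\<^sub>o T) (abs_htensor (\<lambda>_. L)) = abs_htensor (\<lambda>_. ?h L)" for L
    unfolding htensor_const_sum
    by (induction L) (simp_all add: blinfun.add_right map_tensor[OF S T])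
  moreover have "ft_norm (?h L) \<le> norm S * norm T * ft_norm L" for L
  proof -
    have "ft_norm (?h L) \<le> norm S * ft_norm (map (apsnd (blinfun_apply T)) L)"
      using S by (intro ft_norm_map_fst norm_blinfun) (auto simp: bounded_operators_def)
    also have "\<dots> \<le> norm S * (norm T * ft_norm L)"
      using T by (intro mult_left_mono ft_norm_map_snd norm_blinfun) (auto simp: bounded_operators_def)
    finally show ?thesis by (simp add: mult_ac)
  qed
  ultimately have "norm ((S \<otimes>\<^sub>o T) (abs_htensor (\<lambda>_. L))) \<le> norm S * norm T * norm (abs_htensor (\<lambda>_. L) :: ('a, 'b) htensor)" for L
    by (simp add: htensor_norm_const)
  then have le: "norm ((S \<otimes>\<^sub>o T) (abs_htensor (\<lambda>_. s n)))
      \<le> norm S * norm T * norm (abs_htensor (\<lambda>_. s n) :: ('a, 'b) htensor)" for n .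
  note lim = htensor_const_approx_seq[OF s(1)]
  show "norm ((S \<otimes>\<^sub>o T) v) \<le> norm S * norm T * norm v"
    unfolding s(2)
    by (rule LIMSEQ_le[OF tendsto_norm[OF blinfun.tendsto[OF tendsto_const lim]]
          tendsto_mult[OF tendsto_const tendsto_norm[OF lim]]]) (use le in blast)
qed simp

text \<open>The general bound gives one inequality. The other comes from testing on the vectors
  \<open>z \<otimes> x\<close>, whose second factor is fixed. Thus tensoring with a rank one
  projection is an isometric embedding.\<close>

lemma norm_map_tensor_rank_one:
  assumes S: "S \<in> bounded_operators" and x: "norm x = 1"
  shows "norm (S \<otimes>\<^sub>o rank_one x x) = norm S"
proof (rule antisym)
  show "norm (S \<otimes>\<^sub>o rank_one x x) \<le> norm S"
    using norm_map_tensor_le[OF S rank_one_bounded_operators[of x x]]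
      mult_left_mono[OF norm_rank_one_le[of x x] norm_ge_zero[of S]] x by simp
  show "norm S \<le> norm (S \<otimes>\<^sub>o rank_one x x)"
  proof (rule norm_blinfun_bound)
    fix z
    have "norm ((S \<otimes>\<^sub>o rank_one x x) (z \<otimes>\<^sub>h x)) = norm (S z)"
      by (simp add: map_tensor(2)[OF S] norm_tensor cinner_self x)
    then show "norm (S z) \<le> norm (S \<otimes>\<^sub>o rank_one x x) * norm z"
      using norm_blinfun[of "S \<otimes>\<^sub>o rank_one x x" "z \<otimes>\<^sub>h x"] by (simp add: norm_tensor x)
  qed simp
qed

lemma map_tensor_rank_one_inject:
  assumes "S \<in> bounded_operators" "S' \<in> bounded_operators" "norm x = 1"
  shows "S \<otimes>\<^sub>o rank_one x x = S' \<otimes>\<^sub>o rank_one x x \<longleftrightarrow> S = S'"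
  using norm_map_tensor_rank_one[of "S - S'" x] assms
  by (auto simp: map_tensor_diff_left)

text \<open>Testing on \<open>u \<otimes> x\<close> and \<open>v \<otimes> x\<close> leaves only the
  factor \<open>cinner x x = 1\<close>. In this way adjoints found in a stabilization lead back to
  the diagonal of the algebra.\<close>

lemma is_adjoint_of_map_tensor:
  assumes S: "S \<in> bounded_operators" "S' \<in> bounded_operators" and x: "norm x = 1"
    and adj: "is_adjoint (S \<otimes>\<^sub>o rank_one x x) (S' \<otimes>\<^sub>o rank_one x x)"
  shows "is_adjoint S S'"
  unfolding is_adjoint_def
proof (intro allI)
  fix u v
  show "cinner (S u) v = cinner u (S' v)"
    using adj[unfolded is_adjoint_def, rule_format, of "u \<otimes>\<^sub>h x" "v \<otimes>\<^sub>h x"]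
    by (simp add: map_tensor(2) S cinner_tensor cinner_self x)
qed

section \<open>Closed spans and corners of the spatial tensor product\<close>

lemma csubspace_closure:
  fixes M :: "('a::complex_normed_vector) set"
  assumes "csubspace M"
  shows "csubspace (closure M)"
proof (rule complex_vector.subspaceI)
  show "0 \<in> closure M"
    using complex_vector.subspace_0[OF assms] closure_subset by blast
next
  fix x y assume "x \<in> closure M" "y \<in> closure M"
  then obtain f g where "\<forall>n. f n \<in> M" "f \<longlonglongrightarrow> x" "\<forall>n. g n \<in> M" "g \<longlonglongrightarrow> y"
    unfolding closure_sequential by blast
  then show "x + y \<in> closure M" unfolding closure_sequential
    by (intro exI[of _ "\<lambda>n. f n + g n"]) (auto intro: tendsto_add complex_vector.subspace_add[OF assms])
next
  fix c and x assume "x \<in> closure M"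
  then obtain f where f: "\<forall>n. f n \<in> M" "f \<longlonglongrightarrow> x" unfolding closure_sequential by blast
  have "bounded_linear (\<lambda>v :: 'a. c *\<^sub>C v)"
    by (rule bounded_linear_intro[where K = "cmod c"]) (simp_all add: scaleC_add_right scaleC_scaleR)
  from bounded_linear.tendsto[OF this f(2)] f(1)
  show "c *\<^sub>C x \<in> closure M" unfolding closure_sequential
    by (intro exI[of _ "\<lambda>n. c *\<^sub>C f n"]) (auto intro: complex_vector.subspace_scale[OF assms])
qed

lemma cspan_compose_closed:
  fixes G :: "('a::chilbert_space \<Rightarrow>\<^sub>L 'a) set"
  assumes G: "G \<subseteq> bounded_operators" "\<And>S T. S \<in> G \<Longrightarrow> T \<in> G \<Longrightarrow> S o\<^sub>L T \<in> G"
    and S: "S \<in> cspan G" and T: "T \<in> cspan G"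
  shows "S o\<^sub>L T \<in> cspan G"
proof -
  have 1: "S o\<^sub>L T \<in> cspan G" if "S \<in> G" for S
    using T
  proof (induction T rule: complex_vector.span_induct_alt)
    case base
    show ?case by (simp add: complex_vector.span_zero)
  next
    case (step c R T)
    have "S o\<^sub>L (c *\<^sub>C R + T) = c *\<^sub>C (S o\<^sub>L R) + (S o\<^sub>L T)"
      using that G(1) by (auto simp: compose_add_right compose_scaleC_right)
    with step that G(2) show ?case
      by (simp add: complex_vector.span_add complex_vector.span_scale complex_vector.span_base)
  qed
  show ?thesis
    using S
  proof (induction S rule: complex_vector.span_induct_alt)
    case base
    show ?case by (simp add: complex_vector.span_zero)
  next
    case (step c R S)
    with 1 show ?case
      by (auto simp: compose_add_left intro!: complex_vector.span_add complex_vector.span_scale)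
  qed
qed

text \<open>Products of the generating tensors are generating tensors again, so their span is an
  algebra. Its closure is a closed subalgebra, and the hull is the least one that contains the
  generators.\<close>

lemma spatial_tensor_subset_closure_span:
  assumes A: "A \<subseteq> bounded_operators" "\<And>S T. S \<in> A \<Longrightarrow> T \<in> A \<Longrightarrow> S o\<^sub>L T \<in> A"
    and B: "B \<subseteq> bounded_operators" "\<And>S T. S \<in> B \<Longrightarrow> T \<in> B \<Longrightarrow> S o\<^sub>L T \<in> B"
  shows "spatial_tensor A B \<subseteq> closure (cspan {S \<otimes>\<^sub>o T | S T. S \<in> A \<and> T \<in> B})"
proof -
  let ?G = "{S \<otimes>\<^sub>o T | S T. S \<in> A \<and> T \<in> B}"
  have G: "?G \<subseteq> bounded_operators" using A(1) B(1) by (auto intro!: map_tensor)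
  have "cspan ?G \<subseteq> bounded_operators"
    by (rule complex_vector.span_minimal[OF G csubspace_bounded_operators])
  then have cl: "closure (cspan ?G) \<subseteq> bounded_operators"
    using closed_subalgebra_bounded_operators by (intro closure_minimal) (auto simp: closed_subalgebra_def)
  have GG: "S o\<^sub>L T \<in> ?G" if ST: "S \<in> ?G" "T \<in> ?G" for S T
  proof -
    from ST(1) obtain a b where 1: "S = a \<otimes>\<^sub>o b" "a \<in> A" "b \<in> B" by blast
    from ST(2) obtain a' b' where 2: "T = a' \<otimes>\<^sub>o b'" "a' \<in> A" "b' \<in> B" by blast
    have "S o\<^sub>L T = (a o\<^sub>L a') \<otimes>\<^sub>o (b o\<^sub>L b')"
      unfolding 1 2 using 1 2 A(1) B(1) by (intro map_tensor_compose) auto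
    with 1 2 A(2) B(2) show ?thesis by blast
  qed
  have "S o\<^sub>L T \<in> closure (cspan ?G)" if "S \<in> closure (cspan ?G)" "T \<in> closure (cspan ?G)" for S T
  proof -
    from that obtain f g where fg: "\<forall>n. f n \<in> cspan ?G" "f \<longlonglongrightarrow> S" "\<forall>n. g n \<in> cspan ?G" "g \<longlonglongrightarrow> T"
      unfolding closure_sequential by blast
    have "f n o\<^sub>L g n \<in> cspan ?G" for n
      using fg by (intro cspan_compose_closed[OF G GG]) blast+
    then show ?thesis unfolding closure_sequential
      using tendsto_compose_blinfun[OF fg(2,4)] by (intro exI[of _ "\<lambda>n. f n o\<^sub>L g n"]) auto
  qed
  then have "closed_subalgebra (closure (cspan ?G))"
    using cl by (auto simp: closed_subalgebra_def intro!: csubspace_closure complex_vector.subspace_span)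
  moreover have "?G \<subseteq> closure (cspan ?G)"
    using complex_vector.span_superset closure_subset by (rule order_trans)
  ultimately show ?thesis unfolding spatial_tensor_def by (intro hull_minimal)
qed

text \<open>Compressing a generator \<open>a \<otimes> k\<close> gives the multiple
  \<open>cinner x (k x)\<close> of \<open>a \<otimes> e\<close>, with \<open>e\<close> the rank one
  projection, and linear combinations keep this form. The isometry
  \<open>a \<mapsto> a \<otimes> e\<close> and the closedness of \<open>A\<close> preserve it in the
  limit. The compressing operator itself need not lie in the tensor product.\<close>

lemma spatial_tensor_corner:
  fixes A :: "('a::chilbert_space \<Rightarrow>\<^sub>L 'a) set" and T :: "('a, 'k::chilbert_space) htensor \<Rightarrow>\<^sub>L ('a, 'k) htensor"
  assumes A: "closed_subalgebra A" and x: "norm x = 1"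
    and T: "T \<in> spatial_tensor A compact_operators"
  shows "\<exists>a\<in>A. (id_blinfun \<otimes>\<^sub>o rank_one x x) o\<^sub>L (T o\<^sub>L (id_blinfun \<otimes>\<^sub>o rank_one x x)) = a \<otimes>\<^sub>o rank_one x x"
proof -
  let ?e = "rank_one x x" and ?E = "id_blinfun \<otimes>\<^sub>o rank_one x x :: ('a, 'k) htensor \<Rightarrow>\<^sub>L _"
  let ?G = "{a \<otimes>\<^sub>o k | a k. a \<in> A \<and> k \<in> (compact_operators :: ('k \<Rightarrow>\<^sub>L 'k) set)}"
  let ?P = "\<lambda>T. \<exists>a\<in>A. ?E o\<^sub>L (T o\<^sub>L ?E) = a \<otimes>\<^sub>o ?e"
  have AB: "A \<subseteq> bounded_operators" "csubspace A" "closed A" "\<And>S T. S \<in> A \<Longrightarrow> T \<in> A \<Longrightarrow> S o\<^sub>L T \<in> A"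
    using A by (auto simp: closed_subalgebra_def)
  have KB: "(compact_operators :: ('k \<Rightarrow>\<^sub>L 'k) set) \<subseteq> bounded_operators"
    by (auto simp: compact_operators_def)
  have EB: "?E \<in> bounded_operators" by (intro map_tensor) auto
  have span: "?P T" if "T \<in> cspan ?G" for T
    using that
  proof (induction T rule: complex_vector.span_induct_alt)
    case base
    show ?case using complex_vector.subspace_0[OF AB(2)] by (intro bexI[of _ 0]) simp_all
  next
    case (step c R T)
    from step(1) obtain a k where R: "R = a \<otimes>\<^sub>o k" "a \<in> A" "k \<in> compact_operators" by blast
    then have b: "a \<in> bounded_operators" "k \<in> bounded_operators" using AB KB by auto
    from step(2) obtain t where t: "t \<in> A" "?E o\<^sub>L (T o\<^sub>L ?E) = t \<otimes>\<^sub>o ?e" by blast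
    define d where "d = c * cinner x (k x)"
    have "?E o\<^sub>L (R o\<^sub>L ?E) = a \<otimes>\<^sub>o (?e o\<^sub>L (k o\<^sub>L ?e))"
      using b by (simp add: R map_tensor_compose)
    also have "\<dots> = cinner x (k x) *\<^sub>C (a \<otimes>\<^sub>o ?e)"
      using b by (simp add: rank_one_compose map_tensor_scaleC_right)
    finally have "?E o\<^sub>L (R o\<^sub>L ?E) = cinner x (k x) *\<^sub>C (a \<otimes>\<^sub>o ?e)" .
    then have "?E o\<^sub>L ((c *\<^sub>C R + T) o\<^sub>L ?E) = d *\<^sub>C (a \<otimes>\<^sub>o ?e) + t \<otimes>\<^sub>o ?e"
      by (simp add: compose_add_left compose_add_right compose_scaleC_right[OF EB] t d_def)
    also have "\<dots> = (d *\<^sub>C a + t) \<otimes>\<^sub>o ?e"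
      using b t(1) AB(1) by (simp add: map_tensor_add_left map_tensor_scaleC_left subset_iff)
    finally show ?case
      using R t(1) by (intro bexI[of _ "d *\<^sub>C a + t"])
        (auto intro: complex_vector.subspace_add[OF AB(2)] complex_vector.subspace_scale[OF AB(2)])
  qed
  have "T \<in> closure (cspan ?G)"
    using spatial_tensor_subset_closure_span[OF AB(1,4) KB compact_operators_compose] T by blast
  then obtain f where f: "\<And>n. f n \<in> cspan ?G" "f \<longlonglongrightarrow> T" unfolding closure_sequential by blast
  obtain a where a: "\<And>n. a n \<in> A" "\<And>n. ?E o\<^sub>L (f n o\<^sub>L ?E) = a n \<otimes>\<^sub>o ?e"
    using span[OF f(1)] by metis
  have ab: "a n \<in> bounded_operators" for n using a(1) AB(1) by blast
  have lim: "(\<lambda>n. a n \<otimes>\<^sub>o ?e) \<longlonglongrightarrow> (?E o\<^sub>L (T o\<^sub>L ?E))"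
    unfolding a(2)[symmetric] by (intro tendsto_compose_blinfun tendsto_const f)
  have nd: "norm (S \<otimes>\<^sub>o ?e - S' \<otimes>\<^sub>o ?e) = norm (S - S')"
    if "S \<in> bounded_operators" "S' \<in> bounded_operators" for S S' :: "'a \<Rightarrow>\<^sub>L 'a"
    using norm_map_tensor_rank_one[of "S - S'" x] that x by (simp add: map_tensor_diff_left)
  have "Cauchy a"
    using LIMSEQ_imp_Cauchy[OF lim] unfolding Cauchy_def dist_norm nd[OF ab ab] .
  then obtain a0 where a0: "a \<longlonglongrightarrow> a0" by (auto simp: Cauchy_convergent_iff convergent_def)
  have a0A: "a0 \<in> A" using closed_sequentially[OF AB(3) _ a0] a(1) by blast
  have "(\<lambda>n. a n \<otimes>\<^sub>o ?e) \<longlonglongrightarrow> (a0 \<otimes>\<^sub>o ?e)"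
    using a0 a0A AB(1) unfolding LIMSEQ_def dist_norm by (auto simp: nd[OF ab])
  from LIMSEQ_unique[OF lim this] a0A show ?thesis by blast
qed

section \<open>Algebras with \<open>c\<^sub>0\<close>-isomorphic diagonal\<close>

text \<open>For complex-linear operators the norm bound and idempotence imply selfadjointness
  (\<open>contractive_idempotent_selfadjoint\<close>). Unlike an adjoint relation, both are visibly
  preserved by isometric isomorphisms.\<close>

definition projection_in :: "('a::chilbert_space \<Rightarrow>\<^sub>L 'a) set \<Rightarrow> ('a \<Rightarrow>\<^sub>L 'a) \<Rightarrow> bool"
  where "projection_in C P \<longleftrightarrow> P \<in> C \<and> norm P \<le> 1 \<and> P o\<^sub>L P = P"

definition minimal_projection_in :: "('a::chilbert_space \<Rightarrow>\<^sub>L 'a) set \<Rightarrow> ('a \<Rightarrow>\<^sub>L 'a) \<Rightarrow> bool"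
  where "minimal_projection_in C P \<longleftrightarrow> projection_in C P \<and> P \<noteq> 0 \<and>
    (\<forall>Q. projection_in C Q \<and> P o\<^sub>L Q = Q \<and> Q o\<^sub>L P = Q \<longrightarrow> Q = 0 \<or> Q = P)"

text \<open>Murray-von Neumann equivalence, with a partial isometry and its adjoint given as a
  contractive pair. Both are required in \<open>C\<close>, which need not be closed under
  adjoints.\<close>

definition mvn_equiv :: "('a::chilbert_space \<Rightarrow>\<^sub>L 'a) set \<Rightarrow> ('a \<Rightarrow>\<^sub>L 'a) \<Rightarrow> ('a \<Rightarrow>\<^sub>L 'a) \<Rightarrow> bool"
  where "mvn_equiv C P Q \<longleftrightarrow> (\<exists>V\<in>C. \<exists>W\<in>C. contractive_pair V W \<and> V o\<^sub>L W = P \<and> W o\<^sub>L V = Q)"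

lemma mvn_equiv_sym: "mvn_equiv C P Q \<Longrightarrow> mvn_equiv C Q P"
  unfolding mvn_equiv_def using contractive_pair_sym by blast

text \<open>The composite is \<open>V V'\<close> with partner \<open>W' W\<close>. The middle
  projection \<open>Q = W V = V' W'\<close> is absorbed on either side:
  \<open>V V' W' = V W V = V\<close> and \<open>W' W V = W' V' W' = W'\<close>.\<close>

lemma mvn_equiv_trans:
  assumes C: "closed_subalgebra C" and PQ: "mvn_equiv C P Q" and QR: "mvn_equiv C Q R"
  shows "mvn_equiv C P R"
proof -
  obtain V W where V: "V \<in> C" "W \<in> C" "contractive_pair V W" "V o\<^sub>L W = P" "W o\<^sub>L V = Q"
    using PQ unfolding mvn_equiv_def by blast
  obtain V' W' where V': "V' \<in> C" "W' \<in> C" "contractive_pair V' W'" "V' o\<^sub>L W' = Q" "W' o\<^sub>L V' = R"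
    using QR unfolding mvn_equiv_def by blast
  have app: "V (W (V x)) = V x" "W (V (W x)) = W x" "V' (W' (V' y)) = V' y" "W' (V' (W' y)) = W' y"
    "W (V z) = V' (W' z)" for x y z
    using V(3,5) V'(3,4) unfolding contractive_pair_def by (metis blinfun_apply_blinfun_compose)+
  have VV: "V (V' (W' z)) = V z" "W' (W (V z)) = W' z" for z
    by (metis app)+
  show ?thesis unfolding mvn_equiv_def
  proof (rule bexI[of _ "V o\<^sub>L V'"], rule bexI[of _ "W' o\<^sub>L W"], intro conjI)
    show "contractive_pair (V o\<^sub>L V') (W' o\<^sub>L W)"
      using V(3) V'(3) unfolding contractive_pair_def
      by (auto intro!: norm_compose_le_1 blinfun_eqI simp: VV app)
    show "V o\<^sub>L V' o\<^sub>L (W' o\<^sub>L W) = P" "W' o\<^sub>L W o\<^sub>L (V o\<^sub>L V') = R"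
      unfolding V(4)[symmetric] V'(5)[symmetric] by (auto intro!: blinfun_eqI simp: VV app)
  qed (use C V V' in \<open>auto simp: closed_subalgebra_def\<close>)
qed

lemma c0_dominated:
  assumes f: "f \<in> c0 \<Gamma>" and g: "\<And>x. cmod (g x) \<le> K * cmod (f x)"
  shows "g \<in> c0 \<Gamma>"
  unfolding c0_def
proof (intro CollectI conjI allI impI)
  fix x assume "x \<notin> \<Gamma>"
  then have "f x = 0" using f by (simp add: c0_def)
  then show "g x = 0" using g[of x] by simp
next
  fix e :: real assume "e > 0"
  \<comment> \<open>The constant \<open>\<bar>K\<bar> + 1\<close> is positive for every
    \<open>K\<close>, so the threshold can be divided by it.\<close>
  have K: "cmod (g x) \<le> (\<bar>K\<bar> + 1) * cmod (f x)" for x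
    by (rule order_trans[OF g]) (intro mult_right_mono; auto)
  have K0: "\<bar>K\<bar> + 1 > 0" by linarith
  have "{x \<in> \<Gamma>. e \<le> cmod (g x)} \<subseteq> {x \<in> \<Gamma>. e / (\<bar>K\<bar> + 1) \<le> cmod (f x)}"
  proof (intro subsetI CollectI conjI)
    fix x assume "x \<in> {x \<in> \<Gamma>. e \<le> cmod (g x)}"
    then show "x \<in> \<Gamma>" "e / (\<bar>K\<bar> + 1) \<le> cmod (f x)"
      using K[of x] K0 by (simp_all add: pos_divide_le_eq mult.commute)
  qed
  moreover have "finite {x \<in> \<Gamma>. e / (\<bar>K\<bar> + 1) \<le> cmod (f x)}"
    using f \<open>e > 0\<close> K0 by (simp add: c0_def)
  ultimately show "finite {x \<in> \<Gamma>. e \<le> cmod (g x)}" by (rule finite_subset)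
qed

lemma c0_finite_support:
  assumes "finite F" "F \<subseteq> \<Gamma>" "\<And>x. x \<notin> F \<Longrightarrow> f x = 0"
  shows "f \<in> c0 \<Gamma>"
  unfolding c0_def
proof (intro CollectI conjI allI impI)
  fix e :: real assume "e > 0"
  then have "{x \<in> \<Gamma>. e \<le> cmod (f x)} \<subseteq> F" using assms(3) by fastforce
  then show "finite {x \<in> \<Gamma>. e \<le> cmod (f x)}" using assms(1) by (rule finite_subset)
qed (use assms in blast)

abbreviation stabilization ::
    "('a::chilbert_space \<Rightarrow>\<^sub>L 'a) set \<Rightarrow> (('a, 'k::chilbert_space) htensor \<Rightarrow>\<^sub>L ('a, 'k) htensor) set"
  where "stabilization A \<equiv> spatial_tensor A compact_operators"

locale c0_diagonal =
  fixes A :: "('a::chilbert_space \<Rightarrow>\<^sub>L 'a) set" and \<Gamma> :: "'g set" and \<pi> :: "('a \<Rightarrow>\<^sub>L 'a) \<Rightarrow> 'g \<Rightarrow> complex"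
  assumes operator_algebra: "operator_algebra A"
    and bij: "bij_betw \<pi> (diag A) (c0 \<Gamma>)"
    and add: "\<And>S T. S \<in> diag A \<Longrightarrow> T \<in> diag A \<Longrightarrow> \<pi> (S + T) = (\<lambda>x. \<pi> S x + \<pi> T x)"
    and scale: "\<And>c T. T \<in> diag A \<Longrightarrow> \<pi> (c *\<^sub>C T) = (\<lambda>x. c * \<pi> T x)"
    and mult: "\<And>S T. S \<in> diag A \<Longrightarrow> T \<in> diag A \<Longrightarrow> \<pi> (S o\<^sub>L T) = (\<lambda>x. \<pi> S x * \<pi> T x)"
    and star: "\<And>S T. S \<in> diag A \<Longrightarrow> T \<in> diag A \<Longrightarrow> is_adjoint S T \<Longrightarrow> \<pi> S = (\<lambda>x. cnj (\<pi> T x))"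
begin

lemma algebra: "closed_subalgebra A"
  using operator_algebra by (simp add: operator_algebra_def)

lemma subspace: "csubspace A" and closed: "closed A"
  and bounded: "a \<in> A \<Longrightarrow> a \<in> bounded_operators"
  and compose: "a \<in> A \<Longrightarrow> b \<in> A \<Longrightarrow> a o\<^sub>L b \<in> A"
  using algebra by (auto simp: closed_subalgebra_def)

lemma diag_iff: "S \<in> diag A \<longleftrightarrow> S \<in> A \<and> (\<exists>T\<in>A. is_adjoint S T)"
  by (simp add: diag_def)

lemma diag_subset: "S \<in> diag A \<Longrightarrow> S \<in> A"
  by (simp add: diag_iff)

lemma diag_adjoint: "S \<in> A \<Longrightarrow> T \<in> A \<Longrightarrow> is_adjoint S T \<Longrightarrow> S \<in> diag A \<and> T \<in> diag A"
  using is_adjoint_sym by (auto simp: diag_iff)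

lemma diag_add: "S \<in> diag A \<Longrightarrow> T \<in> diag A \<Longrightarrow> S + T \<in> diag A"
  unfolding diag_iff using complex_vector.subspace_add[OF subspace] is_adjoint_add by blast

lemma diag_scale: "T \<in> diag A \<Longrightarrow> c *\<^sub>C T \<in> diag A"
  unfolding diag_iff using complex_vector.subspace_scale[OF subspace] is_adjoint_scaleC by blast

lemma diag_compose: "S \<in> diag A \<Longrightarrow> T \<in> diag A \<Longrightarrow> S o\<^sub>L T \<in> diag A"
  unfolding diag_iff using compose is_adjoint_compose by blast

lemma diag_zero: "0 \<in> diag A"
  unfolding diag_iff using complex_vector.subspace_0[OF subspace] is_adjoint_zero by blast

lemma diag_diff: "S \<in> diag A \<Longrightarrow> T \<in> diag A \<Longrightarrow> S - T \<in> diag A"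
  using diag_add[of S "(- 1) *\<^sub>C T"] diag_scale[of T "- 1"] by (simp add: scaleC_minus_one)

lemmas diag_closed = diag_add diag_scale diag_compose diag_zero diag_diff

text \<open>The diagonal operator with symbol \<open>f\<close>, that is, the inverse Gelfand
  transform. The value has a meaning only for \<open>f\<close> in
  \<open>c0 \<Gamma>\<close>.\<close>

definition inv_rep :: "('g \<Rightarrow> complex) \<Rightarrow> ('a \<Rightarrow>\<^sub>L 'a)"
  where "inv_rep = inv_into (diag A) \<pi>"

lemma inv_rep:
  assumes "f \<in> c0 \<Gamma>"
  shows "inv_rep f \<in> diag A" "\<pi> (inv_rep f) = f"
  using bij assms unfolding inv_rep_def bij_betw_def by (auto intro: inv_into_into f_inv_into_f)

lemma rep_in_c0: "S \<in> diag A \<Longrightarrow> \<pi> S \<in> c0 \<Gamma>"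
  using bij by (auto simp: bij_betw_def)

lemma rep_inject: "S \<in> diag A \<Longrightarrow> T \<in> diag A \<Longrightarrow> \<pi> S = \<pi> T \<Longrightarrow> S = T"
  using bij by (auto simp: bij_betw_def inj_on_def)

lemma rep_0: "\<pi> 0 = (\<lambda>x. 0)"
  using scale[OF diag_zero, of 0] by simp

text \<open>The definition of \<open>diag\<close> supplies an adjoint \<open>T\<close> inside the
  diagonal, \<open>star\<close> shows that its symbol is the conjugate of \<open>f\<close>, and the
  symbol determines the operator.\<close>

lemma is_adjoint_inv_rep:
  assumes f: "f \<in> c0 \<Gamma>" and g: "\<And>x. g x = cnj (f x)"
  shows "is_adjoint (inv_rep f) (inv_rep g)"
proof -
  have gc: "g \<in> c0 \<Gamma>" using f by (rule c0_dominated[where K = 1]) (simp add: g)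
  obtain T where T: "T \<in> diag A" "is_adjoint (inv_rep f) T"
    using inv_rep(1)[OF f] diag_adjoint unfolding diag_iff by blast
  have "\<pi> T = g"
    using star[OF inv_rep(1)[OF f] T] inv_rep(2)[OF f] by (auto simp: fun_eq_iff g)
  then have "T = inv_rep g" using rep_inject[OF T(1)] inv_rep[OF gc] by simp
  with T(2) show ?thesis by simp
qed

text \<open>If \<open>\<bar>f\<bar> \<le> 1\<close>, then \<open>h = 1 - \<surd>(1 - \<bar>f\<bar>\<^sup>2)\<close> lies in \<open>c\<^sub>0\<close> and satisfies \<open>\<bar>f\<bar>\<^sup>2 = 2h - h\<^sup>2\<close>, so that
  the operators \<open>D\<close>, \<open>H\<close> with symbols \<open>f\<close>, \<open>h\<close> satisfy \<open>\<parallel>D x\<parallel>\<^sup>2 + \<parallel>x - H x\<parallel>\<^sup>2 = \<parallel>x\<parallel>\<^sup>2\<close>.\<close>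

lemma norm_inv_rep_le_1:
  assumes f: "f \<in> c0 \<Gamma>" and f1: "\<And>x. cmod (f x) \<le> 1"
  shows "norm (inv_rep f) \<le> 1"
proof -
  define h where "h x = complex_of_real (1 - sqrt (1 - (cmod (f x))\<^sup>2))" for x
  define k where "k x = cnj (f x)" for x
  \<comment> \<open>Together these bounds put \<open>h\<close> into \<open>c0 \<Gamma>\<close>. The
    second one comes from \<open>(1 - t)^2 \<le> 1 - t^2\<close> on the unit interval.\<close>
  have h01: "0 \<le> 1 - sqrt (1 - (cmod (f x))\<^sup>2)" "1 - sqrt (1 - (cmod (f x))\<^sup>2) \<le> cmod (f x)" for x
  proof -
    let ?t = "cmod (f x)"
    have t: "0 \<le> ?t" "?t \<le> 1" using f1 by auto
    show "0 \<le> 1 - sqrt (1 - ?t\<^sup>2)" by simp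
    have "?t * ?t \<le> ?t" using mult_left_mono[OF t(2) t(1)] by simp
    then have "(1 - ?t)\<^sup>2 \<le> 1 - ?t\<^sup>2"
      by (simp add: power2_eq_square algebra_simps)
    then have "1 - ?t \<le> sqrt (1 - ?t\<^sup>2)" by (rule real_le_rsqrt)
    then show "1 - sqrt (1 - ?t\<^sup>2) \<le> ?t" by linarith
  qed
  have h: "h \<in> c0 \<Gamma>"
    using f by (rule c0_dominated[where K = 1]) (use h01 in \<open>simp add: h_def norm_of_real del: of_real_diff\<close>)
  have k: "k \<in> c0 \<Gamma>" using f by (rule c0_dominated[where K = 1]) (simp add: k_def)
  define D where "D = inv_rep f"
  define D' where "D' = inv_rep k"
  define H where "H = inv_rep h"
  have d: "D \<in> diag A" "D' \<in> diag A" "H \<in> diag A" "\<pi> D = f" "\<pi> D' = k" "\<pi> H = h"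
    by (simp_all add: D_def D'_def H_def inv_rep f h k)
  have adj: "is_adjoint D D'" "is_adjoint H H"
    unfolding D_def D'_def H_def by (intro is_adjoint_inv_rep f h; simp add: k_def h_def)+
  have kf: "k x * f x + h x * h x = h x + h x" for x
  proof -
    have "sqrt (1 - (cmod (f x))\<^sup>2) * sqrt (1 - (cmod (f x))\<^sup>2) = 1 - (cmod (f x))\<^sup>2"
      using f1[of x] by (simp add: power_le_one)
    then have "(cmod (f x))\<^sup>2 + (1 - sqrt (1 - (cmod (f x))\<^sup>2)) * (1 - sqrt (1 - (cmod (f x))\<^sup>2))
      = 2 * (1 - sqrt (1 - (cmod (f x))\<^sup>2))" by (simp add: algebra_simps)
    then have "complex_of_real ((cmod (f x))\<^sup>2 + (1 - sqrt (1 - (cmod (f x))\<^sup>2)) * (1 - sqrt (1 - (cmod (f x))\<^sup>2)))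
      = complex_of_real (2 * (1 - sqrt (1 - (cmod (f x))\<^sup>2)))" by simp
    moreover have "k x * f x = complex_of_real ((cmod (f x))\<^sup>2)"
      unfolding k_def complex_norm_square by (rule mult.commute)
    ultimately show ?thesis by (simp only: h_def of_real_add of_real_mult) simp
  qed
  have "(D' o\<^sub>L D) + (H o\<^sub>L H) = H + H"
    by (rule rep_inject) (simp_all add: d diag_closed add mult kf)
  then have eq: "D' (D x) + H (H x) = H x + H x" for x
    by (metis blinfun.add_left blinfun_apply_blinfun_compose)
  have "norm (D x) \<le> 1 * norm x" for x
  proof -
    have "(norm (D x))\<^sup>2 + (norm (H x))\<^sup>2 = Re (cinner x (D' (D x) + H (H x)))"
      by (simp add: is_adjoint_norm_sq[OF adj(1)] is_adjoint_norm_sq[OF adj(2)] cinner_add_right)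
    also have "\<dots> = 2 * Re (cinner x (H x))" by (simp add: eq cinner_add_right)
    also have "\<dots> = (norm x)\<^sup>2 + (norm (H x))\<^sup>2 - (norm (x - H x))\<^sup>2"
      using norm_add_sq_cinner[of x "- H x"] by simp
    finally have "(norm (D x))\<^sup>2 + (norm (x - H x))\<^sup>2 = (norm x)\<^sup>2" by simp
    then have "(norm (D x))\<^sup>2 \<le> (norm x)\<^sup>2"
      using zero_le_power2[of "norm (x - H x)"] by linarith
    then have "norm (D x) \<le> norm x" by (rule power2_le_imp_le) simp
    then show ?thesis by simp
  qed
  then show ?thesis unfolding D_def by (intro norm_blinfun_bound) auto
qed

text \<open>The symbol map is assumed to be an algebraic star isomorphism only, so this bound has to
  be derived. Division by \<open>e\<close> reduces it to symbols bounded by one.\<close>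

lemma norm_diag_le:
  assumes S: "S \<in> diag A" and e: "e > 0" "\<And>x. cmod (\<pi> S x) \<le> e"
  shows "norm S \<le> e"
proof -
  define f where "f x = complex_of_real (1 / e) * \<pi> S x" for x
  have f: "f \<in> c0 \<Gamma>"
    using rep_in_c0[OF S] by (rule c0_dominated[where K = "1 / e"]) (use e in \<open>simp add: f_def norm_mult norm_divide\<close>)
  have "norm (inv_rep f) \<le> 1"
    using e by (intro norm_inv_rep_le_1 f) (simp add: f_def norm_mult norm_divide)
  moreover have "S = complex_of_real e *\<^sub>C inv_rep f"
    by (rule rep_inject) (use e in \<open>simp_all add: S f diag_closed inv_rep scale f_def\<close>)
  ultimately show ?thesis
    using e mult_left_mono[of "norm (inv_rep f)" 1 e] by simp
qed

section \<open>Minimal projections of the diagonal and approximation by their finite sums\<close>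

definition P :: "'g \<Rightarrow> ('a \<Rightarrow>\<^sub>L 'a)"
  where "P \<gamma> = inv_rep (\<lambda>x. if x = \<gamma> then 1 else 0)"

lemma P_diag: "\<gamma> \<in> \<Gamma> \<Longrightarrow> P \<gamma> \<in> diag A"
  and rep_P: "\<gamma> \<in> \<Gamma> \<Longrightarrow> \<pi> (P \<gamma>) = (\<lambda>x. if x = \<gamma> then 1 else 0)"
  unfolding P_def by (intro inv_rep c0_finite_support[of "{\<gamma>}"]; auto)+

lemma P_in: "\<gamma> \<in> \<Gamma> \<Longrightarrow> P \<gamma> \<in> A"
  using P_diag diag_subset by blast

lemma P_bounded: "\<gamma> \<in> \<Gamma> \<Longrightarrow> P \<gamma> \<in> bounded_operators"
  using P_in bounded by blast

lemma P_selfadjoint: "\<gamma> \<in> \<Gamma> \<Longrightarrow> is_adjoint (P \<gamma>) (P \<gamma>)"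
  unfolding P_def by (intro is_adjoint_inv_rep c0_finite_support[of "{\<gamma>}"]; auto)

lemma P_compose: "\<gamma> \<in> \<Gamma> \<Longrightarrow> \<gamma>' \<in> \<Gamma> \<Longrightarrow> P \<gamma> o\<^sub>L P \<gamma>' = (if \<gamma> = \<gamma>' then P \<gamma> else 0)"
  by (intro rep_inject) (auto simp: diag_closed P_diag mult rep_P rep_0)

lemma P_nonzero: "\<gamma> \<in> \<Gamma> \<Longrightarrow> P \<gamma> \<noteq> 0"
  using fun_cong[OF rep_P, of \<gamma> \<gamma>] by (auto simp: rep_0)

lemma norm_P: "\<gamma> \<in> \<Gamma> \<Longrightarrow> norm (P \<gamma>) \<le> 1"
  by (rule norm_selfadjoint_idempotent_le_1) (simp_all add: P_selfadjoint P_compose)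

text \<open>Multiplication by \<open>P \<gamma>\<close> kills every value of the symbol except the
  one at \<open>\<gamma>\<close>, and that value is the scalar.\<close>

lemma diag_corner_scalar:
  assumes b: "b \<in> diag A" and g: "\<gamma> \<in> \<Gamma>" and bP: "b o\<^sub>L P \<gamma> = b"
  shows "\<exists>c. b = c *\<^sub>C P \<gamma>"
proof (intro exI rep_inject)
  show "b \<in> diag A" "\<pi> b \<gamma> *\<^sub>C P \<gamma> \<in> diag A" using b P_diag[OF g] diag_closed by auto
  have "\<pi> b = (\<lambda>x. \<pi> b x * \<pi> (P \<gamma>) x)" using mult[OF b P_diag[OF g]] bP by simp
  then show "\<pi> b = \<pi> (\<pi> b \<gamma> *\<^sub>C P \<gamma>)"
    by (auto simp: scale P_diag g rep_P fun_eq_iff split: if_splits)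
qed

text \<open>The relation on the right makes \<open>b\<close> a multiple of
  \<open>P \<gamma>'\<close>, which \<open>P \<gamma>\<close> annihilates. This will separate the
  equivalence classes of different minimal projections.\<close>

lemma diag_corner_zero:
  assumes b: "b \<in> diag A" and g: "\<gamma> \<in> \<Gamma>" "\<gamma>' \<in> \<Gamma>" "\<gamma> \<noteq> \<gamma>'"
    and Pb: "P \<gamma> o\<^sub>L b = b" and bP: "b o\<^sub>L P \<gamma>' = b"
  shows "b = 0"
proof -
  obtain c where c: "b = c *\<^sub>C P \<gamma>'" using diag_corner_scalar[OF b g(2) bP] by blast
  have "b = P \<gamma> o\<^sub>L (c *\<^sub>C P \<gamma>')" by (simp only: Pb c[symmetric])
  also have "\<dots> = 0" using g by (simp add: compose_scaleC_right P_bounded P_compose)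
  finally show ?thesis .
qed

definition PF :: "'g set \<Rightarrow> ('a \<Rightarrow>\<^sub>L 'a)"
  where "PF F = (\<Sum>\<gamma>\<in>F. P \<gamma>)"

lemma PF_diag: "finite F \<Longrightarrow> F \<subseteq> \<Gamma> \<Longrightarrow> PF F \<in> diag A \<and> \<pi> (PF F) = (\<lambda>x. if x \<in> F then 1 else 0)"
proof (induction F rule: finite_induct)
  case empty
  show ?case by (simp add: PF_def rep_0 diag_zero)
next
  case (insert x F)
  then show ?case
    by (auto simp: PF_def add P_diag rep_P diag_closed fun_eq_iff)
qed

lemma PF_in: "finite F \<Longrightarrow> F \<subseteq> \<Gamma> \<Longrightarrow> PF F \<in> A"
  using PF_diag diag_subset by blast

lemma PF_bounded: "finite F \<Longrightarrow> F \<subseteq> \<Gamma> \<Longrightarrow> PF F \<in> bounded_operators"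
  using PF_in bounded by blast

lemma PF_selfadjoint: "F \<subseteq> \<Gamma> \<Longrightarrow> is_adjoint (PF F) (PF F)"
  unfolding PF_def by (intro is_adjoint_sum P_selfadjoint) auto

lemma PF_compose:
  assumes "finite F" "F \<subseteq> \<Gamma>" "finite G" "G \<subseteq> \<Gamma>"
  shows "PF F o\<^sub>L PF G = PF (F \<inter> G)"
  using assms PF_diag[of F] PF_diag[of G] PF_diag[of "F \<inter> G"] le_infI1[of F \<Gamma> G]
  by (intro rep_inject) (auto simp: diag_closed mult fun_eq_iff)

lemma norm_PF: "finite F \<Longrightarrow> F \<subseteq> \<Gamma> \<Longrightarrow> norm (PF F) \<le> 1"
  by (rule norm_selfadjoint_idempotent_le_1) (simp_all add: PF_selfadjoint PF_compose)

text \<open>A function in \<open>c0 \<Gamma>\<close> reaches a positive threshold only on a finite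
  set, and removing its values there leaves a symbol of size at most \<open>e\<close>. The diagonal
  is commutative, so one finite set serves both sides.\<close>

lemma PF_approximates_diag:
  assumes E: "E \<in> diag A" and e: "e > 0"
  shows "\<exists>F. finite F \<and> F \<subseteq> \<Gamma> \<and> norm (E - (PF F o\<^sub>L E)) \<le> e \<and> norm (E - (E o\<^sub>L PF F)) \<le> e"
proof (intro exI conjI)
  let ?F = "{x \<in> \<Gamma>. e \<le> cmod (\<pi> E x)}"
  show F: "finite ?F" using rep_in_c0[OF E] e by (simp add: c0_def)
  show "?F \<subseteq> \<Gamma>" by blast
  note PF = PF_diag[OF F \<open>?F \<subseteq> \<Gamma>\<close>]
  have comm: "E o\<^sub>L PF ?F = PF ?F o\<^sub>L E"
    by (rule rep_inject) (use PF E in \<open>simp_all add: diag_closed mult mult.commute\<close>)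
  have out: "\<pi> E x = 0" if "x \<notin> \<Gamma>" for x using rep_in_c0[OF E] that by (simp add: c0_def)
  show le: "norm (E - (PF ?F o\<^sub>L E)) \<le> e"
  proof (rule norm_diag_le[OF _ e])
    show d: "E - (PF ?F o\<^sub>L E) \<in> diag A" using PF E by (simp add: diag_closed)
    \<comment> \<open>The homomorphism rules speak of sums, so the symbol of the difference is found
      by writing \<open>E\<close> as the difference plus the part cut out by
      \<open>PF\<close>.\<close>
    have "\<pi> E = \<pi> ((E - (PF ?F o\<^sub>L E)) + (PF ?F o\<^sub>L E))" by simp
    also have "\<dots> = (\<lambda>x. \<pi> (E - (PF ?F o\<^sub>L E)) x + \<pi> (PF ?F o\<^sub>L E) x)"
      using PF E by (intro add d diag_closed) auto
    finally have "\<pi> E x = \<pi> (E - (PF ?F o\<^sub>L E)) x + \<pi> (PF ?F) x * \<pi> E x" for x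
      using PF E by (simp add: mult fun_eq_iff)
    then have "\<pi> (E - (PF ?F o\<^sub>L E)) x = \<pi> E x - \<pi> (PF ?F) x * \<pi> E x" for x
      by (simp add: eq_diff_eq)
    then show "cmod (\<pi> (E - (PF ?F o\<^sub>L E)) x) \<le> e" for x
      using PF e out[of x] by auto
  qed
  then show "norm (E - (E o\<^sub>L PF ?F)) \<le> e" by (simp only: comm)
qed

text \<open>The approximate unit provides a contraction \<open>E\<close> in the diagonal that nearly
  fixes \<open>a\<close> from both sides, and some \<open>PF F\<close> nearly fixes
  \<open>E\<close>. Hence \<open>PF F\<close> nearly fixes \<open>a\<close> from both sides.\<close>

lemma PF_approximates:
  assumes a: "a \<in> A" and e: "e > 0"
  shows "\<exists>F. finite F \<and> F \<subseteq> \<Gamma> \<and> norm (a - (PF F o\<^sub>L (a o\<^sub>L PF F))) < e"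
proof -
  \<comment> \<open>Each one-sided error will be at most \<open>d * (2 + norm a)\<close>. Twice this
    is \<open>d * (4 + 2 * norm a)\<close>, and taking 5 makes the final inequality strict.\<close>
  define d where "d = e / (5 + 2 * norm a)"
  have pos: "5 + 2 * norm a > 0" by (intro add_pos_nonneg) auto
  then have d: "d > 0" "d * (5 + 2 * norm a) = e" using e by (simp_all add: d_def)
  obtain \<F> where \<F>: "\<F> \<noteq> bot" "\<forall>\<^sub>F E in \<F>. E \<in> diag A \<and> norm E \<le> 1"
    "((\<lambda>E. E o\<^sub>L a) \<longlongrightarrow> a) \<F>" "((\<lambda>E. a o\<^sub>L E) \<longlongrightarrow> a) \<F>"
    using operator_algebra a
    unfolding operator_algebra_def has_contractive_approximate_unit_in_def by blast
  have "\<forall>\<^sub>F E in \<F>. (E \<in> diag A \<and> norm E \<le> 1) \<and> dist (E o\<^sub>L a) a < d \<and> dist (a o\<^sub>L E) a < d"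
    by (intro eventually_conj \<F> tendstoD d)
  from eventually_happens'[OF \<F>(1) this]
  obtain E where E: "E \<in> diag A" "norm E \<le> 1" "norm (a - (E o\<^sub>L a)) \<le> d" "norm (a - (a o\<^sub>L E)) \<le> d"
    by (auto simp: dist_norm norm_minus_commute)
  obtain F where F: "finite F" "F \<subseteq> \<Gamma>" "norm (E - (PF F o\<^sub>L E)) \<le> d" "norm (E - (E o\<^sub>L PF F)) \<le> d"
    using PF_approximates_diag[OF E(1) d(1)] by blast
  note P1 = norm_PF[OF F(1,2)]
  \<comment> \<open>On the right the terms \<open>E a\<close> and \<open>PF F E a\<close> cancel.
    The three groups are controlled by the choices of \<open>E\<close> and \<open>F\<close> and by
    \<open>norm (PF F) \<le> 1\<close>.\<close>
  have "a - (PF F o\<^sub>L a) = (a - (E o\<^sub>L a)) + (((E - (PF F o\<^sub>L E)) o\<^sub>L a) - (PF F o\<^sub>L (a - (E o\<^sub>L a))))"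
    by (simp add: compose_diff_left compose_diff_right compose_assoc)
  also have "norm \<dots> \<le> d + (d * norm a + 1 * d)"
    by (intro norm_triangle_le norm_triangle_le_diff add_mono norm_compose_le E F P1 order_refl)
  finally have l: "norm (a - (PF F o\<^sub>L a)) \<le> d * (2 + norm a)" by (simp add: algebra_simps)
  have "a - (a o\<^sub>L PF F) = (a - (a o\<^sub>L E)) + ((a o\<^sub>L (E - (E o\<^sub>L PF F))) - ((a - (a o\<^sub>L E)) o\<^sub>L PF F))"
    by (simp add: compose_diff_left compose_diff_right compose_assoc)
  also have "norm \<dots> \<le> d + (norm a * d + d * 1)"
    by (intro norm_triangle_le norm_triangle_le_diff add_mono norm_compose_le E F P1 order_refl)
  finally have r: "norm (a - (a o\<^sub>L PF F)) \<le> d * (2 + norm a)" by (simp add: algebra_simps)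
  have "a - (PF F o\<^sub>L (a o\<^sub>L PF F)) = (a - (PF F o\<^sub>L a)) + (PF F o\<^sub>L (a - (a o\<^sub>L PF F)))"
    by (simp add: compose_diff_right)
  also have "norm \<dots> \<le> d * (2 + norm a) + 1 * (d * (2 + norm a))"
    by (intro norm_triangle_le add_mono norm_compose_le l r P1)
  also have "\<dots> < e" using d by (simp add: algebra_simps)
  finally show ?thesis using F by blast
qed

lemma PF_compression:
  assumes "finite F" "F \<subseteq> \<Gamma>" "a \<in> A"
  shows "PF F o\<^sub>L (a o\<^sub>L PF F) \<in> A"
    "PF F o\<^sub>L (PF F o\<^sub>L (a o\<^sub>L PF F)) = PF F o\<^sub>L (a o\<^sub>L PF F)"
    "(PF F o\<^sub>L (a o\<^sub>L PF F)) o\<^sub>L PF F = PF F o\<^sub>L (a o\<^sub>L PF F)"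
proof -
  have PP: "PF F o\<^sub>L PF F = PF F" using assms by (simp add: PF_compose)
  show "PF F o\<^sub>L (a o\<^sub>L PF F) \<in> A" using assms by (intro compose PF_in)
  show "PF F o\<^sub>L (PF F o\<^sub>L (a o\<^sub>L PF F)) = PF F o\<^sub>L (a o\<^sub>L PF F)"
    by (simp only: compose_assoc[symmetric] PP)
  show "(PF F o\<^sub>L (a o\<^sub>L PF F)) o\<^sub>L PF F = PF F o\<^sub>L (a o\<^sub>L PF F)"
    by (simp only: compose_assoc PP)
qed

section \<open>Minimal projections of the stabilization and their equivalence classes\<close>

lemma stabilization_algebra: "closed_subalgebra (stabilization A)"
  by (rule closed_subalgebra_spatial_tensor) (auto simp: bounded compact_operators_def)

lemma stabilization_compose:
  "S \<in> stabilization A \<Longrightarrow> T \<in> stabilization A \<Longrightarrow> S o\<^sub>L T \<in> stabilization A"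
  using stabilization_algebra by (auto simp: closed_subalgebra_def)

lemma stabilization_scale: "T \<in> stabilization A \<Longrightarrow> c *\<^sub>C T \<in> stabilization A"
  using stabilization_algebra by (auto simp: closed_subalgebra_def intro: complex_vector.subspace_scale)

lemma stabilization_bounded: "T \<in> stabilization A \<Longrightarrow> T \<in> bounded_operators"
  using stabilization_algebra by (auto simp: closed_subalgebra_def)

lemma tensor_in_stabilization: "a \<in> A \<Longrightarrow> k \<in> compact_operators \<Longrightarrow> a \<otimes>\<^sub>o k \<in> stabilization A"
  unfolding spatial_tensor_def by (rule hull_inc) blast

text \<open>With \<open>e\<close> the rank one projection, \<open>1 \<otimes> e\<close> fixes
  \<open>p \<otimes> e\<close> and \<open>q \<otimes> e\<close>, so it fixes \<open>T\<close> from
  both sides and \<open>spatial_tensor_corner\<close> yields \<open>a\<close>. Injectivity of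
  \<open>a \<mapsto> a \<otimes> e\<close> then transfers the relations with \<open>p\<close> and
  \<open>q\<close> to \<open>a\<close>.\<close>

lemma stabilization_corner:
  assumes T: "T \<in> stabilization A" and x: "norm x = 1"
    and p: "p \<in> bounded_operators" "q \<in> bounded_operators"
    and pT: "(p \<otimes>\<^sub>o rank_one x x) o\<^sub>L T = T" and Tq: "T o\<^sub>L (q \<otimes>\<^sub>o rank_one x x) = T"
  obtains a where "a \<in> A" "T = a \<otimes>\<^sub>o rank_one x x" "p o\<^sub>L a = a" "a o\<^sub>L q = a"
proof -
  let ?e = "rank_one x x"
  have ee: "?e o\<^sub>L ?e = ?e" using x by (rule rank_one_unit_compose)
  have "(id_blinfun \<otimes>\<^sub>o ?e) o\<^sub>L T = ((id_blinfun \<otimes>\<^sub>o ?e) o\<^sub>L (p \<otimes>\<^sub>o ?e)) o\<^sub>L T"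
    by (simp only: compose_assoc pT)
  also have "\<dots> = T" using p by (simp add: map_tensor_compose ee pT)
  finally have 1: "(id_blinfun \<otimes>\<^sub>o ?e) o\<^sub>L T = T" .
  have "T o\<^sub>L (id_blinfun \<otimes>\<^sub>o ?e) = T o\<^sub>L ((q \<otimes>\<^sub>o ?e) o\<^sub>L (id_blinfun \<otimes>\<^sub>o ?e))"
    by (simp only: compose_assoc[symmetric] Tq)
  also have "\<dots> = T" using p by (simp add: map_tensor_compose ee Tq)
  finally have 2: "T o\<^sub>L (id_blinfun \<otimes>\<^sub>o ?e) = T" .
  obtain a where a: "a \<in> A" "T = a \<otimes>\<^sub>o ?e"
    using spatial_tensor_corner[OF algebra x T] by (auto simp: 1 2)
  have "(p o\<^sub>L a) \<otimes>\<^sub>o ?e = a \<otimes>\<^sub>o ?e"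
    using pT p bounded[OF a(1)] by (simp add: a map_tensor_compose ee)
  moreover have "(a o\<^sub>L q) \<otimes>\<^sub>o ?e = a \<otimes>\<^sub>o ?e"
    using Tq p bounded[OF a(1)] by (simp add: a map_tensor_compose ee)
  ultimately show ?thesis
    using that a p bounded[OF a(1)] x by (simp add: map_tensor_rank_one_inject)
qed

lemma projection_tensor:
  assumes p: "p \<in> A" "is_adjoint p p" "p o\<^sub>L p = p" and x: "norm x = 1"
  shows "projection_in (stabilization A) (p \<otimes>\<^sub>o rank_one x x)"
  unfolding projection_in_def
  using p x bounded[OF p(1)] norm_selfadjoint_idempotent_le_1[OF p(2,3)]
  by (simp add: tensor_in_stabilization rank_one_compact_operators norm_map_tensor_rank_one
      map_tensor_compose rank_one_unit_compose)

lemma projection_P_tensor: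
  "\<gamma> \<in> \<Gamma> \<Longrightarrow> norm x = 1 \<Longrightarrow> projection_in (stabilization A) (P \<gamma> \<otimes>\<^sub>o rank_one x x)"
  by (rule projection_tensor) (auto simp: P_in P_selfadjoint P_compose)

lemma projection_in_selfadjoint:
  "projection_in (stabilization A) R \<Longrightarrow> is_adjoint R R"
  unfolding projection_in_def
  by (blast intro: contractive_idempotent_selfadjoint stabilization_bounded)

text \<open>The element \<open>a\<close> of \<open>A\<close> behind \<open>T\<close> is selfadjoint,
  hence in the diagonal, where the corner at \<open>P \<gamma>\<close> is scalar. The corner of
  \<open>A\<close> itself may be larger.\<close>

lemma selfadjoint_corner_scalar:
  assumes T: "T \<in> stabilization A" "is_adjoint T T" and x: "norm x = 1" and g: "\<gamma> \<in> \<Gamma>"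
    and PT: "(P \<gamma> \<otimes>\<^sub>o rank_one x x) o\<^sub>L T = T" and TP: "T o\<^sub>L (P \<gamma> \<otimes>\<^sub>o rank_one x x) = T"
  obtains c where "T = c *\<^sub>C (P \<gamma> \<otimes>\<^sub>o rank_one x x)"
proof -
  note Pb = P_bounded[OF g]
  obtain a where a: "a \<in> A" "T = a \<otimes>\<^sub>o rank_one x x" "a o\<^sub>L P \<gamma> = a"
    using stabilization_corner[OF T(1) x Pb Pb PT TP] by metis
  have "is_adjoint a a"
    using is_adjoint_of_map_tensor[OF bounded[OF a(1)] bounded[OF a(1)] x] T(2) a(2) by simp
  then have "a \<in> diag A" using diag_adjoint a(1) by blast
  then obtain c where "a = c *\<^sub>C P \<gamma>" using diag_corner_scalar g a(3) by blast
  then have "T = c *\<^sub>C (P \<gamma> \<otimes>\<^sub>o rank_one x x)" using a(2) Pb by (simp add: map_tensor_scaleC_left)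
  then show ?thesis by (rule that)
qed

lemma P_tensor_nonzero: "\<gamma> \<in> \<Gamma> \<Longrightarrow> norm x = 1 \<Longrightarrow> P \<gamma> \<otimes>\<^sub>o rank_one x x \<noteq> 0"
  using norm_map_tensor_rank_one[OF P_bounded] P_nonzero by fastforce

text \<open>A smaller projection is selfadjoint, so it is a scalar multiple of the given one, and
  idempotence leaves only the scalars 0 and 1.\<close>

lemma minimal_projection_P_tensor:
  assumes g: "\<gamma> \<in> \<Gamma>" and x: "norm x = 1"
  shows "minimal_projection_in (stabilization A) (P \<gamma> \<otimes>\<^sub>o rank_one x x)"
  unfolding minimal_projection_in_def
proof (intro conjI allI impI)
  let ?p = "P \<gamma> \<otimes>\<^sub>o rank_one x x"
  show p: "projection_in (stabilization A) ?p" by (rule projection_P_tensor[OF g x])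
  show "?p \<noteq> 0" by (rule P_tensor_nonzero[OF g x])
  fix Q assume Q: "projection_in (stabilization A) Q \<and> ?p o\<^sub>L Q = Q \<and> Q o\<^sub>L ?p = Q"
  then have "Q \<in> stabilization A" by (simp add: projection_in_def)
  then obtain c where c: "Q = c *\<^sub>C ?p"
    using selfadjoint_corner_scalar[OF _ projection_in_selfadjoint x g] Q by metis
  have "c *\<^sub>C (c *\<^sub>C ?p) = c *\<^sub>C ?p"
    using Q p stabilization_bounded[of ?p] unfolding projection_in_def c
    by (simp add: compose_scaleC_right)
  then have "c * c = c" using \<open>?p \<noteq> 0\<close> by simp
  then show "Q = 0 \<or> Q = ?p" using c by auto
qed

text \<open>For a fixed unit vector \<open>x\<close>, the set of \<open>u\<close> with
  \<open>R (u \<otimes> x) = 0\<close> contains the ranges of the \<open>P \<gamma>\<close> and of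
  the \<open>PF F\<close>. By approximation it contains all \<open>a v\<close> with \<open>a\<close>
  in \<open>A\<close>, and by nondegeneracy it is the whole space.\<close>

lemma eq_0_if_vanishes_on_P_tensor:
  fixes R :: "('a, 'k::chilbert_space) htensor \<Rightarrow>\<^sub>L ('a, 'k) htensor"
  assumes R: "R \<in> bounded_operators"
    and z: "\<And>\<gamma> x :: 'k. \<gamma> \<in> \<Gamma> \<Longrightarrow> norm x = 1 \<Longrightarrow> R o\<^sub>L (P \<gamma> \<otimes>\<^sub>o rank_one x x) = 0"
  shows "R = 0"
proof (rule blinfun_eq_on_tensors)
  fix u :: 'a and y :: 'k
  show "R (u \<otimes>\<^sub>h y) = blinfun_apply 0 (u \<otimes>\<^sub>h y)"
  proof (cases "y = 0")
    case True
    then show ?thesis using tensor_scaleC_right[of u 0 y] by (simp add: blinfun.zero_right)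
  next
    case False
    define x where "x = complex_of_real (1 / norm y) *\<^sub>C y"
    have x: "norm x = 1" using False by (simp add: x_def norm_divide)
    have y: "y = complex_of_real (norm y) *\<^sub>C x" using False by (simp add: x_def)
    let ?Z = "{u. R (u \<otimes>\<^sub>h x) = 0}"
    have bl: "bounded_linear (\<lambda>u. R (u \<otimes>\<^sub>h x))"
    proof (rule bounded_linear_compose[OF blinfun.bounded_linear_right])
      show "bounded_linear (\<lambda>u :: 'a. u \<otimes>\<^sub>h x)"
        by (rule bounded_linear_intro[where K = 1])
          (simp_all add: tensor_add_left scaleR_scaleC tensor_scaleC_left norm_tensor x)
    qed
    have cl: "closed ?Z"
      by (intro closed_Collect_eq linear_continuous_on bl continuous_intros)
    have sub: "csubspace ?Z"
      by (rule complex_vector.subspaceI)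
        (simp_all add: tensor_add_left tensor_scaleC_left blinfun.add_right bounded_operatorsD[OF R] blinfun.zero_right)
    have PZ: "P \<gamma> u \<in> ?Z" if "\<gamma> \<in> \<Gamma>" for \<gamma> u
    proof -
      have "R ((P \<gamma> \<otimes>\<^sub>o rank_one x x) (u \<otimes>\<^sub>h x)) = 0"
        using z[OF that x] by (metis blinfun.zero_left blinfun_apply_blinfun_compose)
      then show ?thesis by (simp add: map_tensor(2) P_bounded that cinner_self x)
    qed
    have PFZ: "PF F u \<in> ?Z" if "F \<subseteq> \<Gamma>" for F u
      unfolding PF_def blinfun.sum_left
      using that by (intro complex_vector.subspace_sum[OF sub] PZ) auto
    have "a v \<in> ?Z" if a: "a \<in> A" for a v
    proof -
      have "a v \<in> closure ?Z" unfolding closure_approachable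
      proof (intro allI impI)
        fix e :: real assume "e > 0"
        \<comment> \<open>The added 1 covers the case \<open>v = 0\<close>.\<close>
        have pos: "norm v + 1 > 0" by (simp add: add_nonneg_pos)
        with \<open>e > 0\<close> have "e / (norm v + 1) > 0" by simp
        then obtain F where F: "F \<subseteq> \<Gamma>" "norm (a - (PF F o\<^sub>L (a o\<^sub>L PF F))) < e / (norm v + 1)"
          using PF_approximates[OF a] by blast
        let ?v = "PF F ((a o\<^sub>L PF F) v)"
        have "norm (a v - ?v) = norm ((a - (PF F o\<^sub>L (a o\<^sub>L PF F))) v)" by (simp add: blinfun.diff_left)
        also have "\<dots> \<le> norm (a - (PF F o\<^sub>L (a o\<^sub>L PF F))) * norm v" by (rule norm_blinfun)
        also have "\<dots> \<le> e / (norm v + 1) * norm v" using F(2) by (intro mult_right_mono) auto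
        also have "\<dots> < e"
          using \<open>e > 0\<close> pos by (simp add: pos_divide_less_eq distrib_left)
        finally show "\<exists>y\<in>?Z. dist y (a v) < e"
          using PFZ[OF F(1)] by (intro bexI[of _ ?v]) (simp_all add: dist_norm norm_minus_commute)
      qed
      then show ?thesis using cl by simp
    qed
    then have "cspan {blinfun_apply a v | a v. a \<in> A} \<subseteq> ?Z"
      by (intro complex_vector.span_minimal sub) blast
    then have "closure (cspan {blinfun_apply a v | a v. a \<in> A}) \<subseteq> ?Z"
      using cl by (rule closure_minimal)
    then have "u \<in> ?Z"
      using operator_algebra by (auto simp: operator_algebra_def nondegenerate_def)
    then show ?thesis
      by (subst y) (simp add: tensor_scaleC_right bounded_operatorsD[OF R])
  qed
qed

text \<open>If \<open>q = P\<^sub>\<gamma> \<otimes> zz\<^sup>*\<close> satisfies \<open>x = rq \<noteq> 0\<close>, then \<open>x\<^sup>*x\<close> is a positive multiple of the minimal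
  projection \<open>q\<close>, so that \<open>x\<close> is a multiple of a partial isometry from \<open>q\<close> to \<open>r\<close>.\<close>

lemma minimal_projection_equiv_P_tensor:
  fixes r :: "('a, 'k::chilbert_space) htensor \<Rightarrow>\<^sub>L ('a, 'k) htensor" and \<xi> :: 'k
  assumes r: "minimal_projection_in (stabilization A) r" and \<xi>: "norm \<xi> = 1"
  shows "\<exists>\<gamma>\<in>\<Gamma>. mvn_equiv (stabilization A) r (P \<gamma> \<otimes>\<^sub>o rank_one \<xi> \<xi>)"
proof -
  let ?C = "stabilization A :: (('a, 'k) htensor \<Rightarrow>\<^sub>L ('a, 'k) htensor) set"
  have rp: "projection_in ?C r" "r \<noteq> 0" using r by (simp_all add: minimal_projection_in_def)
  then have rC: "r \<in> ?C" "r o\<^sub>L r = r" by (simp_all add: projection_in_def)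
  note rb = stabilization_bounded[OF rC(1)]
  note radj = projection_in_selfadjoint[OF rp(1)]
  \<comment> \<open>Since \<open>r\<close> is nonzero, it cannot vanish on all these projections.
    The unit vector \<open>z\<close> found here may differ from \<open>\<xi>\<close>, which is
    corrected at the end.\<close>
  obtain \<gamma> and z :: 'k where g: "\<gamma> \<in> \<Gamma>" and z: "norm z = 1"
    and ne: "r o\<^sub>L (P \<gamma> \<otimes>\<^sub>o rank_one z z) \<noteq> 0"
    using eq_0_if_vanishes_on_P_tensor[OF rb] rp(2) by blast
  define q where "q = P \<gamma> \<otimes>\<^sub>o rank_one z z"
  note qp = projection_P_tensor[OF g z, folded q_def]
  then have qC: "q \<in> ?C" "q o\<^sub>L q = q" "norm q \<le> 1" by (simp_all add: projection_in_def)
  note qb = stabilization_bounded[OF qC(1)]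
  note qadj = projection_in_selfadjoint[OF qp]
  have qq: "q (q u) = q u" and rr: "r (r u) = r u" for u
    by (metis qC(2) rC(2) blinfun_apply_blinfun_compose)+
  define x where "x = r o\<^sub>L q"
  define y where "y = q o\<^sub>L r"
  have xy: "is_adjoint x y" unfolding x_def y_def by (rule is_adjoint_compose[OF radj qadj])
  have xC: "x \<in> ?C" "y \<in> ?C" unfolding x_def y_def by (intro stabilization_compose rC qC)+
  obtain c where c: "y o\<^sub>L x = c *\<^sub>C q"
  proof (rule selfadjoint_corner_scalar[OF _ _ z g, folded q_def])
    show "y o\<^sub>L x \<in> ?C" by (intro stabilization_compose xC)
    show "is_adjoint (y o\<^sub>L x) (y o\<^sub>L x)" using is_adjoint_compose[OF is_adjoint_sym[OF xy] xy] .
    show "q o\<^sub>L (y o\<^sub>L x) = y o\<^sub>L x" "(y o\<^sub>L x) o\<^sub>L q = y o\<^sub>L x"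
      by (auto intro!: blinfun_eqI simp: x_def y_def qq)
  qed
  have nx: "complex_of_real ((norm (x u))\<^sup>2) = c * complex_of_real ((norm (q u))\<^sup>2)" for u
  proof -
    have "complex_of_real ((norm (x u))\<^sup>2) = cinner u ((y o\<^sub>L x) u)"
      using xy unfolding is_adjoint_def cinner_self[symmetric] by simp
    also have "\<dots> = c * cinner u (q (q u))" by (simp add: c scaleC_blinfun.rep_eq qq)
    also have "cinner u (q (q u)) = complex_of_real ((norm (q u))\<^sup>2)"
      using qadj unfolding is_adjoint_def cinner_self[symmetric] by simp
    finally show ?thesis .
  qed
  have "x \<noteq> 0" using ne by (simp add: x_def q_def)
  then obtain u where u: "x u \<noteq> 0" by (metis blinfun.zero_left blinfun_eqI)
  with nx[of u] have qu: "q u \<noteq> 0" by auto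
  \<comment> \<open>This is \<open>c\<close> as a real number. Its positivity is read off at a
    vector that \<open>x\<close> does not kill, and permits division by its square root.\<close>
  define \<rho> where "\<rho> = (norm (x u))\<^sup>2 / (norm (q u))\<^sup>2"
  have \<rho>: "\<rho> > 0" using u qu by (simp add: \<rho>_def)
  have c\<rho>: "c = complex_of_real \<rho>" using nx[of u] qu by (simp add: \<rho>_def field_simps)
  define t where "t = complex_of_real (1 / sqrt \<rho>)"
  have tt: "cnj t = t" "t * (t * c) = 1"
  proof -
    have "1 / sqrt \<rho> * (1 / sqrt \<rho> * \<rho>) = 1" using \<rho> by (simp add: field_simps)
    then show "t * (t * c) = 1" unfolding t_def c\<rho> of_real_mult[symmetric] by simp
  qed (simp add: t_def)
  define v where "v = t *\<^sub>C x"
  define w where "w = t *\<^sub>C y"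
  have vC: "v \<in> ?C" "w \<in> ?C" unfolding v_def w_def by (intro stabilization_scale xC)+
  have vw: "is_adjoint v w" using is_adjoint_scaleC[OF xy, of t] by (simp add: v_def w_def tt)
  have wv: "w o\<^sub>L v = q"
    by (simp add: v_def w_def compose_scaleC_right stabilization_bounded xC c mult.assoc tt(2))
  have x_simps: "x o\<^sub>L q = x" "q o\<^sub>L y = y" "r o\<^sub>L x = x" "y o\<^sub>L r = y"
    by (auto intro!: blinfun_eqI simp: x_def y_def qq rr)
  have v_simps: "v o\<^sub>L q = v" "q o\<^sub>L w = w" "r o\<^sub>L v = v" "w o\<^sub>L r = w"
    by (simp_all add: v_def w_def compose_scaleC_right qb rb x_simps)
  have idem: "(v o\<^sub>L w) o\<^sub>L (v o\<^sub>L w) = v o\<^sub>L w"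
    by (metis compose_assoc wv v_simps(2))
  have vw_adj: "is_adjoint (v o\<^sub>L w) (v o\<^sub>L w)" by (rule is_adjoint_compose[OF vw is_adjoint_sym[OF vw]])
  note nvw = norm_selfadjoint_idempotent_le_1[OF vw_adj idem]
  have nv: "norm v \<le> 1" using norm_le_1_if_adjoint[OF vw] by (simp add: wv qC(3))
  have nw: "norm w \<le> 1" using norm_le_1_if_adjoint[OF is_adjoint_sym[OF vw] nvw] .
  have pair: "contractive_pair v w" unfolding contractive_pair_def
    by (simp add: nv nw wv v_simps compose_assoc[symmetric])
  \<comment> \<open>\<open>v w\<close> is a projection below \<open>r\<close>, and it is nonzero
    because \<open>q = q q = w (v w) v\<close>. Minimality of \<open>r\<close> then identifies the
    two.\<close>
  have "v o\<^sub>L w = r"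
  proof -
    have "projection_in ?C (v o\<^sub>L w)"
      unfolding projection_in_def using nvw idem stabilization_compose[OF vC] by simp
    moreover have "r o\<^sub>L (v o\<^sub>L w) = v o\<^sub>L w" "(v o\<^sub>L w) o\<^sub>L r = v o\<^sub>L w"
      using v_simps by (metis compose_assoc)+
    moreover have "v o\<^sub>L w \<noteq> 0"
    proof
      assume "v o\<^sub>L w = 0"
      then have "q o\<^sub>L q = 0" unfolding wv[symmetric] by (metis compose_assoc blinfun_compose_zero)
      then show False using qu by (simp add: qC(2))
    qed
    ultimately show ?thesis using r unfolding minimal_projection_in_def by blast
  qed
  then have rq: "mvn_equiv ?C r q" unfolding mvn_equiv_def using vC pair wv by blast
  \<comment> \<open>The partial isometry \<open>P \<gamma> \<otimes> rank_one z \<xi>\<close>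
    exchanges the vectors \<open>z\<close> and \<open>\<xi>\<close>, so the class depends on
    \<open>\<gamma>\<close> alone.\<close>
  have "mvn_equiv ?C q (P \<gamma> \<otimes>\<^sub>o rank_one \<xi> \<xi>)"
    unfolding mvn_equiv_def
  proof (rule bexI[of _ "P \<gamma> \<otimes>\<^sub>o rank_one z \<xi>"], rule bexI[of _ "P \<gamma> \<otimes>\<^sub>o rank_one \<xi> z"], intro conjI)
    have n: "norm (P \<gamma> \<otimes>\<^sub>o rank_one a b) \<le> 1" if "norm a = 1" "norm b = 1" for a b :: 'k
    proof -
      have "norm (P \<gamma> \<otimes>\<^sub>o rank_one a b) \<le> norm (P \<gamma>) * norm (rank_one a b)"
        by (intro norm_map_tensor_le P_bounded g) simp
      also have "\<dots> \<le> 1 * 1"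
        using norm_rank_one_le[of a b] that by (intro mult_mono norm_P g) auto
      finally show ?thesis by simp
    qed
    show "contractive_pair (P \<gamma> \<otimes>\<^sub>o rank_one z \<xi>) (P \<gamma> \<otimes>\<^sub>o rank_one \<xi> z)"
      unfolding contractive_pair_def
      by (simp add: n z \<xi> map_tensor_compose P_bounded g P_compose rank_one_unit_compose)
  qed (simp_all add: q_def z \<xi> map_tensor_compose P_bounded g P_compose rank_one_unit_compose
      tensor_in_stabilization rank_one_compact_operators P_in)
  with rq show ?thesis using mvn_equiv_trans[OF stabilization_algebra] g by blast
qed

text \<open>The pair comes from elements \<open>a\<close>, \<open>b\<close> of \<open>A\<close> that
  are adjoint to each other, so \<open>a\<close> lies in the diagonal. If the indices differed,
  \<open>a\<close> would sit between two orthogonal minimal projections of the diagonal and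
  vanish.\<close>

lemma mvn_equiv_P_tensor_eq:
  assumes eq: "mvn_equiv (stabilization A) (P \<gamma> \<otimes>\<^sub>o rank_one \<xi> \<xi>) (P \<gamma>' \<otimes>\<^sub>o rank_one \<xi> \<xi>)"
    and g: "\<gamma> \<in> \<Gamma>" "\<gamma>' \<in> \<Gamma>" and \<xi>: "norm \<xi> = 1"
  shows "\<gamma> = \<gamma>'"
proof (rule ccontr)
  assume ne: "\<gamma> \<noteq> \<gamma>'"
  let ?e = "rank_one \<xi> \<xi>"
  obtain V W where V: "V \<in> stabilization A" "W \<in> stabilization A" "contractive_pair V W"
    "V o\<^sub>L W = P \<gamma> \<otimes>\<^sub>o ?e" "W o\<^sub>L V = P \<gamma>' \<otimes>\<^sub>o ?e"
    using eq unfolding mvn_equiv_def by blast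
  note adj = contractive_pair_adjoint[OF stabilization_bounded[OF V(1)] stabilization_bounded[OF V(2)] V(3)]
  note Pb = P_bounded[OF g(1)] P_bounded[OF g(2)]
  have VW: "(P \<gamma> \<otimes>\<^sub>o ?e) o\<^sub>L V = V" "V o\<^sub>L (P \<gamma>' \<otimes>\<^sub>o ?e) = V"
    "(P \<gamma>' \<otimes>\<^sub>o ?e) o\<^sub>L W = W" "W o\<^sub>L (P \<gamma> \<otimes>\<^sub>o ?e) = W"
    using V(3) unfolding contractive_pair_def V(4,5)[symmetric] by (simp_all add: compose_assoc)
  obtain a where a: "a \<in> A" "V = a \<otimes>\<^sub>o ?e" "P \<gamma> o\<^sub>L a = a" "a o\<^sub>L P \<gamma>' = a"
    using stabilization_corner[OF V(1) \<xi> Pb VW(1,2)] .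
  obtain b where b: "b \<in> A" "W = b \<otimes>\<^sub>o ?e"
    using stabilization_corner[OF V(2) \<xi> Pb(2,1) VW(3,4)] .
  have "is_adjoint a b"
    using is_adjoint_of_map_tensor[OF bounded[OF a(1)] bounded[OF b(1)] \<xi>] adj a(2) b(2) by simp
  then have "a \<in> diag A" using diag_adjoint a(1) b(1) by blast
  then have "a = 0" using diag_corner_zero g ne a(3,4) by blast
  then have "V = 0" by (simp add: a(2))
  then have "P \<gamma> \<otimes>\<^sub>o ?e = 0" using V(4) by simp
  then show False using P_tensor_nonzero g \<xi> by blast
qed

end

section \<open>Isometric isomorphisms\<close>

definition isometric_isomorphism ::
    "(('a::chilbert_space \<Rightarrow>\<^sub>L 'a) \<Rightarrow> ('b::chilbert_space \<Rightarrow>\<^sub>L 'b)) \<Rightarrow> ('a \<Rightarrow>\<^sub>L 'a) set \<Rightarrow> ('b \<Rightarrow>\<^sub>L 'b) set \<Rightarrow> bool"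
  where "isometric_isomorphism \<phi> C D \<longleftrightarrow> bij_betw \<phi> C D \<and>
    (\<forall>S\<in>C. \<forall>T\<in>C. \<phi> (S + T) = \<phi> S + \<phi> T) \<and>
    (\<forall>c. \<forall>T\<in>C. \<phi> (c *\<^sub>C T) = c *\<^sub>C \<phi> T) \<and>
    (\<forall>S\<in>C. \<forall>T\<in>C. \<phi> (S o\<^sub>L T) = \<phi> S o\<^sub>L \<phi> T) \<and>
    (\<forall>T\<in>C. norm (\<phi> T) = norm T)"

lemma isometrically_isomorphic_iff: "isometrically_isomorphic C D \<longleftrightarrow> (\<exists>\<phi>. isometric_isomorphism \<phi> C D)"
  by (simp add: isometrically_isomorphic_def isometric_isomorphism_def)

lemma isometric_isomorphism_inverse:
  assumes \<phi>: "isometric_isomorphism \<phi> C D" and C: "closed_subalgebra C"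
  shows "isometric_isomorphism (inv_into C \<phi>) D C"
proof -
  let ?\<psi> = "inv_into C \<phi>"
  have bij: "bij_betw \<phi> C D" using \<phi> by (simp add: isometric_isomorphism_def)
  have in_C: "?\<psi> T \<in> C" and \<phi>\<psi>: "\<phi> (?\<psi> T) = T" if "T \<in> D" for T
    using that bij by (auto simp: bij_betw_def inv_into_into f_inv_into_f)
  have eqI: "?\<psi> T = S" if "S \<in> C" "\<phi> S = T" for S T
    using that bij by (auto simp: bij_betw_def)
  show ?thesis unfolding isometric_isomorphism_def
  proof (intro conjI ballI allI)
    show "bij_betw ?\<psi> D C" using bij by (rule bij_betw_inv_into)
    fix S T c assume S: "S \<in> D" and T: "T \<in> D"
    show "?\<psi> (S + T) = ?\<psi> S + ?\<psi> T" "?\<psi> (S o\<^sub>L T) = ?\<psi> S o\<^sub>L ?\<psi> T"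
      using in_C[OF S] in_C[OF T] \<phi> C \<phi>\<psi>[OF S] \<phi>\<psi>[OF T]
      by (intro eqI; simp add: isometric_isomorphism_def closed_subalgebra_def complex_vector.subspace_add)+
  next
    fix T c assume T: "T \<in> D"
    show "?\<psi> (c *\<^sub>C T) = c *\<^sub>C ?\<psi> T"
      using in_C[OF T] \<phi> C \<phi>\<psi>[OF T]
      by (intro eqI; simp add: isometric_isomorphism_def closed_subalgebra_def complex_vector.subspace_scale)
    show "norm (?\<psi> T) = norm T"
      using in_C[OF T] \<phi> \<phi>\<psi>[OF T] by (metis isometric_isomorphism_def)
  qed
qed

locale isometric_iso =
  fixes \<phi> :: "('a::chilbert_space \<Rightarrow>\<^sub>L 'a) \<Rightarrow> ('b::chilbert_space \<Rightarrow>\<^sub>L 'b)" and C D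
  assumes iso: "isometric_isomorphism \<phi> C D" and alg: "closed_subalgebra C"
begin

lemma bij: "bij_betw \<phi> C D"
  and \<phi>_add: "S \<in> C \<Longrightarrow> T \<in> C \<Longrightarrow> \<phi> (S + T) = \<phi> S + \<phi> T"
  and \<phi>_scale: "T \<in> C \<Longrightarrow> \<phi> (c *\<^sub>C T) = c *\<^sub>C \<phi> T"
  and \<phi>_compose: "S \<in> C \<Longrightarrow> T \<in> C \<Longrightarrow> \<phi> (S o\<^sub>L T) = \<phi> S o\<^sub>L \<phi> T"
  and \<phi>_norm: "T \<in> C \<Longrightarrow> norm (\<phi> T) = norm T"
  and \<phi>_in: "T \<in> C \<Longrightarrow> \<phi> T \<in> D"
  using iso by (auto simp: isometric_isomorphism_def bij_betw_def)

lemma C_compose: "S \<in> C \<Longrightarrow> T \<in> C \<Longrightarrow> S o\<^sub>L T \<in> C"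
  and C_subspace: "csubspace C"
  using alg by (auto simp: closed_subalgebra_def)

lemma \<phi>_inject: "S \<in> C \<Longrightarrow> T \<in> C \<Longrightarrow> \<phi> S = \<phi> T \<longleftrightarrow> S = T"
  using bij by (auto simp: bij_betw_def inj_on_def)

lemma \<phi>_zero: "\<phi> 0 = 0"
  using \<phi>_norm[OF complex_vector.subspace_0[OF C_subspace]] by simp

lemma \<phi>_sum: "(\<And>i. i \<in> I \<Longrightarrow> f i \<in> C) \<Longrightarrow> \<phi> (sum f I) = (\<Sum>i\<in>I. \<phi> (f i))"
  by (induction I rule: infinite_finite_induct)
    (auto simp: \<phi>_zero \<phi>_add complex_vector.subspace_sum[OF C_subspace])

text \<open>A contractive pair is described by norms and products alone, so \<open>\<phi>\<close>
  carries it over although nothing is assumed about \<open>\<phi>\<close> and adjoints.\<close>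

lemma mvn_equiv_\<phi>: "mvn_equiv C P Q \<Longrightarrow> mvn_equiv D (\<phi> P) (\<phi> Q)"
proof -
  assume "mvn_equiv C P Q"
  then obtain V W where V: "V \<in> C" "W \<in> C" "contractive_pair V W" "V o\<^sub>L W = P" "W o\<^sub>L V = Q"
    unfolding mvn_equiv_def by blast
  then have "contractive_pair (\<phi> V) (\<phi> W)"
    unfolding contractive_pair_def by (metis \<phi>_norm \<phi>_compose C_compose)
  with V show ?thesis unfolding mvn_equiv_def by (metis \<phi>_in \<phi>_compose)
qed

lemma projection_in_\<phi>: "projection_in C P \<Longrightarrow> projection_in D (\<phi> P)"
  unfolding projection_in_def by (metis \<phi>_in \<phi>_norm \<phi>_compose)

lemma projection_in_\<phi>_iff:
  assumes "Q \<in> C"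
  shows "projection_in D (\<phi> Q) \<longleftrightarrow> projection_in C Q"
  using assms C_compose[OF assms assms]
  by (auto simp: projection_in_def \<phi>_in \<phi>_norm \<phi>_inject simp flip: \<phi>_compose)

lemma minimal_projection_in_\<phi>:
  assumes P: "minimal_projection_in C P"
  shows "minimal_projection_in D (\<phi> P)"
  unfolding minimal_projection_in_def
proof (intro conjI allI impI)
  have P': "projection_in C P" "P \<noteq> 0" and PC: "P \<in> C"
    using P by (auto simp: minimal_projection_in_def projection_in_def)
  show "projection_in D (\<phi> P)" using P' by (intro projection_in_\<phi>)
  show "\<phi> P \<noteq> 0" using P' \<phi>_norm[OF PC] by auto
  fix Q assume Q: "projection_in D Q \<and> \<phi> P o\<^sub>L Q = Q \<and> Q o\<^sub>L \<phi> P = Q"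
  then have "Q \<in> D" by (simp add: projection_in_def)
  then obtain S where S: "S \<in> C" "\<phi> S = Q" using bij by (auto simp: bij_betw_def)
  have "projection_in C S" using Q S projection_in_\<phi>_iff by blast
  moreover have "P o\<^sub>L S = S" "S o\<^sub>L P = S"
    using Q S PC C_compose by (auto simp flip: \<phi>_inject simp: \<phi>_compose)
  ultimately have "S = 0 \<or> S = P" using P unfolding minimal_projection_in_def by blast
  then show "Q = 0 \<or> Q = \<phi> P" using S \<phi>_zero by auto
qed

end

section \<open>Extending an isometric isomorphism from a dense graph\<close>

lemma isometric_graph_extends:
  fixes R :: "('x::real_normed_vector \<times> 'y::banach) set"
  assumes iso: "\<And>a b a' b'. (a, b) \<in> R \<Longrightarrow> (a', b') \<in> R \<Longrightarrow> norm (b - b') = norm (a - a')"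
    and dense: "\<And>e. e > 0 \<Longrightarrow> \<exists>(a', b')\<in>R. norm (a - a') < e"
  shows "\<exists>b. (a, b) \<in> closure R"
proof -
  have "\<exists>p\<in>R. norm (a - fst p) < inverse (real (Suc n))" for n
    using dense[of "inverse (real (Suc n))"] by force
  then obtain p where p: "\<And>n. p n \<in> R" "\<And>n. norm (a - fst (p n)) < inverse (real (Suc n))"
    by metis
  have "(\<lambda>n. a - fst (p n)) \<longlonglongrightarrow> 0"
    by (rule LIMSEQ_null_bound[OF LIMSEQ_inverse_real_of_nat]) (use p(2) in \<open>auto intro: less_imp_le\<close>)
  from tendsto_diff[OF tendsto_const this, of a] have a: "(\<lambda>n. fst (p n)) \<longlonglongrightarrow> a" by simp
  \<comment> \<open>The isometry condition hands the Cauchy property from the first coordinates to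
    the second ones.\<close>
  have "norm (snd (p m) - snd (p n)) = norm (fst (p m) - fst (p n))" for m n
    by (rule iso) (simp_all add: p)
  then have "Cauchy (\<lambda>n. snd (p n))"
    using LIMSEQ_imp_Cauchy[OF a] unfolding Cauchy_def dist_norm by simp
  then obtain b where "(\<lambda>n. snd (p n)) \<longlonglongrightarrow> b" by (auto simp: Cauchy_convergent_iff convergent_def)
  from tendsto_Pair[OF a this] p(1) show ?thesis
    unfolding closure_sequential by (intro exI[of _ b] exI[of _ p]) simp
qed

text \<open>The closure of \<open>R\<close> is the graph of the required isomorphism. A relation
  treats the two algebras symmetrically, so totality and surjectivity follow from the same extension
  argument.\<close>

lemma isometrically_isomorphic_if_dense_graph:
  fixes A :: "('a::chilbert_space \<Rightarrow>\<^sub>L 'a) set" and B :: "('b::chilbert_space \<Rightarrow>\<^sub>L 'b) set"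
  assumes A: "closed_subalgebra A" and B: "closed_subalgebra B"
    and R: "R \<subseteq> A \<times> B"
    and R_add: "\<And>a b a' b'. (a, b) \<in> R \<Longrightarrow> (a', b') \<in> R \<Longrightarrow> (a + a', b + b') \<in> R"
    and R_scale: "\<And>c a b. (a, b) \<in> R \<Longrightarrow> (c *\<^sub>C a, c *\<^sub>C b) \<in> R"
    and R_compose: "\<And>a b a' b'. (a, b) \<in> R \<Longrightarrow> (a', b') \<in> R \<Longrightarrow> (a o\<^sub>L a', b o\<^sub>L b') \<in> R"
    and R_norm: "\<And>a b. (a, b) \<in> R \<Longrightarrow> norm b = norm a"
    and dense_A: "\<And>a e. a \<in> A \<Longrightarrow> e > 0 \<Longrightarrow> \<exists>(a', b')\<in>R. norm (a - a') < e"
    and dense_B: "\<And>b e. b \<in> B \<Longrightarrow> e > 0 \<Longrightarrow> \<exists>(a', b')\<in>R. norm (b - b') < e"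
  shows "isometrically_isomorphic A B"
proof -
  have R_diff: "(a - a', b - b') \<in> R" if "(a, b) \<in> R" "(a', b') \<in> R" for a b a' b'
    using R_add[OF that(1) R_scale[OF that(2), of "- 1"]] by (simp add: scaleC_minus_one)
  let ?G = "closure R"
  have seq: "\<exists>f g. (\<forall>n. (f n, g n) \<in> R) \<and> f \<longlonglongrightarrow> a \<and> g \<longlonglongrightarrow> b" if "(a, b) \<in> ?G" for a b
  proof -
    from that obtain p where p: "\<forall>n. p n \<in> R" "p \<longlonglongrightarrow> (a, b)" unfolding closure_sequential by blast
    then show ?thesis using tendsto_fst[OF p(2)] tendsto_snd[OF p(2)]
      by (intro exI[of _ "\<lambda>n. fst (p n)"] exI[of _ "\<lambda>n. snd (p n)"]) simp
  qed
  have GI: "(a, b) \<in> ?G" if "\<And>n. (f n, g n) \<in> R" "f \<longlonglongrightarrow> a" "g \<longlonglongrightarrow> b" for f g a b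
    unfolding closure_sequential using that
    by (intro exI[of _ "\<lambda>n. (f n, g n)"]) (auto intro: tendsto_Pair)
  have cont: "bounded_linear (\<lambda>v :: 'x::complex_normed_vector. c *\<^sub>C v)" for c
    by (rule bounded_linear_intro[where K = "cmod c"]) (simp_all add: scaleC_add_right scaleC_scaleR)
  have "closed (A \<times> B)" using A B by (simp add: closed_subalgebra_def closed_Times)
  with R have G_in: "?G \<subseteq> A \<times> B" by (rule closure_minimal)
  have G_norm: "norm b = norm a" if "(a, b) \<in> ?G" for a b
  proof -
    from seq[OF that] obtain f g where "\<forall>n. (f n, g n) \<in> R" "f \<longlonglongrightarrow> a" "g \<longlonglongrightarrow> b" by blast
    note fg = this
    have "norm (g n) = norm (f n)" for n using R_norm fg(1) by blast
    with tendsto_norm[OF fg(3)] have "(\<lambda>n. norm (f n)) \<longlonglongrightarrow> norm b" by simp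
    then show ?thesis by (rule LIMSEQ_unique[OF _ tendsto_norm[OF fg(2)]])
  qed
  have G_ops: "(a + a', b + b') \<in> ?G" "(a - a', b - b') \<in> ?G" "(a o\<^sub>L a', b o\<^sub>L b') \<in> ?G"
    if "(a, b) \<in> ?G" "(a', b') \<in> ?G" for a b a' b'
  proof -
    from seq[OF that(1)] obtain f g where fg: "\<forall>n. (f n, g n) \<in> R" "f \<longlonglongrightarrow> a" "g \<longlonglongrightarrow> b" by blast
    from seq[OF that(2)] obtain f' g' where fg': "\<forall>n. (f' n, g' n) \<in> R" "f' \<longlonglongrightarrow> a'" "g' \<longlonglongrightarrow> b'" by blast
    note fg = fg(1)[rule_format] fg(2,3) and fg' = fg'(1)[rule_format] fg'(2,3)
    have "(f n + f' n, g n + g' n) \<in> R" "(f n - f' n, g n - g' n) \<in> R"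
      "(f n o\<^sub>L f' n, g n o\<^sub>L g' n) \<in> R" for n
      by (intro R_add R_diff R_compose fg fg')+
    note in_R = this
    show "(a + a', b + b') \<in> ?G"
      by (rule GI[of "\<lambda>n. f n + f' n" "\<lambda>n. g n + g' n"]) (intro in_R tendsto_add fg fg')+
    show "(a - a', b - b') \<in> ?G"
      by (rule GI[of "\<lambda>n. f n - f' n" "\<lambda>n. g n - g' n"]) (intro in_R tendsto_diff fg fg')+
    show "(a o\<^sub>L a', b o\<^sub>L b') \<in> ?G"
      by (rule GI[of "\<lambda>n. f n o\<^sub>L f' n" "\<lambda>n. g n o\<^sub>L g' n"]) (intro in_R tendsto_compose_blinfun fg fg')+
  qed
  have G_scale: "(c *\<^sub>C a, c *\<^sub>C b) \<in> ?G" if "(a, b) \<in> ?G" for c a b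
  proof -
    from seq[OF that] obtain f g where fg: "\<forall>n. (f n, g n) \<in> R" "f \<longlonglongrightarrow> a" "g \<longlonglongrightarrow> b" by blast
    have "(c *\<^sub>C f n, c *\<^sub>C g n) \<in> R" for n using R_scale fg(1) by blast
    then show ?thesis
      by (rule GI[of "\<lambda>n. c *\<^sub>C f n" "\<lambda>n. c *\<^sub>C g n"]) (intro bounded_linear.tendsto[OF cont] fg)+
  qed
  have G_total: "\<exists>b. (a, b) \<in> ?G" if "a \<in> A" for a
    by (rule isometric_graph_extends[OF R_norm[OF R_diff] dense_A[OF that]])
  have G_onto: "\<exists>a. (a, b) \<in> ?G" if "b \<in> B" for b
  proof -
    \<comment> \<open>Surjectivity is totality of the converse relation.\<close>
    have "\<exists>a. (b, a) \<in> closure (R\<inverse>)"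
    proof (rule isometric_graph_extends)
      show "norm (a - a') = norm (b - b')" if "(b, a) \<in> R\<inverse>" "(b', a') \<in> R\<inverse>" for b a b' a'
        using R_norm[OF R_diff[of a b a' b']] that by simp
      show "\<exists>(b', a')\<in>R\<inverse>. norm (b - b') < e" if "e > 0" for e
        using dense_B[OF \<open>b \<in> B\<close> that] by auto
    qed
    then obtain a p where p: "\<forall>n. p n \<in> R\<inverse>" "p \<longlonglongrightarrow> (b, a)" unfolding closure_sequential by blast
    from p(1) have "(snd (p n), fst (p n)) \<in> R" for n by (metis converse_iff surjective_pairing)
    then have "(a, b) \<in> ?G"
      by (rule GI[of "\<lambda>n. snd (p n)" "\<lambda>n. fst (p n)"])
        (use tendsto_fst[OF p(2)] tendsto_snd[OF p(2)] in simp_all)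
    then show ?thesis ..
  qed
  \<comment> \<open>Subtraction puts \<open>(0, b - b')\<close> into the closure, where both entries
    have the same norm.\<close>
  have G_unique: "b = b'" if "(a, b) \<in> ?G" "(a, b') \<in> ?G" for a b b'
    using G_norm[OF G_ops(2)[OF that]] by simp
  obtain \<phi> where \<phi>: "\<And>a. a \<in> A \<Longrightarrow> (a, \<phi> a) \<in> ?G" using G_total by metis
  have \<phi>_eq: "\<phi> a = b" if "(a, b) \<in> ?G" for a b
    using G_unique[OF \<phi> that] G_in that by auto
  have "bij_betw \<phi> A B" unfolding bij_betw_def
  proof
    show "inj_on \<phi> A"
    proof (rule inj_onI)
      fix a a' assume a: "a \<in> A" "a' \<in> A" "\<phi> a = \<phi> a'"
      show "a = a'" using G_norm[OF G_ops(2)[OF \<phi>[OF a(1)] \<phi>[OF a(2)]]] a(3) by simp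
    qed
    show "\<phi> ` A = B" using \<phi> \<phi>_eq G_in G_onto by (force simp: image_iff)
  qed
  moreover have "\<phi> (S + T) = \<phi> S + \<phi> T" "\<phi> (S o\<^sub>L T) = \<phi> S o\<^sub>L \<phi> T" if "S \<in> A" "T \<in> A" for S T
    using that by (simp_all add: \<phi>_eq[OF G_ops(1)] \<phi>_eq[OF G_ops(3)] \<phi>)
  moreover have "\<phi> (c *\<^sub>C T) = c *\<^sub>C \<phi> T" "norm (\<phi> T) = norm T" if "T \<in> A" for c T
    using that by (simp_all add: \<phi>_eq[OF G_scale] G_norm \<phi>)
  ultimately show ?thesis unfolding isometrically_isomorphic_def by blast
qed

section \<open>The bijection between the minimal projections of the two diagonals\<close>

locale stable_isomorphism =
  A: c0_diagonal A \<Gamma> \<pi> + B: c0_diagonal B \<Delta> \<rho> +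
  isometric_iso \<phi> "stabilization A" "stabilization B"
  for A :: "('a::chilbert_space \<Rightarrow>\<^sub>L 'a) set" and \<Gamma> :: "'g set" and \<pi>
    and B :: "('b::chilbert_space \<Rightarrow>\<^sub>L 'b) set" and \<Delta> :: "'h set" and \<rho>
    and \<phi> :: "(('a, 'k::chilbert_space) htensor \<Rightarrow>\<^sub>L ('a, 'k) htensor) \<Rightarrow> (('b, 'k) htensor \<Rightarrow>\<^sub>L ('b, 'k) htensor)" +
  fixes \<xi> :: 'k
  assumes \<xi>: "norm \<xi> = 1"
begin

abbreviation "e \<equiv> rank_one \<xi> \<xi>"

text \<open>\<open>\<phi>\<close> preserves minimal projections, and their classification on the
  side of \<open>B\<close> provides \<open>\<sigma> \<gamma>\<close>. For injectivity an equivalence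
  is pulled back along the inverse of \<open>\<phi>\<close>. For surjectivity the classification on
  the side of \<open>A\<close> is applied to the preimage of
  \<open>B.P \<delta> \<otimes> e\<close>.\<close>

lemma ex_matching:
  "\<exists>\<sigma>. bij_betw \<sigma> \<Gamma> \<Delta> \<and>
    (\<forall>\<gamma>\<in>\<Gamma>. mvn_equiv (stabilization B) (B.P (\<sigma> \<gamma>) \<otimes>\<^sub>o e) (\<phi> (A.P \<gamma> \<otimes>\<^sub>o e)))"
proof -
  let ?C = "stabilization A :: (('a, 'k) htensor \<Rightarrow>\<^sub>L ('a, 'k) htensor) set"
  let ?D = "stabilization B :: (('b, 'k) htensor \<Rightarrow>\<^sub>L ('b, 'k) htensor) set"
  let ?\<psi> = "inv_into ?C \<phi>"
  interpret inv: isometric_iso ?\<psi> ?D ?C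
    using isometric_isomorphism_inverse[OF iso alg] B.stabilization_algebra by unfold_locales
  have \<psi>\<phi>: "?\<psi> (\<phi> T) = T" if "T \<in> ?C" for T using that bij by (simp add: bij_betw_def)
  have \<phi>\<psi>: "\<phi> (?\<psi> T) = T" if "T \<in> ?D" for T using that bij by (simp add: bij_betw_def f_inv_into_f)
  have PA: "A.P \<gamma> \<otimes>\<^sub>o e \<in> ?C" if "\<gamma> \<in> \<Gamma>" for \<gamma>
    using that by (intro A.tensor_in_stabilization A.P_in rank_one_compact_operators)
  have PB: "B.P \<delta> \<otimes>\<^sub>o e \<in> ?D" if "\<delta> \<in> \<Delta>" for \<delta>
    using that by (intro B.tensor_in_stabilization B.P_in rank_one_compact_operators)
  have "\<exists>\<delta>\<in>\<Delta>. mvn_equiv ?D (B.P \<delta> \<otimes>\<^sub>o e) (\<phi> (A.P \<gamma> \<otimes>\<^sub>o e))" if "\<gamma> \<in> \<Gamma>" for \<gamma>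
    using B.minimal_projection_equiv_P_tensor[OF minimal_projection_in_\<phi>[OF A.minimal_projection_P_tensor[OF that \<xi>]] \<xi>]
    by (blast intro: mvn_equiv_sym)
  then obtain \<sigma> where \<sigma>: "\<And>\<gamma>. \<gamma> \<in> \<Gamma> \<Longrightarrow> \<sigma> \<gamma> \<in> \<Delta>"
    "\<And>\<gamma>. \<gamma> \<in> \<Gamma> \<Longrightarrow> mvn_equiv ?D (B.P (\<sigma> \<gamma>) \<otimes>\<^sub>o e) (\<phi> (A.P \<gamma> \<otimes>\<^sub>o e))"
    by metis
  have "inj_on \<sigma> \<Gamma>"
  proof (rule inj_onI)
    fix \<gamma> \<gamma>' assume g: "\<gamma> \<in> \<Gamma>" "\<gamma>' \<in> \<Gamma>" and eq: "\<sigma> \<gamma> = \<sigma> \<gamma>'"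
    have "mvn_equiv ?D (\<phi> (A.P \<gamma> \<otimes>\<^sub>o e)) (\<phi> (A.P \<gamma>' \<otimes>\<^sub>o e))"
      using mvn_equiv_trans[OF B.stabilization_algebra mvn_equiv_sym[OF \<sigma>(2)[OF g(1)]]] \<sigma>(2)[OF g(2)] eq
      by simp
    from inv.mvn_equiv_\<phi>[OF this] have "mvn_equiv ?C (A.P \<gamma> \<otimes>\<^sub>o e) (A.P \<gamma>' \<otimes>\<^sub>o e)"
      by (simp add: \<psi>\<phi> PA g)
    then show "\<gamma> = \<gamma>'" by (rule A.mvn_equiv_P_tensor_eq[OF _ g \<xi>])
  qed
  moreover have "\<delta> \<in> \<sigma> ` \<Gamma>" if d: "\<delta> \<in> \<Delta>" for \<delta>
  proof -
    obtain \<gamma> where g: "\<gamma> \<in> \<Gamma>" "mvn_equiv ?C (?\<psi> (B.P \<delta> \<otimes>\<^sub>o e)) (A.P \<gamma> \<otimes>\<^sub>o e)"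
      using A.minimal_projection_equiv_P_tensor[OF inv.minimal_projection_in_\<phi>[OF B.minimal_projection_P_tensor[OF d \<xi>]] \<xi>]
      by blast
    from mvn_equiv_\<phi>[OF this(2)] have "mvn_equiv ?D (B.P \<delta> \<otimes>\<^sub>o e) (\<phi> (A.P \<gamma> \<otimes>\<^sub>o e))"
      by (simp add: \<phi>\<psi> PB d)
    then have "mvn_equiv ?D (B.P \<delta> \<otimes>\<^sub>o e) (B.P (\<sigma> \<gamma>) \<otimes>\<^sub>o e)"
      using mvn_equiv_trans[OF B.stabilization_algebra] mvn_equiv_sym[OF \<sigma>(2)[OF g(1)]] by blast
    then have "\<delta> = \<sigma> \<gamma>" by (rule B.mvn_equiv_P_tensor_eq[OF _ d \<sigma>(1)[OF g(1)] \<xi>])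
    then show ?thesis using g(1) by blast
  qed
  ultimately show ?thesis using \<sigma> unfolding bij_betw_def by blast
qed

end

section \<open>Passing from stabilizations to the algebras\<close>

text \<open>This collapses products of sums of partial isometries. The outer set may be smaller, as
  needed when different finite index sets are compared.\<close>

lemma sum_diagonal:
  assumes "finite F" "finite G" "F \<subseteq> G" "\<And>i j. i \<in> G \<Longrightarrow> j \<in> G \<Longrightarrow> i \<noteq> j \<Longrightarrow> h i j = (0 :: 'z::comm_monoid_add)"
  shows "(\<Sum>i\<in>F. \<Sum>j\<in>G. h i j) = (\<Sum>i\<in>F. h i i)"
proof (rule sum.cong[OF refl])
  fix i assume "i \<in> F"
  with assms have "(\<Sum>j\<in>G. h i j) = (\<Sum>j\<in>G. if j = i then h i i else 0)"
    by (intro sum.cong) auto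
  with \<open>i \<in> F\<close> assms show "(\<Sum>j\<in>G. h i j) = h i i" by auto
qed

locale matched_stable_isomorphism = stable_isomorphism +
  fixes \<sigma> and v and w
  assumes \<sigma>: "bij_betw \<sigma> \<Gamma> \<Delta>"
    and v_in: "\<And>\<gamma>. \<gamma> \<in> \<Gamma> \<Longrightarrow> v \<gamma> \<in> stabilization B"
    and w_in: "\<And>\<gamma>. \<gamma> \<in> \<Gamma> \<Longrightarrow> w \<gamma> \<in> stabilization B"
    and pair: "\<And>\<gamma>. \<gamma> \<in> \<Gamma> \<Longrightarrow> contractive_pair (v \<gamma>) (w \<gamma>)"
    and v_w: "\<And>\<gamma>. \<gamma> \<in> \<Gamma> \<Longrightarrow> v \<gamma> o\<^sub>L w \<gamma> = B.P (\<sigma> \<gamma>) \<otimes>\<^sub>o e"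
    and w_v: "\<And>\<gamma>. \<gamma> \<in> \<Gamma> \<Longrightarrow> w \<gamma> o\<^sub>L v \<gamma> = \<phi> (A.P \<gamma> \<otimes>\<^sub>o e)"
begin

lemma tensor_A: "a \<in> A \<Longrightarrow> a \<otimes>\<^sub>o e \<in> stabilization A"
  and tensor_B: "b \<in> B \<Longrightarrow> b \<otimes>\<^sub>o e \<in> stabilization B"
  by (simp_all add: A.tensor_in_stabilization B.tensor_in_stabilization rank_one_compact_operators)

lemma tensor_compose:
  fixes a a' :: "'x::chilbert_space \<Rightarrow>\<^sub>L 'x"
  assumes "a \<in> bounded_operators" "a' \<in> bounded_operators"
  shows "(a \<otimes>\<^sub>o e) o\<^sub>L (a' \<otimes>\<^sub>o e) = (a o\<^sub>L a') \<otimes>\<^sub>o e"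
  using assms \<xi> by (simp add: map_tensor_compose rank_one_unit_compose)

lemma \<sigma>_in: "\<gamma> \<in> \<Gamma> \<Longrightarrow> \<sigma> \<gamma> \<in> \<Delta>"
  and \<sigma>_inj: "\<gamma> \<in> \<Gamma> \<Longrightarrow> \<gamma>' \<in> \<Gamma> \<Longrightarrow> \<sigma> \<gamma> = \<sigma> \<gamma>' \<longleftrightarrow> \<gamma> = \<gamma>'"
  using \<sigma> by (auto simp: bij_betw_def inj_on_def)

lemma vwv: "\<gamma> \<in> \<Gamma> \<Longrightarrow> (v \<gamma> o\<^sub>L w \<gamma>) o\<^sub>L v \<gamma> = v \<gamma>"
  and wvw: "\<gamma> \<in> \<Gamma> \<Longrightarrow> (w \<gamma> o\<^sub>L v \<gamma>) o\<^sub>L w \<gamma> = w \<gamma>"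
  using pair[of \<gamma>] by (simp_all add: contractive_pair_def compose_assoc)

text \<open>Inserting the range projections of both partial isometries brings
  \<open>B.P (\<sigma> \<gamma>)\<close> next to \<open>B.P (\<sigma> \<gamma>')\<close>, and these
  are orthogonal because \<open>\<sigma>\<close> is injective.\<close>

lemma w_v_orthogonal:
  assumes g: "\<gamma> \<in> \<Gamma>" "\<gamma>' \<in> \<Gamma>" "\<gamma> \<noteq> \<gamma>'"
  shows "w \<gamma> o\<^sub>L v \<gamma>' = 0"
proof -
  have "w \<gamma> o\<^sub>L v \<gamma>' = ((w \<gamma> o\<^sub>L v \<gamma>) o\<^sub>L w \<gamma>) o\<^sub>L ((v \<gamma>' o\<^sub>L w \<gamma>') o\<^sub>L v \<gamma>')"
    by (simp only: vwv wvw g)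
  also have "\<dots> = w \<gamma> o\<^sub>L (((v \<gamma> o\<^sub>L w \<gamma>) o\<^sub>L (v \<gamma>' o\<^sub>L w \<gamma>')) o\<^sub>L v \<gamma>')"
    by (simp only: compose_assoc)
  also have "(v \<gamma> o\<^sub>L w \<gamma>) o\<^sub>L (v \<gamma>' o\<^sub>L w \<gamma>') = 0"
    using g by (simp add: v_w tensor_compose B.P_bounded \<sigma>_in B.P_compose \<sigma>_inj)
  finally show ?thesis by simp
qed

text \<open>Here the initial projections meet. They are orthogonal as images under
  \<open>\<phi>\<close> of orthogonal projections.\<close>

lemma v_w_orthogonal:
  assumes g: "\<gamma> \<in> \<Gamma>" "\<gamma>' \<in> \<Gamma>" "\<gamma> \<noteq> \<gamma>'"
  shows "v \<gamma> o\<^sub>L w \<gamma>' = 0"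
proof -
  have "v \<gamma> o\<^sub>L w \<gamma>' = ((v \<gamma> o\<^sub>L w \<gamma>) o\<^sub>L v \<gamma>) o\<^sub>L ((w \<gamma>' o\<^sub>L v \<gamma>') o\<^sub>L w \<gamma>')"
    by (simp only: vwv wvw g)
  also have "\<dots> = v \<gamma> o\<^sub>L (((w \<gamma> o\<^sub>L v \<gamma>) o\<^sub>L (w \<gamma>' o\<^sub>L v \<gamma>')) o\<^sub>L w \<gamma>')"
    by (simp only: compose_assoc)
  also have "(w \<gamma> o\<^sub>L v \<gamma>) o\<^sub>L (w \<gamma>' o\<^sub>L v \<gamma>') = 0"
    using g by (simp add: w_v tensor_compose A.P_bounded A.P_compose tensor_A A.P_in \<phi>_zero flip: \<phi>_compose)
  finally show ?thesis by simp
qed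

section \<open>Finite sums of the matching partial isometries\<close>

definition "V F = (\<Sum>\<gamma>\<in>F. v \<gamma>)"
definition "W F = (\<Sum>\<gamma>\<in>F. w \<gamma>)"
text \<open>The initial and the final projection of \<open>V F\<close> for finite
  \<open>F\<close>.\<close>

abbreviation "EA F \<equiv> \<phi> (A.PF F \<otimes>\<^sub>o e)"
abbreviation "EB F \<equiv> B.PF (\<sigma> ` F) \<otimes>\<^sub>o e"

lemma V_in: "F \<subseteq> \<Gamma> \<Longrightarrow> V F \<in> stabilization B"
  and W_in: "F \<subseteq> \<Gamma> \<Longrightarrow> W F \<in> stabilization B"
proof -
  have sub: "csubspace (stabilization B)"
    using B.stabilization_algebra by (auto simp: closed_subalgebra_def)
  show "F \<subseteq> \<Gamma> \<Longrightarrow> V F \<in> stabilization B" "F \<subseteq> \<Gamma> \<Longrightarrow> W F \<in> stabilization B"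
    unfolding V_def W_def by (auto intro!: complex_vector.subspace_sum[OF sub] v_in w_in)
qed

lemma EA_sum: "F \<subseteq> \<Gamma> \<Longrightarrow> EA F = (\<Sum>\<gamma>\<in>F. w \<gamma> o\<^sub>L v \<gamma>)"
  unfolding A.PF_def using subsetD[of F \<Gamma>]
  by (simp add: map_tensor_sum_left A.P_bounded \<phi>_sum tensor_A A.P_in w_v)

lemma EB_sum: "F \<subseteq> \<Gamma> \<Longrightarrow> EB F = (\<Sum>\<gamma>\<in>F. v \<gamma> o\<^sub>L w \<gamma>)"
proof -
  assume F: "F \<subseteq> \<Gamma>"
  then have "inj_on \<sigma> F" using \<sigma> inj_on_subset by (auto simp: bij_betw_def)
  then have "B.PF (\<sigma> ` F) = (\<Sum>\<gamma>\<in>F. B.P (\<sigma> \<gamma>))" by (simp add: B.PF_def sum.reindex)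
  then show ?thesis using subsetD[OF F] by (simp add: map_tensor_sum_left B.P_bounded \<sigma>_in v_w)
qed

lemma W_V:
  assumes F: "finite F" "F \<subseteq> \<Gamma>"
  shows "W F o\<^sub>L V F = EA F"
proof -
  have "W F o\<^sub>L V F = (\<Sum>i\<in>F. \<Sum>j\<in>F. w i o\<^sub>L v j)"
    by (simp add: W_def V_def compose_sum_left compose_sum_right) (rule sum.swap)
  also have "\<dots> = (\<Sum>i\<in>F. w i o\<^sub>L v i)"
    using F by (intro sum_diagonal w_v_orthogonal) auto
  finally show ?thesis by (simp add: EA_sum F)
qed

lemma V_W:
  assumes F: "finite F" "F \<subseteq> \<Gamma>"
  shows "V F o\<^sub>L W F = EB F"
proof -
  have "V F o\<^sub>L W F = (\<Sum>i\<in>F. \<Sum>j\<in>F. v i o\<^sub>L w j)"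
    by (simp add: W_def V_def compose_sum_left compose_sum_right) (rule sum.swap)
  also have "\<dots> = (\<Sum>i\<in>F. v i o\<^sub>L w i)"
    using F by (intro sum_diagonal v_w_orthogonal) auto
  finally show ?thesis by (simp add: EB_sum F)
qed

text \<open>By orthogonality, the initial projection over \<open>F\<close> removes all summands of
  \<open>V G\<close> outside \<open>F\<close>. This makes the corner maps compatible; for
  \<open>F = G\<close> it says that \<open>V G\<close> absorbs its own initial projection.\<close>

lemma V_EA:
  assumes G: "finite G" "G \<subseteq> \<Gamma>" and FG: "F \<subseteq> G"
  shows "V G o\<^sub>L EA F = V F"
proof -
  have F: "finite F" "F \<subseteq> \<Gamma>" using FG G finite_subset by auto
  have 0: "v j o\<^sub>L (w i o\<^sub>L v i) = 0" if "i \<in> G" "j \<in> G" "i \<noteq> j" for i j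
    using v_w_orthogonal[of j i] that G(2) by (simp add: subset_iff flip: compose_assoc)
  have "V G o\<^sub>L EA F = (\<Sum>i\<in>F. \<Sum>j\<in>G. v j o\<^sub>L (w i o\<^sub>L v i))"
    by (simp add: EA_sum F V_def compose_sum_left compose_sum_right)
  also have "\<dots> = (\<Sum>i\<in>F. v i o\<^sub>L (w i o\<^sub>L v i))"
    using F G FG 0 by (intro sum_diagonal) auto
  also have "\<dots> = V F"
    unfolding V_def using F(2) by (intro sum.cong) (auto simp: vwv simp flip: compose_assoc)
  finally show ?thesis .
qed

lemma EA_W:
  assumes G: "finite G" "G \<subseteq> \<Gamma>" and FG: "F \<subseteq> G"
  shows "EA F o\<^sub>L W G = W F"
proof -
  have F: "finite F" "F \<subseteq> \<Gamma>" using FG G finite_subset by auto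
  have 0: "(w i o\<^sub>L v i) o\<^sub>L w j = 0" if "i \<in> G" "j \<in> G" "i \<noteq> j" for i j
    using v_w_orthogonal[of i j] that G(2) by (simp add: subset_iff compose_assoc)
  have "EA F o\<^sub>L W G = (\<Sum>i\<in>F. \<Sum>j\<in>G. (w i o\<^sub>L v i) o\<^sub>L w j)"
    by (simp add: EA_sum F W_def compose_sum_left compose_sum_right) (rule sum.swap)
  also have "\<dots> = (\<Sum>i\<in>F. (w i o\<^sub>L v i) o\<^sub>L w i)"
    using F G FG 0 by (intro sum_diagonal) auto
  also have "\<dots> = W F"
    unfolding W_def using F(2) by (intro sum.cong) (auto simp: wvw)
  finally show ?thesis .
qed

lemma V_W_adjoint: "F \<subseteq> \<Gamma> \<Longrightarrow> is_adjoint (V F) (W F)"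
  unfolding V_def W_def
  by (intro is_adjoint_sum contractive_pair_adjoint B.stabilization_bounded v_in w_in pair) auto

text \<open>Contractivity of the summands would bound the sums only by the size of \<open>F\<close>.
  Here the products \<open>W F V F\<close> and \<open>V F W F\<close> are projections, which bounds
  both factors by one.\<close>

lemma norm_V_W:
  assumes F: "finite F" "F \<subseteq> \<Gamma>"
  shows "norm (V F) \<le> 1" "norm (W F) \<le> 1"
proof -
  have \<sigma>F: "finite (\<sigma> ` F)" "\<sigma> ` F \<subseteq> \<Delta>" using F \<sigma>_in by auto
  have "norm (W F o\<^sub>L V F) \<le> 1"
    using A.norm_PF[OF F] by (simp add: W_V F \<phi>_norm tensor_A A.PF_in norm_map_tensor_rank_one A.PF_bounded \<xi>)
  then show "norm (V F) \<le> 1" by (rule norm_le_1_if_adjoint[OF V_W_adjoint[OF F(2)]])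
  have "norm (V F o\<^sub>L W F) \<le> 1"
    using B.norm_PF[OF \<sigma>F] by (simp add: V_W F norm_map_tensor_rank_one B.PF_bounded \<sigma>F \<xi>)
  then show "norm (W F) \<le> 1" by (rule norm_le_1_if_adjoint[OF is_adjoint_sym[OF V_W_adjoint[OF F(2)]]])
qed

text \<open>Conjugation by \<open>V F\<close>, as a relation between the corners of \<open>A\<close>
  and \<open>B\<close> cut out by \<open>F\<close>. Keeping \<open>F\<close> as a parameter allows
  the corners to be united afterwards.\<close>

definition related :: "'b set \<Rightarrow> _ \<Rightarrow> _ \<Rightarrow> bool" where
  "related F a b \<longleftrightarrow> finite F \<and> F \<subseteq> \<Gamma> \<and> a \<in> A \<and> b \<in> B \<and>
    A.PF F o\<^sub>L a = a \<and> a o\<^sub>L A.PF F = a \<and> B.PF (\<sigma> ` F) o\<^sub>L b = b \<and> b o\<^sub>L B.PF (\<sigma> ` F) = b \<and>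
    V F o\<^sub>L (\<phi> (a \<otimes>\<^sub>o e) o\<^sub>L W F) = b \<otimes>\<^sub>o e"

lemma EA_absorb:
  assumes F: "finite F" "F \<subseteq> \<Gamma>" and a: "a \<in> A"
  shows "A.PF F o\<^sub>L a = a \<Longrightarrow> EA F o\<^sub>L \<phi> (a \<otimes>\<^sub>o e) = \<phi> (a \<otimes>\<^sub>o e)"
    and "a o\<^sub>L A.PF F = a \<Longrightarrow> \<phi> (a \<otimes>\<^sub>o e) o\<^sub>L EA F = \<phi> (a \<otimes>\<^sub>o e)"
  using F a by (simp_all add: tensor_A A.PF_in tensor_compose A.PF_bounded A.bounded flip: \<phi>_compose)

text \<open>\<open>\<phi> (a \<otimes> e)\<close> absorbs \<open>EA F\<close> on both sides, and
  \<open>EA F\<close> cuts \<open>V G\<close> and \<open>W G\<close> down to \<open>V F\<close> and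
  \<open>W F\<close>. So enlarging the index set does not change the conjugate.\<close>

lemma related_mono:
  assumes r: "related F a b" and G: "finite G" "G \<subseteq> \<Gamma>" "F \<subseteq> G"
  shows "related G a b"
proof -
  have F: "finite F" "F \<subseteq> \<Gamma>" and ab: "a \<in> A" "b \<in> B"
    and a: "A.PF F o\<^sub>L a = a" "a o\<^sub>L A.PF F = a"
    and b: "B.PF (\<sigma> ` F) o\<^sub>L b = b" "b o\<^sub>L B.PF (\<sigma> ` F) = b"
    and V: "V F o\<^sub>L (\<phi> (a \<otimes>\<^sub>o e) o\<^sub>L W F) = b \<otimes>\<^sub>o e"
    using r by (auto simp: related_def)
  have \<sigma>F: "finite (\<sigma> ` F)" "\<sigma> ` F \<subseteq> \<Delta>" and \<sigma>G: "finite (\<sigma> ` G)" "\<sigma> ` G \<subseteq> \<Delta>"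
    using F G \<sigma>_in by auto
  have "A.PF G o\<^sub>L A.PF F = A.PF F" "A.PF F o\<^sub>L A.PF G = A.PF F"
    using F G by (simp_all add: A.PF_compose Int_absorb1 Int_absorb2)
  then have 1: "A.PF G o\<^sub>L a = a" "a o\<^sub>L A.PF G = a" using a by (metis compose_assoc)+
  have "\<sigma> ` F \<subseteq> \<sigma> ` G" using G(3) by blast
  then have "B.PF (\<sigma> ` G) o\<^sub>L B.PF (\<sigma> ` F) = B.PF (\<sigma> ` F)" "B.PF (\<sigma> ` F) o\<^sub>L B.PF (\<sigma> ` G) = B.PF (\<sigma> ` F)"
    using \<sigma>F \<sigma>G by (simp_all add: B.PF_compose Int_absorb1 Int_absorb2)
  then have 2: "B.PF (\<sigma> ` G) o\<^sub>L b = b" "b o\<^sub>L B.PF (\<sigma> ` G) = b" using b by (metis compose_assoc)+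
  have "V G o\<^sub>L (\<phi> (a \<otimes>\<^sub>o e) o\<^sub>L W G) = V G o\<^sub>L ((EA F o\<^sub>L (\<phi> (a \<otimes>\<^sub>o e) o\<^sub>L EA F)) o\<^sub>L W G)"
    by (simp only: EA_absorb[OF F ab(1)] a)
  also have "\<dots> = (V G o\<^sub>L EA F) o\<^sub>L (\<phi> (a \<otimes>\<^sub>o e) o\<^sub>L (EA F o\<^sub>L W G))"
    by (simp only: compose_assoc)
  also have "\<dots> = b \<otimes>\<^sub>o e" by (simp only: V_EA EA_W G V)
  finally show ?thesis using 1 2 G ab by (simp add: related_def)
qed

text \<open>Conjugating back produces \<open>W F V F = EA F\<close> on both sides, which is
  absorbed.\<close>

lemma related_inverse:
  assumes r: "related F a b"
  shows "W F o\<^sub>L ((b \<otimes>\<^sub>o e) o\<^sub>L V F) = \<phi> (a \<otimes>\<^sub>o e)"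
proof -
  have F: "finite F" "F \<subseteq> \<Gamma>" and ab: "a \<in> A"
    and a: "A.PF F o\<^sub>L a = a" "a o\<^sub>L A.PF F = a"
    and V: "V F o\<^sub>L (\<phi> (a \<otimes>\<^sub>o e) o\<^sub>L W F) = b \<otimes>\<^sub>o e"
    using r by (auto simp: related_def)
  have "W F o\<^sub>L ((b \<otimes>\<^sub>o e) o\<^sub>L V F) = (W F o\<^sub>L V F) o\<^sub>L (\<phi> (a \<otimes>\<^sub>o e) o\<^sub>L (W F o\<^sub>L V F))"
    by (simp only: V[symmetric] compose_assoc)
  also have "\<dots> = \<phi> (a \<otimes>\<^sub>o e)" by (simp only: W_V F EA_absorb[OF F ab] a)
  finally show ?thesis .
qed

text \<open>Each of the two elements is obtained from the other by multiplication with contractions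
  on both sides.\<close>

lemma related_norm:
  assumes r: "related F a b"
  shows "norm b = norm a"
proof -
  have F: "finite F" "F \<subseteq> \<Gamma>" and ab: "a \<in> A" "b \<in> B"
    and V: "V F o\<^sub>L (\<phi> (a \<otimes>\<^sub>o e) o\<^sub>L W F) = b \<otimes>\<^sub>o e"
    using r by (auto simp: related_def)
  have n: "norm (b \<otimes>\<^sub>o e) = norm b" "norm (\<phi> (a \<otimes>\<^sub>o e)) = norm a"
    using ab by (simp_all add: norm_map_tensor_rank_one \<xi> A.bounded B.bounded \<phi>_norm tensor_A)
  have "norm (b \<otimes>\<^sub>o e) \<le> norm (\<phi> (a \<otimes>\<^sub>o e))"
    unfolding V[symmetric] by (rule norm_compression_le[OF norm_V_W[OF F]])
  moreover have "norm (\<phi> (a \<otimes>\<^sub>o e)) \<le> norm (b \<otimes>\<^sub>o e)"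
    unfolding related_inverse[OF r, symmetric] by (rule norm_compression_le[OF norm_V_W(2,1)[OF F]])
  ultimately show ?thesis by (simp add: n)
qed

lemma related_add:
  assumes "related F a b" "related F a' b'"
  shows "related F (a + a') (b + b')"
  using assms unfolding related_def
  by (simp add: compose_add_left compose_add_right complex_vector.subspace_add[OF A.subspace]
      complex_vector.subspace_add[OF B.subspace] map_tensor_add_left A.bounded B.bounded \<phi>_add tensor_A)

lemma related_scale:
  assumes "related F a b"
  shows "related F (c *\<^sub>C a) (c *\<^sub>C b)"
proof -
  have F: "finite F" "F \<subseteq> \<Gamma>" using assms by (auto simp: related_def)
  then have \<sigma>F: "finite (\<sigma> ` F)" "\<sigma> ` F \<subseteq> \<Delta>" using \<sigma>_in by auto
  show ?thesis
    using assms \<sigma>F unfolding related_def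
    by (simp add: compose_scaleC_right complex_vector.subspace_scale[OF A.subspace]
      complex_vector.subspace_scale[OF B.subspace] map_tensor_scaleC_left A.bounded B.bounded \<phi>_scale
      tensor_A A.PF_bounded B.PF_bounded B.stabilization_bounded V_in)
qed

text \<open>Between the two conjugated factors stands \<open>W F V F = EA F\<close>, which the
  second factor absorbs.\<close>

lemma related_compose:
  assumes r: "related F a b" and r': "related F a' b'"
  shows "related F (a o\<^sub>L a') (b o\<^sub>L b')"
proof -
  have F: "finite F" "F \<subseteq> \<Gamma>" and ab: "a \<in> A" "b \<in> B" "a' \<in> A" "b' \<in> B"
    and a: "A.PF F o\<^sub>L a = a" "a' o\<^sub>L A.PF F = a'" "A.PF F o\<^sub>L a' = a'"
    and b: "B.PF (\<sigma> ` F) o\<^sub>L b = b" "b' o\<^sub>L B.PF (\<sigma> ` F) = b'"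
    and V: "V F o\<^sub>L (\<phi> (a \<otimes>\<^sub>o e) o\<^sub>L W F) = b \<otimes>\<^sub>o e" "V F o\<^sub>L (\<phi> (a' \<otimes>\<^sub>o e) o\<^sub>L W F) = b' \<otimes>\<^sub>o e"
    using r r' by (auto simp: related_def)
  have "(b o\<^sub>L b') \<otimes>\<^sub>o e = (b \<otimes>\<^sub>o e) o\<^sub>L (b' \<otimes>\<^sub>o e)"
    by (simp add: tensor_compose B.bounded ab)
  also have "\<dots> = V F o\<^sub>L (\<phi> (a \<otimes>\<^sub>o e) o\<^sub>L (((W F o\<^sub>L V F) o\<^sub>L \<phi> (a' \<otimes>\<^sub>o e)) o\<^sub>L W F))"
    by (simp only: V[symmetric] compose_assoc)
  also have "\<dots> = V F o\<^sub>L ((\<phi> (a \<otimes>\<^sub>o e) o\<^sub>L \<phi> (a' \<otimes>\<^sub>o e)) o\<^sub>L W F)"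
    by (simp only: W_V F EA_absorb[OF F ab(3)] a compose_assoc)
  also have "\<phi> (a \<otimes>\<^sub>o e) o\<^sub>L \<phi> (a' \<otimes>\<^sub>o e) = \<phi> ((a o\<^sub>L a') \<otimes>\<^sub>o e)"
    by (simp add: tensor_compose A.bounded ab tensor_A flip: \<phi>_compose)
  finally have "V F o\<^sub>L (\<phi> ((a o\<^sub>L a') \<otimes>\<^sub>o e) o\<^sub>L W F) = (b o\<^sub>L b') \<otimes>\<^sub>o e" by (rule sym)
  moreover have "A.PF F o\<^sub>L (a o\<^sub>L a') = a o\<^sub>L a'" "B.PF (\<sigma> ` F) o\<^sub>L (b o\<^sub>L b') = b o\<^sub>L b'"
    by (simp_all add: a b flip: compose_assoc)
  moreover have "(a o\<^sub>L a') o\<^sub>L A.PF F = a o\<^sub>L a'" "(b o\<^sub>L b') o\<^sub>L B.PF (\<sigma> ` F) = b o\<^sub>L b'"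
    by (simp_all add: a b compose_assoc)
  ultimately show ?thesis
    using F ab by (simp add: related_def A.compose B.compose)
qed

text \<open>The conjugate lies in the stabilization of \<open>B\<close> and is fixed by
  \<open>EB F\<close> on both sides, so \<open>B.stabilization_corner\<close> writes it as
  \<open>b \<otimes> e\<close>.\<close>

lemma related_total:
  assumes F: "finite F" "F \<subseteq> \<Gamma>" and a: "a \<in> A" "A.PF F o\<^sub>L a = a" "a o\<^sub>L A.PF F = a"
  shows "\<exists>b. related F a b"
proof -
  let ?T = "V F o\<^sub>L (\<phi> (a \<otimes>\<^sub>o e) o\<^sub>L W F)"
  have \<sigma>F: "finite (\<sigma> ` F)" "\<sigma> ` F \<subseteq> \<Delta>" using F \<sigma>_in by auto
  have T: "?T \<in> stabilization B"
    using F a by (intro B.stabilization_compose V_in W_in \<phi>_in tensor_A)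
  have "EB F o\<^sub>L ?T = (V F o\<^sub>L (W F o\<^sub>L V F)) o\<^sub>L (\<phi> (a \<otimes>\<^sub>o e) o\<^sub>L W F)"
    by (simp only: V_W[OF F, symmetric] compose_assoc)
  also have "\<dots> = ?T" by (simp only: W_V F V_EA order_refl)
  finally have 1: "EB F o\<^sub>L ?T = ?T" .
  have "?T o\<^sub>L EB F = V F o\<^sub>L (\<phi> (a \<otimes>\<^sub>o e) o\<^sub>L ((W F o\<^sub>L V F) o\<^sub>L W F))"
    by (simp only: V_W[OF F, symmetric] compose_assoc)
  also have "\<dots> = ?T" by (simp only: W_V F EA_W order_refl)
  finally have 2: "?T o\<^sub>L EB F = ?T" .
  obtain b where "b \<in> B" "?T = b \<otimes>\<^sub>o e" "B.PF (\<sigma> ` F) o\<^sub>L b = b" "b o\<^sub>L B.PF (\<sigma> ` F) = b"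
    by (rule B.stabilization_corner[OF T \<xi> B.PF_bounded[OF \<sigma>F] B.PF_bounded[OF \<sigma>F] 1 2])
  then show ?thesis using F a unfolding related_def by blast
qed

text \<open>The conjugate of \<open>b \<otimes> e\<close> by \<open>W F\<close> has a preimage under
  \<open>\<phi>\<close>. Injectivity of \<open>\<phi>\<close> turns its absorption of
  \<open>EA F\<close> into a corner relation in the stabilization of \<open>A\<close>, which
  produces \<open>a\<close>.\<close>

lemma related_onto:
  assumes F: "finite F" "F \<subseteq> \<Gamma>"
    and b: "b \<in> B" "B.PF (\<sigma> ` F) o\<^sub>L b = b" "b o\<^sub>L B.PF (\<sigma> ` F) = b"
  shows "\<exists>a. related F a b"
proof -
  let ?T = "W F o\<^sub>L ((b \<otimes>\<^sub>o e) o\<^sub>L V F)"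
  have \<sigma>F: "finite (\<sigma> ` F)" "\<sigma> ` F \<subseteq> \<Delta>" using F \<sigma>_in by auto
  have "?T \<in> stabilization B"
    using F b by (intro B.stabilization_compose V_in W_in tensor_B)
  then obtain S where S: "S \<in> stabilization A" "\<phi> S = ?T"
    using bij_betw_imp_surj_on[OF bij] by (metis imageE)
  have P: "A.PF F \<otimes>\<^sub>o e \<in> stabilization A" using F by (intro tensor_A A.PF_in)
  have "EA F o\<^sub>L ?T = ?T" by (simp only: compose_assoc[symmetric] EA_W F order_refl)
  then have 1: "(A.PF F \<otimes>\<^sub>o e) o\<^sub>L S = S"
    using S P C_compose by (simp add: \<phi>_compose flip: \<phi>_inject)
  have "?T o\<^sub>L EA F = ?T" by (simp only: compose_assoc V_EA F order_refl)
  then have 2: "S o\<^sub>L (A.PF F \<otimes>\<^sub>o e) = S"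
    using S P C_compose by (simp add: \<phi>_compose flip: \<phi>_inject)
  obtain a where a: "a \<in> A" "S = a \<otimes>\<^sub>o e" "A.PF F o\<^sub>L a = a" "a o\<^sub>L A.PF F = a"
    by (rule A.stabilization_corner[OF S(1) \<xi> A.PF_bounded[OF F] A.PF_bounded[OF F] 1 2])
  have "V F o\<^sub>L (\<phi> (a \<otimes>\<^sub>o e) o\<^sub>L W F) = (V F o\<^sub>L W F) o\<^sub>L ((b \<otimes>\<^sub>o e) o\<^sub>L (V F o\<^sub>L W F))"
    by (simp only: a(2)[symmetric] S(2) compose_assoc)
  also have "\<dots> = b \<otimes>\<^sub>o e"
    using b \<sigma>F by (simp add: V_W F tensor_compose B.bounded B.PF_bounded)
  finally show ?thesis using F a b unfolding related_def by blast
qed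

text \<open>The union of the relations over all finite \<open>F\<close> is a dense isometric graph:
  any two members live over a common index set, and compressions by finite sums of minimal
  projections are dense on both sides.\<close>

lemma isometrically_isomorphic_A_B: "isometrically_isomorphic A B"
proof (rule isometrically_isomorphic_if_dense_graph[OF A.algebra B.algebra])
  let ?R = "{(a, b). \<exists>F. related F a b}"
  show "?R \<subseteq> A \<times> B" by (auto simp: related_def)
  show "norm b = norm a" if "(a, b) \<in> ?R" for a b using that by (auto intro: related_norm)
  show "(c *\<^sub>C a, c *\<^sub>C b) \<in> ?R" if "(a, b) \<in> ?R" for c a b using that by (auto intro: related_scale)
  have common: "\<exists>F. related F a b \<and> related F a' b'" if "(a, b) \<in> ?R" "(a', b') \<in> ?R" for a b a' b'
  proof -
    from that obtain F G where F: "related F a b" and G: "related G a' b'" by auto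
    then have FG: "finite (F \<union> G)" "F \<union> G \<subseteq> \<Gamma>" by (auto simp: related_def)
    then have "related (F \<union> G) a b" "related (F \<union> G) a' b'"
      using related_mono[OF F FG] related_mono[OF G FG] by auto
    then show ?thesis by blast
  qed
  show "(a + a', b + b') \<in> ?R" if "(a, b) \<in> ?R" "(a', b') \<in> ?R" for a b a' b'
    using common[OF that] by (auto intro: related_add)
  show "(a o\<^sub>L a', b o\<^sub>L b') \<in> ?R" if "(a, b) \<in> ?R" "(a', b') \<in> ?R" for a b a' b'
    using common[OF that] by (auto intro: related_compose)
  show "\<exists>(a', b')\<in>?R. norm (a - a') < \<epsilon>" if a: "a \<in> A" and \<epsilon>: "\<epsilon> > 0" for a \<epsilon>
  proof -
    obtain F where F: "finite F" "F \<subseteq> \<Gamma>" "norm (a - (A.PF F o\<^sub>L (a o\<^sub>L A.PF F))) < \<epsilon>"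
      using A.PF_approximates[OF a \<epsilon>] by blast
    obtain b where "related F (A.PF F o\<^sub>L (a o\<^sub>L A.PF F)) b"
      using related_total[OF F(1,2) A.PF_compression[OF F(1,2) a]] by (elim exE)
    then show ?thesis using F(3) by (intro bexI[of _ "(A.PF F o\<^sub>L (a o\<^sub>L A.PF F), b)"]) auto
  qed
  show "\<exists>(a', b')\<in>?R. norm (b - b') < \<epsilon>" if b: "b \<in> B" and \<epsilon>: "\<epsilon> > 0" for b \<epsilon>
  proof -
    obtain G where G: "finite G" "G \<subseteq> \<Delta>" "norm (b - (B.PF G o\<^sub>L (b o\<^sub>L B.PF G))) < \<epsilon>"
      using B.PF_approximates[OF b \<epsilon>] by blast
    \<comment> \<open>Surjectivity of \<open>\<sigma>\<close> makes every finite set of indices on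
      the side of \<open>B\<close> the image of a finite set on the side of
      \<open>A\<close>.\<close>
    then obtain F where F: "F \<subseteq> \<Gamma>" "finite F" "G = \<sigma> ` F"
      using finite_subset_image[of G \<sigma> \<Gamma>] bij_betw_imp_surj_on[OF \<sigma>] by metis
    obtain a where "related F a (B.PF G o\<^sub>L (b o\<^sub>L B.PF G))"
      using related_onto[OF F(2,1), folded F(3), OF B.PF_compression[OF G(1,2) b]] by (elim exE)
    then show ?thesis using G(3) by (intro bexI[of _ "(a, B.PF G o\<^sub>L (b o\<^sub>L B.PF G))"]) auto
  qed
qed

end

lemma star_isomorphic_c0D:
  assumes "operator_algebra A" "star_isomorphic_c0 (diag A) \<Gamma>"
  shows "\<exists>\<pi>. c0_diagonal A \<Gamma> \<pi>"
  using assms(2) unfolding star_isomorphic_c0_def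
proof (elim exE, goal_cases)
  case (1 \<pi>)
  with assms(1) have "c0_diagonal A \<Gamma> \<pi>" by unfold_locales simp_all
  then show ?case by (rule exI[of "c0_diagonal A \<Gamma>" \<pi>])
qed

theorem theorem2p5:
  fixes A :: "('a::chilbert_space \<Rightarrow>\<^sub>L 'a) set"
    and B :: "('b::chilbert_space \<Rightarrow>\<^sub>L 'b) set"
  assumes "operator_algebra A" and "operator_algebra B"
    and "\<exists>\<Gamma> :: 'g set. star_isomorphic_c0 (diag A) \<Gamma>"
    and "\<exists>\<Delta> :: 'h set. star_isomorphic_c0 (diag B) \<Delta>"
    and "separable_space (euclidean :: 'k::chilbert_space topology)"
    and "\<not> (\<exists>X :: 'k set. finite X \<and> cspan X = UNIV)"
    and "isometrically_isomorphic
           (spatial_tensor A (compact_operators :: ('k \<Rightarrow>\<^sub>L 'k) set))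
           (spatial_tensor B (compact_operators :: ('k \<Rightarrow>\<^sub>L 'k) set))"
  shows "isometrically_isomorphic A B"
proof -
  obtain \<Gamma> :: "'g set" and \<pi> where A: "c0_diagonal A \<Gamma> \<pi>"
    using assms(1,3) star_isomorphic_c0D by blast
  obtain \<Delta> :: "'h set" and \<rho> where B: "c0_diagonal B \<Delta> \<rho>"
    using assms(2,4) star_isomorphic_c0D by blast
  obtain \<phi> where \<phi>: "isometric_isomorphism \<phi>
      (spatial_tensor A (compact_operators :: ('k \<Rightarrow>\<^sub>L 'k) set))
      (spatial_tensor B (compact_operators :: ('k \<Rightarrow>\<^sub>L 'k) set))"
    using assms(7) by (auto simp: isometrically_isomorphic_iff)
  \<comment> \<open>Infinite dimension supplies a nonzero vector, which is then normalized: a zero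
    space would be spanned by the finite set \<open>{0}\<close>.\<close>
  have "cspan {0 :: 'k} \<noteq> UNIV" using assms(6) by blast
  then obtain x :: 'k where "x \<notin> cspan {0}" by blast
  then have x: "x \<noteq> 0" using complex_vector.span_zero by auto
  define \<xi> where "\<xi> = complex_of_real (1 / norm x) *\<^sub>C x"
  have \<xi>: "norm \<xi> = 1" using x by (simp add: \<xi>_def norm_divide)
  interpret stable_isomorphism A \<Gamma> \<pi> B \<Delta> \<rho> \<phi> \<xi>
    using A B \<phi> \<xi> c0_diagonal.stabilization_algebra[OF A]
    by (intro stable_isomorphism.intro isometric_iso.intro stable_isomorphism_axioms.intro)
  obtain \<sigma> where \<sigma>: "bij_betw \<sigma> \<Gamma> \<Delta>"
    "\<forall>\<gamma>\<in>\<Gamma>. mvn_equiv (stabilization B) (B.P (\<sigma> \<gamma>) \<otimes>\<^sub>o rank_one \<xi> \<xi>) (\<phi> (A.P \<gamma> \<otimes>\<^sub>o rank_one \<xi> \<xi>))"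
    using ex_matching by blast
  \<comment> \<open>Each partial isometry and its partner are bundled into one pair, so that a
    single choice over \<open>\<Gamma>\<close> selects them together.\<close>
  from \<sigma>(2) have "\<forall>\<gamma>\<in>\<Gamma>. \<exists>p. fst p \<in> stabilization B \<and> snd p \<in> stabilization B \<and>
    contractive_pair (fst p) (snd p) \<and> fst p o\<^sub>L snd p = B.P (\<sigma> \<gamma>) \<otimes>\<^sub>o rank_one \<xi> \<xi> \<and>
    snd p o\<^sub>L fst p = \<phi> (A.P \<gamma> \<otimes>\<^sub>o rank_one \<xi> \<xi>)"
    unfolding mvn_equiv_def by (simp add: Bex_def)
  from bchoice[OF this] obtain p where p: "\<forall>\<gamma>\<in>\<Gamma>. fst (p \<gamma>) \<in> stabilization B \<and>
    snd (p \<gamma>) \<in> stabilization B \<and> contractive_pair (fst (p \<gamma>)) (snd (p \<gamma>)) \<and>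
    fst (p \<gamma>) o\<^sub>L snd (p \<gamma>) = B.P (\<sigma> \<gamma>) \<otimes>\<^sub>o rank_one \<xi> \<xi> \<and>
    snd (p \<gamma>) o\<^sub>L fst (p \<gamma>) = \<phi> (A.P \<gamma> \<otimes>\<^sub>o rank_one \<xi> \<xi>)" by (elim exE)
  interpret matched_stable_isomorphism A \<Gamma> \<pi> B \<Delta> \<rho> \<phi> \<xi> \<sigma> "\<lambda>\<gamma>. fst (p \<gamma>)" "\<lambda>\<gamma>. snd (p \<gamma>)"
    by unfold_locales (use \<sigma>(1) p in simp_all)
  show ?thesis by (rule isometrically_isomorphic_A_B)
qed

end
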